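(* Let $\mathcal M$ be a Beurling type invariant subspace of $F^2_s(H_{n_1})\otimes\cdots\otimes F^2_s(H_{n_k})\otimes\mathcal E$, where $\mathcal E$ is a finite dimensional Hilbert space. Then the multiplicity $m_c(\mathcal M)$ exists (i.e. the limit defining it exists) and satisfies the equations $$m_c(\mathcal M)=\lim_{(q_1,\ldots,q_k)\in\mathbb Z_+^k}\frac{\mathrm{trace}\left[P_{\mathcal M}(Q^{(1)}_{q_1}\otimes\cdots\otimes Q^{(k)}_{q_k}\otimes I_{\mathcal E})\right]}{\mathrm{trace}\left[Q^{(1)}_{q_1}\otimes\cdots\otimes Q^{(k)}_{q_k}\right]}$$ $$=\lim_{q_1\to\infty}\cdots\lim_{q_k\to\infty}\frac{\mathrm{trace}\left[P_{\mathcal M}(Q_{\le(q_1,\ldots,q_k)}\otimes I_{\mathcal E})\right]}{\mathrm{trace}\left[Q_{\le(q_1,\ldots,q_k)}\right]}$$ $$=\lim_{m\to\infty}\frac1{\binom{m+k-1}{k-1}}\sum_{\substack{q_1\ge0,\ldots,q_k\ge0\\ q_1+\cdots+q_k=m}}\frac{\mathrm{trace}\left[P_{\mathcal M}(Q^{(1)}_{q_1}\otimes\cdots\otimes Q^{(k)}_{q_k}\otimes I_{\mathcal E})\right]}{\mathrm{trace}\left[Q^{(1)}_{q_1}\otimes\cdots\otimes Q^{(k)}_{q_k}\right]}$$ $$=\dim\mathcal E-\mathrm{curv}_c(\mathbf M),$$ where $\mathbf M:=(M_1,\ldots,M_k)$ with $M_i:=(M_{i,1},\ldots,M_{i,n_i})$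 and $M_{i,j}:=P_{\mathcal M^\perp}(\mathbf B_{i,j}\otimes I_{\mathcal E})|_{\mathcal M^\perp}$.
   Context: All Hilbert spaces are complex; $\mathbb N=\{1,2,\ldots\}$, $\mathbb Z_+=\{0,1,\ldots\}$. Fix $k\in\mathbb N$ and $\mathbf n=(n_1,\ldots,n_k)\in\mathbb N^k$ with at least one $n_i\ge2$. $F^2(H_{n_i})=\mathbb C1\oplus\bigoplus_{p\ge1}H_{n_i}^{\otimes p}$ is the full Fock space of an $n_i$-dimensional Hilbert space $H_{n_i}$ with orthonormal basis $e^i_1,\ldots,e^i_{n_i}$, and $F^2_s(H_{n_i})\subset F^2(H_{n_i})$ is the symmetric Fock space (closed span of symmetric tensors). $\mathbb F_{n_i}^+$ is the free unital semigroup on generators $g_1^i,\ldots,g_{n_i}^i$; for $\alpha=g^i_{j_1}\cdots g^i_{j_p}$ put $e^i_\alpha=e^i_{j_1}\otimes\cdots\otimes e^i_{j_p}$, and $e^i_\alpha=1$ for the neutral element. Let $S_{i,j}e^i_\alpha=e^i_{g^i_j\alpha}$, $B_{i,j}=P_{F^2_s(H_{n_i})}S_{i,j}|_{F^2_s(H_{n_i})}$, and $\mathbf B_{i,j}=I\otimes\cdots\otimes B_{i,j}\otimes\cdots\otimes I$ ($B_{i,j}$ in position $i$) on $\bigotimes_{i=1}^kF_s^2(H_{n_i})$. A bounded operator $\Psi:\bigotimes_iF^2_s(H_{n_i})\otimes\mathcal G\to\bigotimes_iF^2_s(H_{n_i})\otimes\mathcal G'$ is multi-analytic with respect to $\mathbf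 B$ if $\Psi(\mathbf B_{i,j}\otimes I_{\mathcal G})=(\mathbf B_{i,j}\otimes I_{\mathcal G'})\Psi$ for all $i,j$. A subspace $\mathcal M\subset\bigotimes_iF^2_s(H_{n_i})\otimes\mathcal E$ is a Beurling type invariant subspace if $\mathcal M=\Psi[\bigotimes_iF^2_s(H_{n_i})\otimes\mathcal G]$ for some Hilbert space $\mathcal G$ and some partially isometric multi-analytic operator $\Psi$. $P_{\mathcal M}$ is the orthogonal projection onto $\mathcal M$. $Q^{(i)}_q$ is the orthogonal projection of $F^2_s(H_{n_i})$ onto its homogeneous component of degree $q$, and $Q_{\le(q_1,\ldots,q_k)}=\sum_{0\le s_i\le q_i}Q^{(1)}_{s_1}\otimes\cdots\otimes Q^{(k)}_{s_k}$. The multiplicity of a Beurling type invariant subspace is defined by $$m_c(\mathcal M):=\lim_{m\to\infty}\frac1{\binom{m+k}{k}}\sum_{\substack{q_1\ge0,\ldots,q_k\ge0\\ q_1+\cdots+q_k\le m}}\frac{\mathrm{trace}\left[P_{\mathcal M}(Q^{(1)}_{q_1}\otimes\cdots\otimes Q^{(k)}_{q_k}\otimes I_{\mathcal E})\right]}{\prod_{i=1}^k\mathrm{trace}(Q^{(i)}_{q_i})}.$$ For $X_i=(X_{i,1},\ldots,X_{i,n_i})\in B(\mathcal H)^{n_i}$ let $\Phi_{X_i}(Y)=\sum_{j=1}^{n_i}X_{i,j}YX_{i,j}^*$. The commutative polyball $\mathbf B^c_{\mathbf n}(\mathcal H)$ is the set of all $\mathbf X=(X_1,\ldots,X_k)$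 with $X_i\in B(\mathcal H)^{n_i}$, all entries $X_{i,j}$ commuting, and $(id-\Phi_{X_1})^{p_1}\circ\cdots\circ(id-\Phi_{X_k})^{p_k}(I)\ge0$ for all $(p_1,\ldots,p_k)\in\{0,1\}^k$. Put $\mathbf\Delta_{\mathbf X}=(id-\Phi_{X_1})\circ\cdots\circ(id-\Phi_{X_k})$ and $\mathcal D_{\mathbf X}=\overline{\mathbf\Delta_{\mathbf X}(I)\mathcal H}$. For $\mathbf T\in\mathbf B^c_{\mathbf n}(\mathcal H)$, with $T_{i,\alpha}=T_{i,j_1}\cdots T_{i,j_p}$ for $\alpha=g^i_{j_1}\cdots g^i_{j_p}$ ($T_{i,\alpha}=I$ for the neutral element), the constrained Berezin kernel is $\widetilde{\mathbf K}_{\mathbf T}=(P_{\bigotimes_iF^2_s(H_{n_i})}\otimes I_{\mathcal D_{\mathbf T}})\mathbf K_{\mathbf T}:\mathcal H\to\bigotimes_iF^2_s(H_{n_i})\otimes\mathcal D_{\mathbf T}$, where $$\mathbf K_{\mathbf T}h=\sum_{\beta_i\in\mathbb F_{n_i}^+,\,i=1,\ldots,k}e^1_{\beta_1}\otimes\cdots\otimes e^k_{\beta_k}\otimes\mathbf\Delta_{\mathbf T}(I)^{1/2}T_{1,\beta_1}^*\cdots T_{k,\beta_k}^*h.$$ $\mathbf T$ has a constrained characteristic function if $\widetilde{\mathbf K}_{\mathbf T}\widetilde{\mathbf K}_{\mathbf T}^*+\widetilde\Theta\widetilde\Theta^*=I$ for some multi-analytic operator $\widetilde\Theta$ (with respect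 to $\mathbf B$) into $\bigotimes_iF^2_s(H_{n_i})\otimes\mathcal D_{\mathbf T}$. For such $\mathbf T$ with $\mathbf\Delta_{\mathbf T}(I)$ of finite rank, $$\mathrm{curv}_c(\mathbf T):=\lim_{m\to\infty}\frac1{\binom{m+k}{k}}\sum_{\substack{q_1\ge0,\ldots,q_k\ge0\\ q_1+\cdots+q_k\le m}}\frac{\mathrm{trace}\left[\widetilde{\mathbf K}_{\mathbf T}^*(Q^{(1)}_{q_1}\otimes\cdots\otimes Q^{(k)}_{q_k}\otimes I_{\mathcal D_{\mathbf T}})\widetilde{\mathbf K}_{\mathbf T}\right]}{\mathrm{trace}\left[Q^{(1)}_{q_1}\otimes\cdots\otimes Q^{(k)}_{q_k}\right]}$$ (this limit exists). Limits over $\mathbb Z_+^k$ are limits of nets for the coordinatewise order. *)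

theory Defs
  imports "HOL-Analysis.Analysis" "HOL-Combinatorics.Permutations"
begin

section \<open>Complex Hilbert spaces\<close>

text \<open>The inner product is linear in its first argument. Its real part is the real inner
  product of the class \<open>real_inner\<close>, so that norm, topology and completeness are those of
  the library.\<close>

class chilbert_space = real_inner + complete_space +
  fixes scaleC :: "complex \<Rightarrow> 'a \<Rightarrow> 'a"  (infixr "*\<^sub>C" 75)
    and cinner :: "'a \<Rightarrow> 'a \<Rightarrow> complex"
  assumes scaleC_add_right: "a *\<^sub>C (x + y) = a *\<^sub>C x + a *\<^sub>C y"
    and scaleC_add_left: "(a + b) *\<^sub>C x = a *\<^sub>C x + b *\<^sub>C x"
    and scaleC_scaleC: "a *\<^sub>C (b *\<^sub>C x) = (a * b) *\<^sub>C x"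
    and scaleC_of_real: "of_real r *\<^sub>C x = r *\<^sub>R x"
    and cinner_commute: "cinner x y = cnj (cinner y x)"
    and cinner_add_left: "cinner (x + y) z = cinner x z + cinner y z"
    and cinner_scaleC_left: "cinner (a *\<^sub>C x) y = a * cinner x y"
    and inner_eq_Re_cinner: "inner x y = Re (cinner x y)"

lemma scaleC_one: "1 *\<^sub>C x = (x :: 'a::chilbert_space)"
  using scaleC_of_real[of 1 x] by simp

interpretation cvec: vector_space "scaleC :: complex \<Rightarrow> 'a \<Rightarrow> 'a::chilbert_space"
  by unfold_locales (simp_all add: scaleC_add_right scaleC_add_left scaleC_scaleC scaleC_one)

lemma cinner_self: "cinner x x = of_real ((norm (x :: 'a::chilbert_space))\<^sup>2)"
proof (rule complex_eqI)
  show "Re (cinner x x) = Re (of_real ((norm x)\<^sup>2))"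
    by (simp add: power2_norm_eq_inner inner_eq_Re_cinner)
  have "Im (cinner x x) = - Im (cinner x x)"
    using arg_cong[OF cinner_commute[of x x], of Im] by simp
  then show "Im (cinner x x) = Im (of_real ((norm x)\<^sup>2))" by simp
qed

lemma norm_scaleC: "norm (a *\<^sub>C x) = cmod a * norm (x :: 'a::chilbert_space)"
proof -
  have "of_real ((norm (a *\<^sub>C x))\<^sup>2) = a * (cnj a * cinner x x)"
    unfolding cinner_self[symmetric] cinner_scaleC_left
    by (subst cinner_commute) (simp add: cinner_scaleC_left cinner_self)
  also have "\<dots> = of_real ((cmod a * norm x)\<^sup>2)"
    by (simp only: cinner_self power_mult_distrib mult.assoc[symmetric] of_real_mult
        complex_norm_square)
  finally have "(norm (a *\<^sub>C x))\<^sup>2 = (cmod a * norm x)\<^sup>2"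
    using of_real_eq_iff by blast
  then show ?thesis by (simp add: power2_eq_iff_nonneg)
qed

lemma cinner_add_right: "cinner x (y + z) = cinner x y + cinner x (z :: 'a::chilbert_space)"
  by (metis cinner_commute cinner_add_left complex_cnj_add)

lemma cinner_scaleC_right: "cinner x (a *\<^sub>C y) = cnj a * cinner x (y :: 'a::chilbert_space)"
  by (metis cinner_commute cinner_scaleC_left complex_cnj_mult)

lemma norm_cinner_le: "cmod (cinner x y) \<le> norm x * norm (y :: 'a::chilbert_space)"
proof (cases "cinner x y = 0")
  case False
  define a where "a = cnj (sgn (cinner x y))"
  have na: "cmod a = 1" using False by (simp add: a_def norm_sgn)
  have "cnj (sgn (cinner x y)) * cinner x y = of_real (cmod (cinner x y))"
    using False complex_norm_square[of "cinner x y"]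
    by (simp add: sgn_eq power2_eq_square field_simps)
  then have "cmod (cinner x y) = inner (a *\<^sub>C x) y"
    by (simp add: inner_eq_Re_cinner cinner_scaleC_left a_def)
  also have "\<dots> \<le> norm (a *\<^sub>C x) * norm y" by (rule norm_cauchy_schwarz)
  finally show ?thesis by (simp add: norm_scaleC na)
qed simp

instantiation complex :: chilbert_space
begin

definition scaleC_complex :: "complex \<Rightarrow> complex \<Rightarrow> complex" where
  "scaleC_complex = (*)"

definition cinner_complex :: "complex \<Rightarrow> complex \<Rightarrow> complex" where
  "cinner_complex x y = x * cnj y"

instance
  by standard (auto simp: scaleC_complex_def cinner_complex_def algebra_simps
      scaleR_conv_of_real inner_complex_def)

end


section \<open>The Hilbert space of square-summable families\<close>

text \<open>The elements of \<open>('i, 'e) ell2\<close> are the families \<open>f :: 'i \<Rightarrow> 'e\<close> with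
  \<open>\<Sum>i. \<parallel>f i\<parallel>\<^sup>2 < \<infinity>\<close>. This is the Hilbert space tensor product of the space with orthonormal
  basis indexed by \<open>'i\<close> and the Hilbert space \<open>'e\<close>.\<close>

typedef (overloaded) ('i, 'e::chilbert_space) ell2 =
    "{f :: 'i \<Rightarrow> 'e. (\<lambda>i. (norm (f i))\<^sup>2) summable_on UNIV}"
  morphisms coord Abs_ell2
  by (intro exI[of _ "\<lambda>_. 0"]) simp

setup_lifting type_definition_ell2

lemma coord_summable: "(\<lambda>i. (norm (coord f i))\<^sup>2) summable_on UNIV"
  using coord[of f] by simp

lemma ell2_add_closed:
  fixes f g :: "'i \<Rightarrow> 'e::chilbert_space"
  assumes "(\<lambda>i. (norm (f i))\<^sup>2) summable_on UNIV" "(\<lambda>i. (norm (g i))\<^sup>2) summable_on UNIV"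
  shows "(\<lambda>i. (norm (f i + g i))\<^sup>2) summable_on UNIV"
proof (rule summable_on_comparison_test)
  show "(\<lambda>i. 2 * (norm (f i))\<^sup>2 + 2 * (norm (g i))\<^sup>2) summable_on UNIV"
    by (intro summable_on_add summable_on_cmult_right assms)
  fix i
  have "(norm (f i + g i))\<^sup>2 \<le> (norm (f i) + norm (g i))\<^sup>2"
    by (intro power_mono norm_triangle_ineq) simp
  also have "\<dots> \<le> 2 * (norm (f i))\<^sup>2 + 2 * (norm (g i))\<^sup>2"
    using sum_squares_bound[of "norm (f i)" "norm (g i)"] by (simp add: power2_sum)
  finally show "(norm (f i + g i))\<^sup>2 \<le> 2 * (norm (f i))\<^sup>2 + 2 * (norm (g i))\<^sup>2" .
qed simp

lemma ell2_scaleC_closed: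
  fixes f :: "'i \<Rightarrow> 'e::chilbert_space"
  assumes "(\<lambda>i. (norm (f i))\<^sup>2) summable_on UNIV"
  shows "(\<lambda>i. (norm (a *\<^sub>C f i))\<^sup>2) summable_on UNIV"
  using summable_on_cmult_right[OF assms, of "(cmod a)\<^sup>2"]
  by (simp add: norm_scaleC power_mult_distrib)

lemma ell2_cinner_summable:
  fixes f g :: "('i, 'e::chilbert_space) ell2"
  shows "(\<lambda>i. cinner (coord f i) (coord g i)) summable_on UNIV"
proof (rule abs_summable_summable, rule summable_on_comparison_test)
  show "(\<lambda>i. (norm (coord f i))\<^sup>2 + (norm (coord g i))\<^sup>2) summable_on UNIV"
    by (intro summable_on_add coord_summable)
  fix i
  have "2 * (norm (coord f i) * norm (coord g i)) \<le> (norm (coord f i))\<^sup>2 + (norm (coord g i))\<^sup>2"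
    using sum_squares_bound[of "norm (coord f i)" "norm (coord g i)"] by simp
  moreover have "0 \<le> norm (coord f i) * norm (coord g i)" by simp
  ultimately show "norm (cinner (coord f i) (coord g i)) \<le> (norm (coord f i))\<^sup>2 + (norm (coord g i))\<^sup>2"
    using norm_cinner_le[of "coord f i" "coord g i"] by linarith
qed simp

lemma ell2_inner_summable:
  fixes f g :: "('i, 'e::chilbert_space) ell2"
  shows "(\<lambda>i. inner (coord f i) (coord g i)) summable_on UNIV"
  unfolding inner_eq_Re_cinner by (rule summable_on_Re[OF ell2_cinner_summable])

instantiation ell2 :: (type, chilbert_space) real_vector
begin

lift_definition zero_ell2 :: "('a, 'b) ell2" is "\<lambda>_. 0" by simp
lift_definition plus_ell2 :: "('a, 'b) ell2 \<Rightarrow> ('a, 'b) ell2 \<Rightarrow> ('a, 'b) ell2"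
  is "\<lambda>f g i. f i + g i" by (rule ell2_add_closed)
lift_definition uminus_ell2 :: "('a, 'b) ell2 \<Rightarrow> ('a, 'b) ell2" is "\<lambda>f i. - f i" by simp
lift_definition minus_ell2 :: "('a, 'b) ell2 \<Rightarrow> ('a, 'b) ell2 \<Rightarrow> ('a, 'b) ell2"
  is "\<lambda>f g i. f i - g i"
  subgoal for f g using ell2_add_closed[of f "\<lambda>i. - g i"] by simp
  done
lift_definition scaleR_ell2 :: "real \<Rightarrow> ('a, 'b) ell2 \<Rightarrow> ('a, 'b) ell2" is "\<lambda>r f i. r *\<^sub>R f i"
  unfolding scaleC_of_real[symmetric] by (rule ell2_scaleC_closed)

instance
  by standard (transfer; simp add: algebra_simps)+

end

instantiation ell2 :: (type, chilbert_space) real_inner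
begin

definition inner_ell2 :: "('a, 'b) ell2 \<Rightarrow> ('a, 'b) ell2 \<Rightarrow> real" where
  "inner_ell2 f g = (\<Sum>\<^sub>\<infinity>i. inner (coord f i) (coord g i))"
definition norm_ell2 :: "('a, 'b) ell2 \<Rightarrow> real" where
  "norm_ell2 f = sqrt (inner f f)"
definition dist_ell2 :: "('a, 'b) ell2 \<Rightarrow> ('a, 'b) ell2 \<Rightarrow> real" where
  "dist_ell2 f g = norm (f - g)"
definition sgn_ell2 :: "('a, 'b) ell2 \<Rightarrow> ('a, 'b) ell2" where
  "sgn_ell2 f = f /\<^sub>R norm f"
definition uniformity_ell2 :: "(('a, 'b) ell2 \<times> ('a, 'b) ell2) filter" where
  "uniformity_ell2 = (INF e\<in>{0<..}. principal {(x, y). dist x y < e})"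
definition open_ell2 :: "('a, 'b) ell2 set \<Rightarrow> bool" where
  "open_ell2 U \<longleftrightarrow> (\<forall>x\<in>U. \<forall>\<^sub>F (x', y) in uniformity. x' = x \<longrightarrow> y \<in> U)"

instance
proof
  fix f g h :: "('a, 'b) ell2" and r :: real
  show "inner f g = inner g f" by (simp add: inner_ell2_def inner_commute)
  show "inner (f + g) h = inner f h + inner g h"
    unfolding inner_ell2_def plus_ell2.rep_eq inner_add_left
    by (intro infsum_add ell2_inner_summable)
  show "inner (r *\<^sub>R f) g = r * inner f g"
    unfolding inner_ell2_def scaleR_ell2.rep_eq inner_scaleR_left
    by (intro infsum_cmult_right ell2_inner_summable)
  show "0 \<le> inner f f" by (simp add: inner_ell2_def infsum_nonneg)
  show "inner f f = 0 \<longleftrightarrow> f = 0"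
  proof
    assume *: "inner f f = 0"
    have "coord f i = 0" for i
      using nonneg_infsum_le_0D[of "\<lambda>i. inner (coord f i) (coord f i)" UNIV i]
        * ell2_inner_summable[of f f] by (simp add: inner_ell2_def)
    then show "f = 0" by (simp add: coord_inject[symmetric] fun_eq_iff zero_ell2.rep_eq)
  qed (simp add: inner_ell2_def zero_ell2.rep_eq)
qed (fact norm_ell2_def dist_ell2_def sgn_ell2_def uniformity_ell2_def open_ell2_def)+

end

lemma ell2_norm_sq: "(norm f)\<^sup>2 = (\<Sum>\<^sub>\<infinity>i. (norm (coord f i))\<^sup>2)"
  for f :: "('i, 'e::chilbert_space) ell2"
  by (simp add: power2_norm_eq_inner inner_ell2_def)

lemma ell2_sum_le: "finite F \<Longrightarrow> (\<Sum>i\<in>F. (norm (coord f i))\<^sup>2) \<le> (norm f)\<^sup>2"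
  for f :: "('i, 'e::chilbert_space) ell2"
  unfolding ell2_norm_sq by (intro finite_sum_le_infsum coord_summable) auto

lemma ell2_coord_le: "norm (coord f i) \<le> norm f"
  for f :: "('i, 'e::chilbert_space) ell2"
  by (rule power2_le_imp_le) (use ell2_sum_le[of "{i}" f] in simp_all)

instance ell2 :: (type, chilbert_space) complete_space
proof
  fix X :: "nat \<Rightarrow> ('a, 'b) ell2"
  assume C: "Cauchy X"
  have "Cauchy (\<lambda>m. coord (X m) i)" for i
  proof (rule metric_CauchyI)
    fix e :: real assume "0 < e"
    then obtain N where N: "\<And>m n. m \<ge> N \<Longrightarrow> n \<ge> N \<Longrightarrow> dist (X m) (X n) < e"
      using metric_CauchyD[OF C] by blast
    have "dist (coord (X m) i) (coord (X n) i) \<le> dist (X m) (X n)" for m n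
      unfolding dist_norm using ell2_coord_le[of "X m - X n" i] by (simp add: minus_ell2.rep_eq)
    then show "\<exists>N. \<forall>m\<ge>N. \<forall>n\<ge>N. dist (coord (X m) i) (coord (X n) i) < e"
      using N by (meson le_less_trans)
  qed
  then have "\<exists>l. (\<lambda>m. coord (X m) i) \<longlonglongrightarrow> l" for i
    using Cauchy_convergent convergent_def by blast
  then obtain g where g: "\<And>i. (\<lambda>m. coord (X m) i) \<longlonglongrightarrow> g i" by metis
  have bound: "(\<Sum>i\<in>F. (norm (coord (X m) i - g i))\<^sup>2) \<le> e\<^sup>2"
    if N: "\<And>m n. m \<ge> N \<Longrightarrow> n \<ge> N \<Longrightarrow> dist (X m) (X n) < e" and "finite F" "m \<ge> N" for F m N e
  proof (rule LIMSEQ_le_const2)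
    show "(\<lambda>n. \<Sum>i\<in>F. (norm (coord (X m) i - coord (X n) i))\<^sup>2)
        \<longlonglongrightarrow> (\<Sum>i\<in>F. (norm (coord (X m) i - g i))\<^sup>2)"
      by (intro tendsto_sum tendsto_power tendsto_norm tendsto_diff tendsto_const g)
    have "(\<Sum>i\<in>F. (norm (coord (X m) i - coord (X n) i))\<^sup>2) \<le> e\<^sup>2" if "n \<ge> N" for n
    proof -
      have "(\<Sum>i\<in>F. (norm (coord (X m) i - coord (X n) i))\<^sup>2) \<le> (norm (X m - X n))\<^sup>2"
        using ell2_sum_le[OF \<open>finite F\<close>, of "X m - X n"] by (simp add: minus_ell2.rep_eq)
      also have "\<dots> \<le> e\<^sup>2"
        using N[OF \<open>m \<ge> N\<close> that] by (intro power_mono) (auto simp: dist_norm)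
      finally show ?thesis .
    qed
    then show "\<exists>N. \<forall>n\<ge>N. (\<Sum>i\<in>F. (norm (coord (X m) i - coord (X n) i))\<^sup>2) \<le> e\<^sup>2" by blast
  qed
  have summ: "(\<lambda>i. (norm (coord (X m) i - g i))\<^sup>2) summable_on UNIV"
    if N: "\<And>m n. m \<ge> N \<Longrightarrow> n \<ge> N \<Longrightarrow> dist (X m) (X n) < e" and "m \<ge> N" for m N e
    using bound[OF N] \<open>m \<ge> N\<close>
    by (intro nonneg_bdd_above_summable_on bdd_aboveI[of _ "e\<^sup>2"]) auto
  obtain N1 where N1: "\<And>m n. m \<ge> N1 \<Longrightarrow> n \<ge> N1 \<Longrightarrow> dist (X m) (X n) < 1"
    using metric_CauchyD[OF C, of 1] by auto
  have "(\<lambda>i. (norm (coord (X N1) i + - (coord (X N1) i - g i)))\<^sup>2) summable_on UNIV"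
    using summ[OF N1, of N1]
    by (intro ell2_add_closed coord_summable) (simp_all only: norm_minus_cancel order_refl)
  then have gs: "g \<in> {f. (\<lambda>i. (norm (f i))\<^sup>2) summable_on UNIV}" by simp
  define G where "G = Abs_ell2 g"
  have G: "coord G = g" unfolding G_def by (rule Abs_ell2_inverse[OF gs])
  have "X \<longlonglongrightarrow> G"
  proof (rule metric_LIMSEQ_I)
    fix e :: real assume "0 < e"
    then obtain N where N: "\<And>m n. m \<ge> N \<Longrightarrow> n \<ge> N \<Longrightarrow> dist (X m) (X n) < e / 2"
      using metric_CauchyD[OF C, of "e / 2"] by auto
    have "dist (X m) G < e" if "m \<ge> N" for m
    proof -
      have "(norm (X m - G))\<^sup>2 \<le> (e / 2)\<^sup>2"
        unfolding ell2_norm_sq minus_ell2.rep_eq G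
      proof (rule infsum_le_finite_sums)
        show "(\<lambda>i. (norm (coord (X m) i - g i))\<^sup>2) summable_on UNIV"
          using summ[of N "e / 2" m] N that by blast
        show "(\<Sum>i\<in>F. (norm (coord (X m) i - g i))\<^sup>2) \<le> (e / 2)\<^sup>2" if "finite F" for F
          using bound[of N "e / 2" F m] N that \<open>m \<ge> N\<close> by blast
      qed
      then have "norm (X m - G) \<le> e / 2"
        by (rule power2_le_imp_le) (use \<open>0 < e\<close> in simp)
      then show ?thesis using \<open>0 < e\<close> by (simp add: dist_norm)
    qed
    then show "\<exists>N. \<forall>m\<ge>N. dist (X m) G < e" by blast
  qed
  then show "convergent X" by (rule convergentI)
qed

instantiation ell2 :: (type, chilbert_space) chilbert_space
begin

lift_definition scaleC_ell2 :: "complex \<Rightarrow> ('a, 'b) ell2 \<Rightarrow> ('a, 'b) ell2"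
  is "\<lambda>a f i. a *\<^sub>C f i" by (rule ell2_scaleC_closed)
definition cinner_ell2 :: "('a, 'b) ell2 \<Rightarrow> ('a, 'b) ell2 \<Rightarrow> complex" where
  "cinner_ell2 f g = (\<Sum>\<^sub>\<infinity>i. cinner (coord f i) (coord g i))"

instance
proof
  fix f g h :: "('a, 'b) ell2" and a b :: complex and r :: real
  show "a *\<^sub>C (f + g) = a *\<^sub>C f + a *\<^sub>C g" by transfer (simp add: scaleC_add_right)
  show "(a + b) *\<^sub>C f = a *\<^sub>C f + b *\<^sub>C f" by transfer (simp add: scaleC_add_left)
  show "a *\<^sub>C (b *\<^sub>C f) = (a * b) *\<^sub>C f" by transfer (simp add: scaleC_scaleC)
  show "of_real r *\<^sub>C f = r *\<^sub>R f" by transfer (simp add: scaleC_of_real)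
  show "cinner f g = cnj (cinner g f)"
    unfolding cinner_ell2_def infsum_cnj[symmetric] by (simp add: cinner_commute[symmetric])
  show "cinner (f + g) h = cinner f h + cinner g h"
    unfolding cinner_ell2_def plus_ell2.rep_eq cinner_add_left
    by (intro infsum_add ell2_cinner_summable)
  show "cinner (a *\<^sub>C f) g = a * cinner f g"
    unfolding cinner_ell2_def scaleC_ell2.rep_eq cinner_scaleC_left
    by (intro infsum_cmult_right ell2_cinner_summable)
  show "inner f g = Re (cinner f g)"
    unfolding inner_ell2_def cinner_ell2_def inner_eq_Re_cinner
    by (rule infsum_Re[OF ell2_cinner_summable])
qed

end

lift_definition ket :: "'i \<Rightarrow> ('i, complex) ell2" is "\<lambda>j i. if i = j then 1 else 0"
  by (rule finite_nonzero_values_imp_summable_on) (rule finite_subset[of _ "{_}"], auto)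


section \<open>Operators between closed subspaces\<close>

text \<open>Every Hilbert space in the sequel is a closed complex subspace of a type of class
  \<open>chilbert_space\<close>. A bounded operator from \<open>V\<close> to \<open>W\<close> is represented by its extension by
  zero to the orthogonal complement of \<open>V\<close>. With this convention composition, adjoint and
  positivity are those of the surrounding types, two operators are equal iff they are equal
  as functions, and the identity of \<open>V\<close> is \<open>orth_proj V\<close>.\<close>

definition closed_span :: "'a::chilbert_space set \<Rightarrow> 'a set" where
  "closed_span S = closure (cvec.span S)"

definition orth_proj :: "'a::chilbert_space set \<Rightarrow> 'a \<Rightarrow> 'a" where
  "orth_proj V x = (THE y. y \<in> V \<and> (\<forall>z\<in>V. cinner (x - y) z = 0))"

definition orth_compl_in :: "'a::chilbert_space set \<Rightarrow> 'a set \<Rightarrow> 'a set" where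
  "orth_compl_in V M = {x \<in> V. \<forall>y\<in>M. cinner x y = 0}"

definition bounded_clinear :: "('a::chilbert_space \<Rightarrow> 'b::chilbert_space) \<Rightarrow> bool" where
  "bounded_clinear A \<longleftrightarrow> bounded_linear A \<and> (\<forall>c x. A (c *\<^sub>C x) = c *\<^sub>C A x)"

definition bop :: "'a::chilbert_space set \<Rightarrow> 'b::chilbert_space set \<Rightarrow> ('a \<Rightarrow> 'b) set" where
  "bop V W = {A. bounded_clinear A \<and> range A \<subseteq> W \<and> (\<forall>x\<in>orth_compl_in UNIV V. A x = 0)}"

definition cadjoint :: "('a::chilbert_space \<Rightarrow> 'b::chilbert_space) \<Rightarrow> 'b \<Rightarrow> 'a" where
  "cadjoint A = (THE B. \<forall>x y. cinner (A x) y = cinner x (B y))"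

definition positive_op :: "('a::chilbert_space \<Rightarrow> 'a) \<Rightarrow> bool" where
  "positive_op A \<longleftrightarrow> (\<forall>x. cinner (A x) x \<in> \<real> \<and> 0 \<le> Re (cinner (A x) x))"

definition op_sqrt :: "('a::chilbert_space \<Rightarrow> 'a) \<Rightarrow> 'a \<Rightarrow> 'a" where
  "op_sqrt A = (SOME R. bounded_clinear R \<and> positive_op R \<and> R \<circ> R = A)"

definition partial_isometry_on ::
    "'a::chilbert_space set \<Rightarrow> ('a \<Rightarrow> 'b::chilbert_space) \<Rightarrow> bool" where
  "partial_isometry_on V A \<longleftrightarrow>
     (\<forall>x \<in> orth_compl_in V {z \<in> V. A z = 0}. norm (A x) = norm x)"

definition finite_rank :: "('a::chilbert_space \<Rightarrow> 'b::chilbert_space) \<Rightarrow> bool" where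
  "finite_rank A \<longleftrightarrow> (\<exists>S. finite S \<and> range A \<subseteq> cvec.span S)"

definition is_onb :: "'a::chilbert_space set \<Rightarrow> 'a set \<Rightarrow> bool" where
  "is_onb V B \<longleftrightarrow> B \<subseteq> V \<and> (\<forall>x\<in>B. \<forall>y\<in>B. cinner x y = (if x = y then 1 else 0)) \<and>
     closed_span B = V"

text \<open>The value does not depend on the chosen orthonormal basis for trace class operators; only
  operators of finite rank will occur.\<close>

definition trace_on :: "'a::chilbert_space set \<Rightarrow> ('a \<Rightarrow> 'a) \<Rightarrow> complex" where
  "trace_on V A = (\<Sum>\<^sub>\<infinity>e\<in>(SOME B. is_onb V B). cinner (A e) e)"


section \<open>Symmetric Fock spaces and their tensor products\<close>

text \<open>The free semigroup on \<open>n\<close> generators is \<open>lists {1..n}\<close>, and the full Fock space of an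
  \<open>n\<close>-dimensional Hilbert space consists of the elements of \<open>(nat list, complex) ell2\<close>
  supported on these words; \<open>ket \<alpha>\<close> is the basis vector \<open>e\<^sub>\<alpha>\<close>.
  The set \<open>sym_tensors n p\<close> is the homogeneous component of degree \<open>p\<close> of the symmetric Fock
  space.\<close>

definition sym_tensors :: "nat \<Rightarrow> nat \<Rightarrow> (nat list, complex) ell2 set" where
  "sym_tensors n p = {f. (\<forall>w. coord f w \<noteq> 0 \<longrightarrow> w \<in> lists {1..n} \<and> length w = p) \<and>
     (\<forall>w \<sigma>. \<sigma> permutes {..<length w} \<longrightarrow> coord f (permute_list \<sigma> w) = coord f w)}"

definition sym_fock :: "nat \<Rightarrow> (nat list, complex) ell2 set" where
  "sym_fock n = closed_span (\<Union>p. sym_tensors n p)"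

definition degree_proj :: "nat \<Rightarrow> nat \<Rightarrow> (nat list, complex) ell2 \<Rightarrow> (nat list, complex) ell2" where
  "degree_proj n q = orth_proj (sym_tensors n q)"

lift_definition left_creation :: "nat \<Rightarrow> (nat list, complex) ell2 \<Rightarrow> (nat list, complex) ell2"
  is "\<lambda>j f w. case w of [] \<Rightarrow> 0 | i # u \<Rightarrow> if i = j then f u else 0"
proof -
  fix j :: nat and f :: "nat list \<Rightarrow> complex"
  assume f: "(\<lambda>i. (norm (f i))\<^sup>2) summable_on UNIV"
  let ?g = "\<lambda>w. (norm (case w of [] \<Rightarrow> 0 | i # u \<Rightarrow> if i = j then f u else 0))\<^sup>2"
  have "?g summable_on range ((#) j)"
    using f by (subst summable_on_reindex) (auto simp: o_def)
  then show "?g summable_on UNIV"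
    by (rule summable_on_cong_neutral[THEN iffD1, rotated 3]) (auto split: list.splits)
qed

lemma left_creation_ket: "left_creation j (ket \<alpha>) = ket (j # \<alpha>)"
  by (simp add: coord_inject[symmetric] fun_eq_iff left_creation.rep_eq ket.rep_eq
      split: list.split)

definition sym_creation :: "nat \<Rightarrow> nat \<Rightarrow> (nat list, complex) ell2 \<Rightarrow> (nat list, complex) ell2" where
  "sym_creation n j = orth_proj (sym_fock n) \<circ> left_creation j \<circ> orth_proj (sym_fock n)"

text \<open>Tensor products of \<open>k\<close> Fock spaces and a Hilbert space \<open>'e\<close> live in
  \<open>(nat \<Rightarrow> nat list, 'e) ell2\<close>: the basis vector \<open>e\<^sub>\<beta>\<^sub>1 \<otimes> \<dots> \<otimes> e\<^sub>\<beta>\<^sub>k\<close> is indexed by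
  \<open>\<beta> \<in> extensional {1..k}\<close>, and \<open>elem_tensor k f v\<close> is the tensor
  \<open>f\<^sub>1 \<otimes> \<dots> \<otimes> f\<^sub>k \<otimes> v\<close>.\<close>

lemma elem_tensor_summable:
  fixes f :: "nat \<Rightarrow> nat list \<Rightarrow> complex" and v :: "'e::chilbert_space"
  assumes "\<And>i. (\<lambda>w. (norm (f i w))\<^sup>2) summable_on UNIV"
  shows "(\<lambda>\<beta>. (norm (if \<beta> \<in> extensional {1..k} then (\<Prod>i = 1..k. f i (\<beta> i)) *\<^sub>C v else 0))\<^sup>2)
    summable_on UNIV"
proof -
  have "Infinite_Set_Sum.abs_summable_on (\<lambda>\<beta>. \<Prod>i\<in>{1..k}. (norm (f i (\<beta> i)))\<^sup>2)
      (PiE {1..k} (\<lambda>_. UNIV))"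
    by (rule abs_summable_on_prod_PiE) (use assms in \<open>simp_all add: abs_summable_equivalent[symmetric]\<close>)
  then have "(\<lambda>\<beta>. \<Prod>i\<in>{1..k}. (norm (f i (\<beta> i)))\<^sup>2) summable_on PiE {1..k} (\<lambda>_. UNIV)"
    unfolding abs_summable_equivalent[symmetric] by (rule abs_summable_summable)
  then have "(\<lambda>\<beta>. \<Prod>i\<in>{1..k}. (norm (f i (\<beta> i)))\<^sup>2) summable_on extensional {1..k}"
    by (simp add: PiE_def Pi_def)
  from summable_on_cmult_left[OF this, of "(norm v)\<^sup>2"]
  show ?thesis
    by (rule summable_on_cong_neutral[THEN iffD1, rotated 3])
      (auto simp: norm_scaleC prod_norm[symmetric] prod_power_distrib power_mult_distrib)
qed

lift_definition elem_tensor ::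
    "nat \<Rightarrow> (nat \<Rightarrow> (nat list, complex) ell2) \<Rightarrow> 'e::chilbert_space \<Rightarrow> (nat \<Rightarrow> nat list, 'e) ell2"
  is "\<lambda>k f v \<beta>. if \<beta> \<in> extensional {1..k} then (\<Prod>i = 1..k. f i (\<beta> i)) *\<^sub>C v else 0"
  by (rule elem_tensor_summable) simp

text \<open>\<open>fock_tensor k n D\<close> is \<open>F\<^sub>s\<^sup>2(H\<^sub>n\<^sub>1) \<otimes> \<dots> \<otimes> F\<^sub>s\<^sup>2(H\<^sub>n\<^sub>k) \<otimes> D\<close>; the product without a
  coefficient space is the case \<open>D = \<complex>\<close>. \<open>tensor_op k n A D\<close> is
  \<open>A\<^sub>1 \<otimes> \<dots> \<otimes> A\<^sub>k \<otimes> I\<^sub>D\<close>.\<close>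

definition fock_tensor ::
    "nat \<Rightarrow> (nat \<Rightarrow> nat) \<Rightarrow> 'e::chilbert_space set \<Rightarrow> (nat \<Rightarrow> nat list, 'e) ell2 set" where
  "fock_tensor k n D =
     closed_span {elem_tensor k f v | f v. (\<forall>i\<in>{1..k}. f i \<in> sym_fock (n i)) \<and> v \<in> D}"

definition tensor_op ::
    "nat \<Rightarrow> (nat \<Rightarrow> nat) \<Rightarrow> (nat \<Rightarrow> (nat list, complex) ell2 \<Rightarrow> (nat list, complex) ell2) \<Rightarrow>
     'e::chilbert_space set \<Rightarrow> (nat \<Rightarrow> nat list, 'e) ell2 \<Rightarrow> (nat \<Rightarrow> nat list, 'e) ell2" where
  "tensor_op k n A D = (THE X. X \<in> bop (fock_tensor k n D) (fock_tensor k n D) \<and>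
     (\<forall>f. \<forall>v\<in>D. (\<forall>i\<in>{1..k}. f i \<in> sym_fock (n i)) \<longrightarrow>
        X (elem_tensor k f v) = elem_tensor k (\<lambda>i. A i (f i)) v))"

definition shift_op ::
    "nat \<Rightarrow> (nat \<Rightarrow> nat) \<Rightarrow> nat \<Rightarrow> nat \<Rightarrow> 'e::chilbert_space set \<Rightarrow>
     (nat \<Rightarrow> nat list, 'e) ell2 \<Rightarrow> (nat \<Rightarrow> nat list, 'e) ell2" where
  "shift_op k n i j D =
     tensor_op k n (\<lambda>l. if l = i then sym_creation (n i) j else orth_proj (sym_fock (n l))) D"

definition Q_op ::
    "nat \<Rightarrow> (nat \<Rightarrow> nat) \<Rightarrow> (nat \<Rightarrow> nat) \<Rightarrow> 'e::chilbert_space set \<Rightarrow>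
     (nat \<Rightarrow> nat list, 'e) ell2 \<Rightarrow> (nat \<Rightarrow> nat list, 'e) ell2" where
  "Q_op k n q D = tensor_op k n (\<lambda>i. degree_proj (n i) (q i)) D"

definition Q_le_op ::
    "nat \<Rightarrow> (nat \<Rightarrow> nat) \<Rightarrow> (nat \<Rightarrow> nat) \<Rightarrow> 'e::chilbert_space set \<Rightarrow>
     (nat \<Rightarrow> nat list, 'e) ell2 \<Rightarrow> (nat \<Rightarrow> nat list, 'e) ell2" where
  "Q_le_op k n q D = (\<lambda>x. \<Sum>s\<in>PiE {1..k} (\<lambda>i. {0..q i}). Q_op k n s D x)"

definition multi_analytic ::
    "nat \<Rightarrow> (nat \<Rightarrow> nat) \<Rightarrow> 'g::chilbert_space set \<Rightarrow> 'e::chilbert_space set \<Rightarrow>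
     ((nat \<Rightarrow> nat list, 'g) ell2 \<Rightarrow> (nat \<Rightarrow> nat list, 'e) ell2) \<Rightarrow> bool" where
  "multi_analytic k n G D \<Psi> \<longleftrightarrow> \<Psi> \<in> bop (fock_tensor k n G) (fock_tensor k n D) \<and>
     (\<forall>i\<in>{1..k}. \<forall>j\<in>{1..n i}. \<Psi> \<circ> shift_op k n i j G = shift_op k n i j D \<circ> \<Psi>)"

text \<open>The coefficient space is the whole type \<open>'e\<close>. The auxiliary Hilbert space of the Beurling
  representation is the type \<open>'g\<close>, a parameter because HOL cannot quantify over types; as a
  hypothesis of a theorem with \<open>'g\<close> free it covers all Hilbert spaces.\<close>

definition beurling_type ::
    "'g::chilbert_space itself \<Rightarrow> nat \<Rightarrow> (nat \<Rightarrow> nat) \<Rightarrow>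
     (nat \<Rightarrow> nat list, 'e::chilbert_space) ell2 set \<Rightarrow> bool" where
  "beurling_type _ k n M \<longleftrightarrow> (\<exists>\<Psi> :: (nat \<Rightarrow> nat list, 'g) ell2 \<Rightarrow> (nat \<Rightarrow> nat list, 'e) ell2.
     multi_analytic k n UNIV UNIV \<Psi> \<and> partial_isometry_on (fock_tensor k n UNIV) \<Psi> \<and>
     M = \<Psi> ` fock_tensor k n UNIV)"


section \<open>Multi-indices and limits\<close>

definition multi_indices :: "nat \<Rightarrow> (nat \<Rightarrow> nat) set" where
  "multi_indices k = PiE {1..k} (\<lambda>_. UNIV)"

definition multi_at_top :: "nat \<Rightarrow> (nat \<Rightarrow> nat) filter" where
  "multi_at_top k =
     (INF N\<in>multi_indices k. principal {q \<in> multi_indices k. \<forall>i\<in>{1..k}. N i \<le> q i})"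

text \<open>\<open>has_iterated_lim k a L\<close> says that all limits in
  \<open>lim\<^bsub>q\<^sub>1\<^esub> \<dots> lim\<^bsub>q\<^sub>k\<^esub> a q\<close> exist, the innermost being over \<open>q\<^sub>k\<close>, and that
  the result is \<open>L\<close>.\<close>

fun has_iterated_lim :: "nat \<Rightarrow> ((nat \<Rightarrow> nat) \<Rightarrow> complex) \<Rightarrow> complex \<Rightarrow> bool" where
  "has_iterated_lim 0 a L \<longleftrightarrow> a (\<lambda>_. undefined) = L"
| "has_iterated_lim (Suc k) a L \<longleftrightarrow>
     (\<exists>b. (\<forall>q\<in>multi_indices k. (\<lambda>r. a (q(Suc k := r))) \<longlonglongrightarrow> b q) \<and> has_iterated_lim k b L)"


section \<open>Multiplicity\<close>

definition mult_seq ::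
    "nat \<Rightarrow> (nat \<Rightarrow> nat) \<Rightarrow> (nat \<Rightarrow> nat list, 'e::chilbert_space) ell2 set \<Rightarrow> nat \<Rightarrow> complex" where
  "mult_seq k n M m = 1 / of_nat ((m + k) choose k) *
     (\<Sum>q | q \<in> multi_indices k \<and> (\<Sum>i = 1..k. q i) \<le> m.
        trace_on (fock_tensor k n UNIV) (orth_proj M \<circ> Q_op k n q UNIV) /
        (\<Prod>i = 1..k. trace_on (sym_fock (n i)) (degree_proj (n i) (q i))))"

definition multiplicity_c ::
    "nat \<Rightarrow> (nat \<Rightarrow> nat) \<Rightarrow> (nat \<Rightarrow> nat list, 'e::chilbert_space) ell2 set \<Rightarrow> complex" where
  "multiplicity_c k n M = lim (mult_seq k n M)"


section \<open>Commutative polyball, Berezin kernel, characteristic function, curvature\<close>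

text \<open>A tuple is a function \<open>T\<close> with entries \<open>T i j\<close> for \<open>i \<in> {1..k}\<close>, \<open>j \<in> {1..n i}\<close>;
  \<open>H\<close> is the Hilbert space on which the entries act.\<close>

definition Phi_map :: "nat \<Rightarrow> (nat \<Rightarrow> 'h::chilbert_space \<Rightarrow> 'h) \<Rightarrow> ('h \<Rightarrow> 'h) \<Rightarrow> 'h \<Rightarrow> 'h" where
  "Phi_map ni X Y = (\<lambda>x. \<Sum>j = 1..ni. X j (Y (cadjoint (X j) x)))"

definition defect_map ::
    "nat \<Rightarrow> (nat \<Rightarrow> nat) \<Rightarrow> (nat \<Rightarrow> nat \<Rightarrow> 'h::chilbert_space \<Rightarrow> 'h) \<Rightarrow> (nat \<Rightarrow> nat) \<Rightarrow>
     ('h \<Rightarrow> 'h) \<Rightarrow> 'h \<Rightarrow> 'h" where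
  "defect_map k n T p Y =
     foldr (\<lambda>i. (\<lambda>Y x. Y x - Phi_map (n i) (T i) Y x) ^^ p i) [1..<Suc k] Y"

definition comm_polyball ::
    "nat \<Rightarrow> (nat \<Rightarrow> nat) \<Rightarrow> 'h::chilbert_space set \<Rightarrow> (nat \<Rightarrow> nat \<Rightarrow> 'h \<Rightarrow> 'h) set" where
  "comm_polyball k n H = {T.
     (\<forall>i\<in>{1..k}. \<forall>j\<in>{1..n i}. T i j \<in> bop H H) \<and>
     (\<forall>i\<in>{1..k}. \<forall>j\<in>{1..n i}. \<forall>i'\<in>{1..k}. \<forall>j'\<in>{1..n i'}. T i j \<circ> T i' j' = T i' j' \<circ> T i j) \<and>
     (\<forall>p\<in>PiE {1..k} (\<lambda>_. {0, 1}). positive_op (defect_map k n T p (orth_proj H)))}"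

definition defect_op ::
    "nat \<Rightarrow> (nat \<Rightarrow> nat) \<Rightarrow> 'h::chilbert_space set \<Rightarrow> (nat \<Rightarrow> nat \<Rightarrow> 'h \<Rightarrow> 'h) \<Rightarrow> 'h \<Rightarrow> 'h" where
  "defect_op k n H T = defect_map k n T (\<lambda>_. 1) (orth_proj H)"

definition defect_space ::
    "nat \<Rightarrow> (nat \<Rightarrow> nat) \<Rightarrow> 'h::chilbert_space set \<Rightarrow> (nat \<Rightarrow> nat \<Rightarrow> 'h \<Rightarrow> 'h) \<Rightarrow> 'h set" where
  "defect_space k n H T = closure (defect_op k n H T ` H)"

definition word_op ::
    "'h::chilbert_space set \<Rightarrow> (nat \<Rightarrow> 'h \<Rightarrow> 'h) \<Rightarrow> nat list \<Rightarrow> 'h \<Rightarrow> 'h" where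
  "word_op H X \<alpha> = foldr (\<lambda>j A. X j \<circ> A) \<alpha> (orth_proj H)"

definition berezin_kernel ::
    "nat \<Rightarrow> (nat \<Rightarrow> nat) \<Rightarrow> 'h::chilbert_space set \<Rightarrow> (nat \<Rightarrow> nat \<Rightarrow> 'h \<Rightarrow> 'h) \<Rightarrow>
     'h \<Rightarrow> (nat \<Rightarrow> nat list, 'h) ell2" where
  "berezin_kernel k n H T h =
     (\<Sum>\<^sub>\<infinity>\<beta>\<in>PiE {1..k} (\<lambda>i. lists {1..n i}).
        elem_tensor k (\<lambda>i. ket (\<beta> i))
          (op_sqrt (defect_op k n H T)
            (foldr (\<lambda>i x. cadjoint (word_op H (T i) (\<beta> i)) x) [1..<Suc k] h)))"

definition constr_berezin_kernel ::
    "nat \<Rightarrow> (nat \<Rightarrow> nat) \<Rightarrow> 'h::chilbert_space set \<Rightarrow> (nat \<Rightarrow> nat \<Rightarrow> 'h \<Rightarrow> 'h) \<Rightarrow>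
     'h \<Rightarrow> (nat \<Rightarrow> nat list, 'h) ell2" where
  "constr_berezin_kernel k n H T =
     orth_proj (fock_tensor k n (defect_space k n H T)) \<circ> berezin_kernel k n H T"

definition has_char_function ::
    "'g::chilbert_space itself \<Rightarrow> nat \<Rightarrow> (nat \<Rightarrow> nat) \<Rightarrow> 'h::chilbert_space set \<Rightarrow>
     (nat \<Rightarrow> nat \<Rightarrow> 'h \<Rightarrow> 'h) \<Rightarrow> bool" where
  "has_char_function _ k n H T \<longleftrightarrow>
     (let D = defect_space k n H T; K = constr_berezin_kernel k n H T in
      \<exists>\<Theta> :: (nat \<Rightarrow> nat list, 'g) ell2 \<Rightarrow> (nat \<Rightarrow> nat list, 'h) ell2.
        multi_analytic k n UNIV D \<Theta> \<and>
        (\<forall>x. K (cadjoint K x) + \<Theta> (cadjoint \<Theta> x) = orth_proj (fock_tensor k n D) x))"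

definition curv_seq ::
    "nat \<Rightarrow> (nat \<Rightarrow> nat) \<Rightarrow> 'h::chilbert_space set \<Rightarrow> (nat \<Rightarrow> nat \<Rightarrow> 'h \<Rightarrow> 'h) \<Rightarrow>
     nat \<Rightarrow> complex" where
  "curv_seq k n H T m = 1 / of_nat ((m + k) choose k) *
     (\<Sum>q | q \<in> multi_indices k \<and> (\<Sum>i = 1..k. q i) \<le> m.
        trace_on H (cadjoint (constr_berezin_kernel k n H T) \<circ>
          Q_op k n q (defect_space k n H T) \<circ> constr_berezin_kernel k n H T) /
        trace_on (fock_tensor k n (UNIV :: complex set)) (Q_op k n q UNIV))"

definition curv_c ::
    "nat \<Rightarrow> (nat \<Rightarrow> nat) \<Rightarrow> 'h::chilbert_space set \<Rightarrow> (nat \<Rightarrow> nat \<Rightarrow> 'h \<Rightarrow> 'h) \<Rightarrow> complex" where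
  "curv_c k n H T = lim (curv_seq k n H T)"

definition compression ::
    "nat \<Rightarrow> (nat \<Rightarrow> nat) \<Rightarrow> (nat \<Rightarrow> nat list, 'e::chilbert_space) ell2 set \<Rightarrow>
     nat \<Rightarrow> nat \<Rightarrow> (nat \<Rightarrow> nat list, 'e) ell2 \<Rightarrow> (nat \<Rightarrow> nat list, 'e) ell2" where
  "compression k n N i j = orth_proj N \<circ> shift_op k n i j UNIV \<circ> orth_proj N"

end

theory Submission
  imports Defs "HOL-Combinatorics.Multiset_Permutations"
begin

text \<open>Let \<open>N\<close> be the orthogonal complement of \<open>M\<close> in the Fock space. It is invariant under the adjoints
  of the shifts, which are the annihilation operators \<open>L\<^sub>i\<^sub>j\<close> deleting a first letter \<open>j\<close> in the
  \<open>i\<close>-th factor. They form row contractions, so \<open>\<Sum>\<^sub>j \<parallel>P\<^sub>M L\<^sub>i\<^sub>j x\<parallel>\<^sup>2 \<le> \<parallel>P\<^sub>M x\<parallel>\<^sup>2\<close>. On the orthonormal basis of symmetric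
  tensors, which is indexed by multisets \<open>\<mu>\<close> of letters, \<open>L\<^sub>i\<^sub>j\<close> maps the vector of \<open>\<mu>\<close> to the vector of
  \<open>\<mu> - {j}\<close> times \<open>sqrt (count \<mu> j / size \<mu>)\<close>; summing the inequality over the basis shows that the
  normalized traces \<open>a(q)\<close> of \<open>P\<^sub>M Q\<^sub>q\<close> increase in every coordinate of \<open>q\<close>. Being bounded by the dimension
  of the coefficient space, they converge to their supremum along the net, and hence so do all the averages.

  The defect operator of the compression \<open>T\<close> is \<open>P\<^sub>N P\<^sub>\<Omega> P\<^sub>N\<close> with \<open>P\<^sub>\<Omega>\<close> the projection onto the vacuum vectors.
  Comparing it with the square of its root yields a partial isometry \<open>u\<close> of the coefficient space onto the
  defect space such that the Berezin kernel is the restriction of \<open>I \<otimes> u\<close> to \<open>N\<close>. Therefore \<open>(I \<otimes> u) \<Psi>\<close> is a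
  characteristic function, and the terms of the curvature are \<open>dim E - a(q)\<close>.\<close>

section \<open>Complex Hilbert spaces\<close>

text \<open>Monotonicity rests on a coincidence of two constants. Raising the degree in factor i
  multiplies the lower bound for the trace by (q i + n i) / (q i + 1), since each letter j is added
  with weight count + 1 and these weights sum to q i + n i; the same number is the ratio of the two
  dimensions, so normalizing absorbs it exactly. Adjoints are preferred throughout: a shift is a
  creation followed by a symmetrizing projection, while an annihilation preserves symmetry and only
  moves indices. The trace quotient over a box is a weighted mean of the a(q) whose weights are
  products over the factors; this is what allows the iterated limit to be taken one coordinate at a
  time. The obstacle in the curvature part is that the defect root and the defect space live on N,
  which may be infinite dimensional, and that \<open>op_sqrt\<close> is merely some positive root.
  Existence of a root is therefore proved for bounded operators, and what is used of R is positivity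
  and R R = A. These make the norm of R x equal to that of the vacuum coefficient of x on N, which
  transports the defect space to the finite dimensional coefficient space.\<close>

instance chilbert_space \<subseteq> banach ..

lemma cinner_zero_left [simp]: "cinner 0 (y :: 'a::chilbert_space) = 0"
  using cinner_scaleC_left[of 0 y y] by (simp add: cvec.scale_zero_left)

lemma cinner_zero_right [simp]: "cinner (y :: 'a::chilbert_space) 0 = 0"
  using cinner_scaleC_right[of y 0 y] by (simp add: cvec.scale_zero_left)

lemma cinner_minus_left [simp]: "cinner (- x) (y :: 'a::chilbert_space) = - cinner x y"
  using cinner_add_left[of x "- x" y] by (simp add: eq_neg_iff_add_eq_0 add.commute)

lemma cinner_minus_right [simp]: "cinner x (- y :: 'a::chilbert_space) = - cinner x y"
  using cinner_add_right[of x y "- y"] by (simp add: eq_neg_iff_add_eq_0 add.commute)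

lemma cinner_diff_left: "cinner (x - y) (z :: 'a::chilbert_space) = cinner x z - cinner y z"
  using cinner_add_left[of x "- y" z] by simp

lemma cinner_diff_right: "cinner x (y - z :: 'a::chilbert_space) = cinner x y - cinner x z"
  using cinner_add_right[of x y "- z"] by simp

lemma cinner_sum_left: "cinner (sum f A) (z :: 'a::chilbert_space) = (\<Sum>i\<in>A. cinner (f i) z)"
  by (induction A rule: infinite_finite_induct) (simp_all add: cinner_add_left)

lemma cinner_sum_right: "cinner z (sum f A :: 'a::chilbert_space) = (\<Sum>i\<in>A. cinner z (f i))"
  by (induction A rule: infinite_finite_induct) (simp_all add: cinner_add_right)

lemma cinner_eq_zero_iff [simp]: "cinner x x = 0 \<longleftrightarrow> x = (0 :: 'a::chilbert_space)"
  by (simp add: cinner_self)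

lemma cinner_eqI: "(\<And>z. cinner x z = cinner y z) \<Longrightarrow> x = (y :: 'a::chilbert_space)"
  using cinner_eq_zero_iff[of "x - y"] by (simp add: cinner_diff_left del: cinner_eq_zero_iff)

lemma cinner_zero_commute: "cinner x y = 0 \<longleftrightarrow> cinner y (x :: 'a::chilbert_space) = 0"
  by (metis cinner_commute complex_cnj_zero_iff)

lemma bounded_linear_cinner_left: "bounded_linear (\<lambda>x. cinner x (y :: 'a::chilbert_space))"
  by (rule bounded_linear_intro[where K = "norm y"])
    (simp_all add: cinner_add_left scaleC_of_real[symmetric] cinner_scaleC_left
      scaleC_complex_def norm_cinner_le)

lemma norm_orthogonal_add:
  assumes "cinner x (y :: 'a::chilbert_space) = 0"
  shows "(norm (x + y))\<^sup>2 = (norm x)\<^sup>2 + (norm y)\<^sup>2"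
  using assms by (simp add: power2_norm_eq_inner inner_add_left inner_add_right inner_commute[of y x]
      inner_eq_Re_cinner[of x y])

section \<open>Closed subspaces and orthogonal projections\<close>

definition closed_csubspace :: "'a::chilbert_space set \<Rightarrow> bool" where
  "closed_csubspace V \<longleftrightarrow> cvec.subspace V \<and> closed V"

lemma closed_csubspaceD:
  assumes "closed_csubspace (V :: 'a::chilbert_space set)"
  shows "0 \<in> V" "\<And>x y. x \<in> V \<Longrightarrow> y \<in> V \<Longrightarrow> x + y \<in> V" "\<And>c x. x \<in> V \<Longrightarrow> c *\<^sub>C x \<in> V"
    "\<And>x y. x \<in> V \<Longrightarrow> y \<in> V \<Longrightarrow> x - y \<in> V" "closed V" "cvec.subspace V"
  using assms unfolding closed_csubspace_def
  by (auto intro: cvec.subspace_0 cvec.subspace_add cvec.subspace_scale cvec.subspace_diff)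

lemma closed_csubspace_UNIV: "closed_csubspace UNIV"
  by (simp add: closed_csubspace_def)

lemma scaleC_half_eq: "(1 / 2) *\<^sub>C (x :: 'a::chilbert_space) = x /\<^sub>R 2"
  using scaleC_of_real[of "1 / 2" x] by simp

text \<open>A minimizing sequence for the distance from x to V is Cauchy by the parallelogram
  identity; completeness gives a nearest point, and varying it along a vector of V forces
  orthogonality.\<close>

lemma exists_orth_proj:
  assumes V: "closed_csubspace (V :: 'a::chilbert_space set)"
  shows "\<exists>y\<in>V. \<forall>z\<in>V. cinner (x - y) z = 0"
proof -
  define D where "D = Inf ((\<lambda>z. (norm (x - z))\<^sup>2) ` V)"
  have bdd: "bdd_below ((\<lambda>z. (norm (x - z))\<^sup>2) ` V)"
    by (rule bdd_belowI[of _ 0]) auto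
  have ne: "V \<noteq> {}" using closed_csubspaceD(1)[OF V] by auto
  have D: "D \<le> (norm (x - z))\<^sup>2" if "z \<in> V" for z
    unfolding D_def using that bdd by (intro cInf_lower) auto
  have "\<exists>z\<in>V. (norm (x - z))\<^sup>2 < D + 1 / Suc m" for m
    using cInf_less_iff[OF _ bdd, of "D + 1 / Suc m"] ne by (auto simp: D_def)
  then obtain z where zV: "\<And>m. z m \<in> V" and z: "\<And>m. (norm (x - z m))\<^sup>2 < D + 1 / Suc m"
    by metis
  have par: "(norm (z m - z l))\<^sup>2 \<le> 2 / Suc m + 2 / Suc l" for m l
  proof -
    \<comment> \<open>The midpoint lies in V, so its squared distance to x is at least D.\<close>
    define w where "w = (1 / 2) *\<^sub>C (z m + z l)"
    have "w \<in> V" unfolding w_def using zV V by (intro closed_csubspaceD)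
    then have "D \<le> (norm (x - w))\<^sup>2" by (rule D)
    moreover have "(norm (z m - z l))\<^sup>2
        = 2 * (norm (x - z m))\<^sup>2 + 2 * (norm (x - z l))\<^sup>2 - 4 * (norm (x - w))\<^sup>2"
      unfolding w_def scaleC_half_eq power2_norm_eq_inner
      by (simp add: inner_add_left inner_add_right inner_diff_left inner_diff_right
          inner_commute algebra_simps)
    ultimately show ?thesis using z[of m] z[of l] by simp
  qed
  have "Cauchy z"
  proof (rule metric_CauchyI)
    fix e :: real assume "0 < e"
    then obtain N where N: "4 / e\<^sup>2 < real N" using reals_Archimedean2 by blast
    have "dist (z m) (z l) < e" if "m \<ge> N" "l \<ge> N" for m l
    proof -
      have "2 / real (Suc m) \<le> 2 / Suc N" "2 / real (Suc l) \<le> 2 / Suc N"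
        using that by (auto intro!: divide_left_mono)
      then have "(norm (z m - z l))\<^sup>2 \<le> 4 / Suc N" using par[of m l] by simp
      also have "\<dots> < e\<^sup>2"
      proof -
        have e2: "0 < e\<^sup>2" using \<open>0 < e\<close> by simp
        then have "4 < real N * e\<^sup>2" using N by (simp only: pos_divide_less_eq)
        also have "\<dots> < real (Suc N) * e\<^sup>2" using e2 by (intro mult_strict_right_mono) auto
        finally show ?thesis by (simp only: pos_divide_less_eq of_nat_0_less_iff mult.commute zero_less_Suc)
      qed
      finally show ?thesis using \<open>0 < e\<close> by (simp add: dist_norm power_less_imp_less_base)
    qed
    then show "\<exists>M. \<forall>m\<ge>M. \<forall>n\<ge>M. dist (z m) (z n) < e" by blast
  qed
  then obtain y where y: "z \<longlonglongrightarrow> y" using Cauchy_convergent convergent_def by blast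
  have yV: "y \<in> V"
    using closed_sequentially[OF closed_csubspaceD(5)[OF V]] zV y by blast
  have "(norm (x - y))\<^sup>2 \<le> D"
  proof (rule LIMSEQ_le)
    show "(\<lambda>m. (norm (x - z m))\<^sup>2) \<longlonglongrightarrow> (norm (x - y))\<^sup>2"
      by (intro tendsto_intros y)
    show "(\<lambda>m. D + 1 / Suc m) \<longlonglongrightarrow> D"
      using tendsto_add[OF tendsto_const LIMSEQ_inverse_real_of_nat] by (simp add: inverse_eq_divide)
    show "\<exists>N. \<forall>n\<ge>N. (norm (x - z n))\<^sup>2 \<le> D + 1 / real (Suc n)"
      using z less_imp_le by blast
  qed
  have inner0: "inner (x - y) w = 0" if "w \<in> V" for w
  proof (rule ccontr)
    define t where "t = inner (x - y) w"
    assume "inner (x - y) w \<noteq> 0"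
    then have t: "t \<noteq> 0" and w: "norm w \<noteq> 0" by (auto simp: t_def)
    \<comment> \<open>This c minimizes the squared norm of x - y - c w over the reals; the gain t^2
      / (norm w)^2 contradicts the minimality of y.\<close>
    define c where "c = t / (norm w)\<^sup>2"
    have "y + of_real c *\<^sub>C w \<in> V" using that yV V by (intro closed_csubspaceD)
    from D[OF this] have "(norm (x - y))\<^sup>2 \<le> (norm ((x - y) - c *\<^sub>R w))\<^sup>2"
      using \<open>(norm (x - y))\<^sup>2 \<le> D\<close> unfolding scaleC_of_real diff_diff_eq by (rule order_trans[rotated])
    also have "\<dots> = (norm (x - y))\<^sup>2 - 2 * c * t + c\<^sup>2 * (norm w)\<^sup>2"
      unfolding power2_norm_eq_inner t_def
      by (simp add: inner_diff_left inner_diff_right inner_commute algebra_simps power2_eq_square)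
    also have "\<dots> = (norm (x - y))\<^sup>2 - t\<^sup>2 / (norm w)\<^sup>2"
      using w by (simp add: c_def field_simps power2_eq_square)
    finally show False using t w by (simp add: field_simps)
  qed
  have "cinner (x - y) w = 0" if "w \<in> V" for w
  proof (rule complex_eqI)
    show "Re (cinner (x - y) w) = Re 0" using inner0[OF that] by (simp add: inner_eq_Re_cinner)
    \<comment> \<open>The real inner product with i w is the imaginary part of
      \<open>cinner (x - y) w\<close>.\<close>
    have "\<i> *\<^sub>C w \<in> V" using that V by (intro closed_csubspaceD)
    from inner0[OF this] show "Im (cinner (x - y) w) = Im 0"
      by (simp add: inner_eq_Re_cinner cinner_scaleC_right)
  qed
  then show ?thesis using yV by blast
qed

text \<open>Two candidates differ by a vector of V that is orthogonal to itself. As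
  \<open>orth_proj\<close> is a definite description, projections are computed through this
  rule.\<close>

lemma orth_proj_eqI:
  assumes "closed_csubspace (V :: 'a::chilbert_space set)" "y \<in> V" "\<And>z. z \<in> V \<Longrightarrow> cinner (x - y) z = 0"
  shows "orth_proj V x = y"
  unfolding orth_proj_def
proof (rule the_equality)
  fix y' assume y': "y' \<in> V \<and> (\<forall>z\<in>V. cinner (x - y') z = 0)"
  have "y - y' \<in> V" using assms y' by (intro closed_csubspaceD) auto
  then have "cinner ((x - y') - (x - y)) (y - y') = 0"
    using assms(3) y' by (subst cinner_diff_left) auto
  then show "y' = y" by simp
qed (use assms in auto)

lemma
  assumes V: "closed_csubspace (V :: 'a::chilbert_space set)"
  shows orth_proj_in: "orth_proj V x \<in> V"
    and orth_proj_orth: "z \<in> V \<Longrightarrow> cinner (x - orth_proj V x) z = 0"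
proof -
  obtain y where y: "y \<in> V" "\<forall>z\<in>V. cinner (x - y) z = 0" using exists_orth_proj[OF V] by blast
  then have "orth_proj V x = y" using V by (intro orth_proj_eqI) auto
  then show "orth_proj V x \<in> V" "z \<in> V \<Longrightarrow> cinner (x - orth_proj V x) z = 0" using y by auto
qed

lemma orth_proj_ident:
  assumes "closed_csubspace (V :: 'a::chilbert_space set)" "x \<in> V" shows "orth_proj V x = x"
  using assms by (intro orth_proj_eqI) auto

lemma cinner_orth_proj_left:
  assumes "closed_csubspace (V :: 'a::chilbert_space set)" "z \<in> V"
  shows "cinner (orth_proj V x) z = cinner x z"
  using orth_proj_orth[OF assms, of x] by (simp add: cinner_diff_left)

lemma cinner_orth_proj_right:
  assumes "closed_csubspace (V :: 'a::chilbert_space set)" "z \<in> V"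
  shows "cinner z (orth_proj V x) = cinner z x"
  by (subst (1 2) cinner_commute) (simp add: cinner_orth_proj_left[OF assms])

lemma orth_proj_selfadjoint:
  assumes "closed_csubspace (V :: 'a::chilbert_space set)"
  shows "cinner (orth_proj V x) y = cinner x (orth_proj V y)"
  using cinner_orth_proj_left[OF assms orth_proj_in[OF assms, of y], of x]
    cinner_orth_proj_right[OF assms orth_proj_in[OF assms, of x], of y] by simp

lemma orth_proj_eq_zero:
  assumes "closed_csubspace (V :: 'a::chilbert_space set)" "\<And>z. z \<in> V \<Longrightarrow> cinner x z = 0"
  shows "orth_proj V x = 0"
  using assms by (intro orth_proj_eqI) (auto intro: closed_csubspaceD)

lemma bounded_clinearI:
  assumes "\<And>x y. A (x + y) = A x + A y" "\<And>c x. A (c *\<^sub>C x) = c *\<^sub>C A x"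
    "\<And>x. norm (A x) \<le> K * norm x"
  shows "bounded_clinear A"
  unfolding bounded_clinear_def
proof (intro conjI allI)
  show "bounded_linear A"
    using assms by (intro bounded_linear_intro[where K = K])
      (simp_all add: scaleC_of_real[symmetric] mult.commute)
qed (use assms in auto)

lemma bounded_clinearD:
  assumes "bounded_clinear A"
  shows "A (x + y) = A x + A y" "A (c *\<^sub>C x) = c *\<^sub>C A x" "bounded_linear A"
    "A 0 = 0" "A (x - y) = A x - A y" "A (sum f I) = (\<Sum>i\<in>I. A (f i))"
  using assms unfolding bounded_clinear_def
  by (auto simp: bounded_linear.linear linear_add linear_0 linear_diff linear_sum)

lemma bounded_clinear_compose:
  "bounded_clinear A \<Longrightarrow> bounded_clinear B \<Longrightarrow> bounded_clinear (\<lambda>x. A (B x))"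
  unfolding bounded_clinear_def by (auto intro: bounded_linear_compose)

lemma bounded_linear_scaleC: "bounded_linear ((*\<^sub>C) c :: 'a \<Rightarrow> 'a::chilbert_space)"
  using bounded_clinearI[of "(*\<^sub>C) c :: 'a \<Rightarrow> 'a" "cmod c"]
  by (simp add: scaleC_add_right scaleC_scaleC mult.commute norm_scaleC bounded_clinear_def)

lemma subspace_image:
  assumes A: "bounded_clinear A" and V: "cvec.subspace V"
  shows "cvec.subspace (A ` V)"
  unfolding cvec.subspace_def
proof (intro conjI ballI allI)
  note lin = bounded_clinearD[OF A]
  show "0 \<in> A ` V" using lin(4) cvec.subspace_0[OF V] by (metis imageI)
  fix x assume "x \<in> A ` V"
  then obtain a where a: "a \<in> V" "x = A a" by blast
  show "c *\<^sub>C x \<in> A ` V" for c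
    using cvec.subspace_scale[OF V a(1)] by (simp add: a(2) lin(2)[symmetric])
  fix y assume "y \<in> A ` V"
  then obtain b where b: "b \<in> V" "y = A b" by blast
  show "x + y \<in> A ` V"
    using cvec.subspace_add[OF V a(1) b(1)] by (simp add: a(2) b(2) lin(1)[symmetric])
qed

lemma norm_orth_proj_le:
  assumes V: "closed_csubspace (V :: 'a::chilbert_space set)"
  shows "norm (orth_proj V x) \<le> norm x"
proof (rule power2_le_imp_le)
  have "cinner (x - orth_proj V x) (orth_proj V x) = 0"
    using orth_proj_orth[OF V orth_proj_in[OF V]] .
  from norm_orthogonal_add[OF this] show "(norm (orth_proj V x))\<^sup>2 \<le> (norm x)\<^sup>2" by simp
qed simp

lemma bounded_clinear_orth_proj:
  assumes V: "closed_csubspace (V :: 'a::chilbert_space set)"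
  shows "bounded_clinear (orth_proj V)"
proof (rule bounded_clinearI[where K = 1])
  fix x y :: 'a and c
  show "orth_proj V (x + y) = orth_proj V x + orth_proj V y"
  proof (rule orth_proj_eqI[OF V])
    fix z assume "z \<in> V"
    then show "cinner (x + y - (orth_proj V x + orth_proj V y)) z = 0"
      by (simp add: cinner_add_left cinner_diff_left cinner_orth_proj_left[OF V])
  qed (intro closed_csubspaceD(2)[OF V] orth_proj_in[OF V])
  show "orth_proj V (c *\<^sub>C x) = c *\<^sub>C orth_proj V x"
  proof (rule orth_proj_eqI[OF V])
    fix z assume "z \<in> V"
    then show "cinner (c *\<^sub>C x - c *\<^sub>C orth_proj V x) z = 0"
      by (simp add: cinner_scaleC_left cinner_diff_left cinner_orth_proj_left[OF V])
  qed (intro closed_csubspaceD(3)[OF V] orth_proj_in[OF V])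
qed (simp add: norm_orth_proj_le[OF V])

lemma closed_csubspace_orth_compl_in:
  assumes V: "closed_csubspace (V :: 'a::chilbert_space set)"
  shows "closed_csubspace (orth_compl_in V M)"
proof -
  have "orth_compl_in V M = V \<inter> (\<Inter>y\<in>M. (\<lambda>x. cinner x y) -` {0})"
    by (auto simp: orth_compl_in_def)
  moreover have "closed ((\<lambda>x. cinner x y) -` {0})" for y :: 'a
    using bounded_linear_cinner_left[of y]
    by (intro continuous_closed_vimage) (simp_all add: linear_continuous_at)
  ultimately have "closed (orth_compl_in V M)"
    using closed_csubspaceD(5)[OF V] by (simp add: closed_Int closed_INT)
  moreover have "cvec.subspace (orth_compl_in V M)"
    unfolding cvec.subspace_def orth_compl_in_def
    by (auto intro: closed_csubspaceD[OF V] simp: cinner_add_left cinner_scaleC_left)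
  ultimately show ?thesis by (simp add: closed_csubspace_def)
qed

lemma orth_proj_orth_compl_in:
  assumes V: "closed_csubspace (V :: 'a::chilbert_space set)" and M: "closed_csubspace M" "M \<subseteq> V"
  shows "orth_proj (orth_compl_in V M) x = orth_proj V x - orth_proj M x"
proof (rule orth_proj_eqI[OF closed_csubspace_orth_compl_in[OF V]])
  show "orth_proj V x - orth_proj M x \<in> orth_compl_in V M"
    using M orth_proj_in[OF V, of x] orth_proj_in[OF M(1), of x]
    by (auto simp: orth_compl_in_def cinner_diff_left cinner_orth_proj_left[OF M(1)]
        cinner_orth_proj_left[OF V] subset_iff intro!: closed_csubspaceD(4)[OF V])
next
  fix z assume z: "z \<in> orth_compl_in V M"
  then have "cinner (orth_proj M x) z = 0"
    using orth_proj_in[OF M(1), of x] by (auto simp: orth_compl_in_def cinner_zero_commute[of _ z])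
  then show "cinner (x - (orth_proj V x - orth_proj M x)) z = 0"
    using z by (simp add: orth_compl_in_def cinner_diff_left cinner_orth_proj_left[OF V])
qed

lemma closed_csubspace_closure:
  assumes "cvec.subspace (S :: 'a::chilbert_space set)"
  shows "closed_csubspace (closure S)"
proof -
  have "x + y \<in> closure S" if "x \<in> closure S" "y \<in> closure S" for x y
  proof -
    from that obtain f g where "\<And>n. f n \<in> S" "f \<longlonglongrightarrow> x" "\<And>n. g n \<in> S" "g \<longlonglongrightarrow> y"
      unfolding closure_sequential by blast
    then show ?thesis unfolding closure_sequential
      by (intro exI[of _ "\<lambda>n. f n + g n"]) (auto intro: cvec.subspace_add[OF assms] tendsto_add)
  qed
  moreover have "c *\<^sub>C x \<in> closure S" if "x \<in> closure S" for c x
  proof -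
    from that obtain f where "\<And>n. f n \<in> S" "f \<longlonglongrightarrow> x" unfolding closure_sequential by blast
    then show ?thesis unfolding closure_sequential
      by (intro exI[of _ "\<lambda>n. c *\<^sub>C f n"])
        (auto intro: cvec.subspace_scale[OF assms] bounded_linear.tendsto[OF bounded_linear_scaleC])
  qed
  moreover have "0 \<in> closure S" using cvec.subspace_0[OF assms] closure_subset by blast
  ultimately show ?thesis by (simp add: closed_csubspace_def cvec.subspace_def)
qed

lemma closed_csubspace_closed_span: "closed_csubspace (closed_span S)"
  unfolding closed_span_def by (rule closed_csubspace_closure) (rule cvec.subspace_span)

lemma closed_span_superset: "x \<in> S \<Longrightarrow> x \<in> closed_span S"
  unfolding closed_span_def using closure_subset cvec.span_base by blast

lemma closed_span_minimal: "closed_csubspace V \<Longrightarrow> S \<subseteq> V \<Longrightarrow> closed_span S \<subseteq> V"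
  unfolding closed_span_def closed_csubspace_def
  by (intro closure_minimal cvec.span_minimal) auto

lemma orth_closed_span:
  assumes "\<And>z. z \<in> S \<Longrightarrow> cinner x z = 0" "y \<in> closed_span S"
  shows "cinner x y = (0 :: complex)"
proof -
  have "closed_csubspace (orth_compl_in UNIV {x})"
    by (rule closed_csubspace_orth_compl_in[OF closed_csubspace_UNIV])
  then have "closed_span S \<subseteq> orth_compl_in UNIV {x}"
    by (rule closed_span_minimal) (use assms(1) in \<open>auto simp: orth_compl_in_def cinner_zero_commute[of _ x]\<close>)
  then show ?thesis using assms(2) by (auto simp: orth_compl_in_def cinner_zero_commute[of x])
qed

text \<open>The set where two bounded operators agree is a closed subspace. This gives uniqueness of
  an operator prescribed on elementary tensors.\<close>

lemma bounded_clinear_eq_on_closed_span: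
  assumes "bounded_clinear A" "bounded_clinear B" "\<And>x. x \<in> S \<Longrightarrow> A x = B x" "x \<in> closed_span S"
  shows "A x = B x"
proof -
  have "closed_csubspace {x. A x = B x}"
    unfolding closed_csubspace_def cvec.subspace_def
    using assms(1,2)
    by (auto simp: bounded_clinearD intro!: closed_Collect_eq linear_continuous_on)
  then show ?thesis using closed_span_minimal[of "{x. A x = B x}" S] assms(3,4) by auto
qed

section \<open>Adjoints\<close>

text \<open>For f nonzero let w be the component of some x0 with \<open>f x0 \<noteq> 0\<close>
  orthogonal to the kernel. Since \<open>f w *\<^sub>C x - f x *\<^sub>C w\<close> lies in the
  kernel, pairing it with w shows that a multiple of w represents f.\<close>

lemma riesz_representation:
  assumes f: "bounded_linear f" and fc: "\<And>c x. f (c *\<^sub>C x) = c * f x"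
  shows "\<exists>y. \<forall>x. f x = cinner x (y :: 'a::chilbert_space)"
proof (cases "\<forall>x. f x = 0")
  case False
  define V where "V = {x. f x = 0}"
  have f_add: "f (x + y) = f x + f y" and f_diff: "f (x - y) = f x - f y" for x y
    using f by (auto simp: bounded_linear.linear linear_add linear_diff)
  have V: "closed_csubspace V"
    unfolding closed_csubspace_def cvec.subspace_def V_def
    using f by (auto simp: f_add fc bounded_linear.linear linear_0
        intro!: closed_Collect_eq linear_continuous_on)
  obtain x0 where x0: "f x0 \<noteq> 0" using False by blast
  define w where "w = x0 - orth_proj V x0"
  have fw: "f w \<noteq> 0" using orth_proj_in[OF V, of x0] x0 by (simp add: w_def f_diff V_def)
  then have w0: "cinner w w \<noteq> 0" using f by (auto simp: bounded_linear.linear linear_0)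
  have "f x = cinner x (cnj (f w / cinner w w) *\<^sub>C w)" for x
  proof -
    have "f w *\<^sub>C x - f x *\<^sub>C w \<in> V" by (simp add: V_def f_diff fc)
    then have "cinner w (f w *\<^sub>C x - f x *\<^sub>C w) = 0"
      unfolding w_def by (rule orth_proj_orth[OF V])
    then have "cinner (f w *\<^sub>C x - f x *\<^sub>C w) w = 0" by (simp add: cinner_zero_commute)
    then show ?thesis using w0
      by (simp add: cinner_diff_left cinner_scaleC_left cinner_scaleC_right field_simps)
  qed
  then show ?thesis by blast
qed (auto intro!: exI[of _ 0])

lemma cadjoint_eqI:
  assumes "\<And>x y. cinner (A x) y = cinner x (B y)"
  shows "cadjoint A = B"
  unfolding cadjoint_def
proof (rule the_equality)
  fix B' assume B': "\<forall>x y. cinner (A x) y = cinner x (B' y)"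
  show "B' = B"
  proof
    fix y show "B' y = B y"
      by (rule cinner_eqI) (metis B' assms cinner_commute)
  qed
qed (use assms in auto)

lemma cadjoint:
  assumes "bounded_clinear A"
  shows "cinner (A x) y = cinner x (cadjoint A y)"
proof -
  have "\<exists>b. \<forall>x. cinner (A x) y = cinner x b" for y
    by (rule riesz_representation)
      (use assms in \<open>auto simp: bounded_clinearD cinner_scaleC_left
        intro!: bounded_linear_compose[OF bounded_linear_cinner_left]\<close>)
  then obtain B where B: "\<And>x y. cinner (A x) y = cinner x (B y)" by metis
  then show ?thesis using cadjoint_eqI[of A B] by metis
qed

lemma cadjoint_left:
  assumes "bounded_clinear A"
  shows "cinner (cadjoint A x) y = cinner x (A y)"
  by (metis assms cadjoint cinner_commute)

lemma bounded_clinear_cadjoint: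
  assumes A: "bounded_clinear A"
  shows "bounded_clinear (cadjoint A)"
proof -
  obtain K where K: "K \<ge> 0" "\<And>x. norm (A x) \<le> norm x * K"
    using bounded_linear.nonneg_bounded[OF bounded_clinearD(3)[OF A]] by blast
  show ?thesis
  proof (rule bounded_clinearI[where K = K])
    fix x y and c
    show "cadjoint A (x + y) = cadjoint A x + cadjoint A y"
      by (rule cinner_eqI) (simp add: cadjoint_left[OF A] cinner_add_left)
    show "cadjoint A (c *\<^sub>C x) = c *\<^sub>C cadjoint A x"
      by (rule cinner_eqI) (simp add: cadjoint_left[OF A] cinner_scaleC_left)
    have "(norm (cadjoint A x))\<^sup>2 = cmod (cinner x (A (cadjoint A x)))"
      by (simp add: cadjoint_left[OF A, symmetric] cinner_self norm_power)
    also have "\<dots> \<le> norm x * norm (A (cadjoint A x))" by (rule norm_cinner_le)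
    also have "\<dots> \<le> norm x * (norm (cadjoint A x) * K)"
      by (intro mult_left_mono K) simp
    finally have "norm (cadjoint A x) * norm (cadjoint A x) \<le> norm (cadjoint A x) * (K * norm x)"
      by (simp add: power2_eq_square algebra_simps)
    then show "norm (cadjoint A x) \<le> K * norm x"
      using K(1) by (cases "norm (cadjoint A x) = 0") auto
  qed
qed

lemma bopD:
  assumes "A \<in> bop V W"
  shows "bounded_clinear A" "A x \<in> W" "(\<And>y. y \<in> V \<Longrightarrow> cinner x y = 0) \<Longrightarrow> A x = 0"
  using assms by (auto simp: bop_def orth_compl_in_def)

lemma bop_orth_proj:
  assumes "A \<in> bop V W" "closed_csubspace V"
  shows "A (orth_proj V x) = A x"
proof -
  have "A (x - orth_proj V x) = 0"
    by (rule bopD(3)[OF assms(1)]) (rule orth_proj_orth[OF assms(2)])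
  then show ?thesis using bounded_clinearD(5)[OF bopD(1)[OF assms(1)], of x "orth_proj V x"] by simp
qed

text \<open>Polarization turns the norm equality on V0, the complement of the kernel in V, into
  equality of inner products. So A* A is the projection onto V0 and A A* A = A. The range is then
  the fixed space of A A*, hence closed.\<close>

lemma partial_isometry_range:
  fixes A :: "'a::chilbert_space \<Rightarrow> 'b::chilbert_space"
  assumes A: "A \<in> bop V UNIV" and V: "closed_csubspace V" and iso: "partial_isometry_on V A"
  shows "closed_csubspace (A ` V)" "A (cadjoint A x) = orth_proj (A ` V) x"
proof -
  note lin = bounded_clinearD[OF bopD(1)[OF A]]
  define Z where "Z = {z \<in> V. A z = 0}"
  define V0 where "V0 = orth_compl_in V Z"
  have Z: "closed_csubspace Z"
  proof -
    have "Z = V \<inter> {x. A x = 0}" by (auto simp: Z_def)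
    then show ?thesis using V lin
      by (auto simp: closed_csubspace_def cvec.subspace_def intro!: closed_Int closed_Collect_eq
          linear_continuous_on)
  qed
  have V0: "closed_csubspace V0" unfolding V0_def by (rule closed_csubspace_orth_compl_in[OF V])
  have PV0: "orth_proj V0 x = orth_proj V x - orth_proj Z x" for x
    unfolding V0_def by (rule orth_proj_orth_compl_in[OF V Z]) (auto simp: Z_def)
  have A0: "A (orth_proj V0 x) = A x" for x
    using orth_proj_in[OF Z, of x] by (simp add: PV0 lin(5) bop_orth_proj[OF A V] Z_def)
  have norm0: "norm (A x) = norm x" if "x \<in> V0" for x
    using iso that by (auto simp: partial_isometry_on_def V0_def Z_def)
  have Re0: "Re (cinner (A x) (A y)) = Re (cinner x y)" if "x \<in> V0" "y \<in> V0" for x y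
  proof -
    have "(norm (A (x + y)))\<^sup>2 = (norm (x + y))\<^sup>2" "(norm (A x))\<^sup>2 = (norm x)\<^sup>2" "(norm (A y))\<^sup>2 = (norm y)\<^sup>2"
      using that norm0 closed_csubspaceD(2)[OF V0] by auto
    then show ?thesis
      by (simp add: power2_norm_eq_inner lin(1) inner_add_left inner_add_right
          inner_commute[of y x] inner_commute[of "A y" "A x"] inner_eq_Re_cinner[symmetric])
  qed
  have iso0: "cinner (A x) (A y) = cinner x y" if "x \<in> V0" "y \<in> V0" for x y
  proof (rule complex_eqI)
    have "Re (cinner (A x) (A (\<i> *\<^sub>C y))) = Re (cinner x (\<i> *\<^sub>C y))"
      using that by (intro Re0 closed_csubspaceD(3)[OF V0])
    then show "Im (cinner (A x) (A y)) = Im (cinner x y)"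
      by (simp add: lin(2) cinner_scaleC_right)
  qed (use Re0 that in auto)
  have ad: "cadjoint A (A z) = orth_proj V0 z" for z
  proof (rule cinner_eqI)
    fix y
    have "cinner (cadjoint A (A z)) y = cinner (A (orth_proj V0 z)) (A (orth_proj V0 y))"
      by (simp add: cadjoint_left[OF bopD(1)[OF A]] A0)
    also have "\<dots> = cinner (orth_proj V0 z) y"
      by (simp add: iso0 orth_proj_in[OF V0] cinner_orth_proj_right[OF V0])
    finally show "cinner (cadjoint A (A z)) y = cinner (orth_proj V0 z) y" .
  qed
  have fixp: "A (cadjoint A (A z)) = A z" for z by (simp add: ad A0)
  have eq: "A ` V = {x. A (cadjoint A x) = x}"
  proof
    show "{x. A (cadjoint A x) = x} \<subseteq> A ` V"
    proof
      fix x assume "x \<in> {x. A (cadjoint A x) = x}"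
      then have "x = A (orth_proj V (cadjoint A x))" by (simp add: bop_orth_proj[OF A V])
      then show "x \<in> A ` V" using orth_proj_in[OF V] by blast
    qed
  qed (auto simp: fixp)
  note adlin = bounded_clinear_cadjoint[OF bopD(1)[OF A]]
  note AAlin = bounded_clinear_compose[OF bopD(1)[OF A] adlin]
  show cl: "closed_csubspace (A ` V)"
    unfolding eq closed_csubspace_def cvec.subspace_def
    using bounded_clinearD[OF AAlin] by (auto intro!: closed_Collect_eq linear_continuous_on)
  show "A (cadjoint A x) = orth_proj (A ` V) x"
  proof (rule orth_proj_eqI[OF cl, symmetric])
    show "A (cadjoint A x) \<in> A ` V" using fixp[of "cadjoint A x"] unfolding eq
      by (metis (mono_tags) bop_orth_proj[OF A V] eq image_eqI orth_proj_in[OF V])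
    fix z assume "z \<in> A ` V"
    then have z: "A (cadjoint A z) = z" by (simp add: eq)
    show "cinner (x - A (cadjoint A x)) z = 0"
      by (simp add: cinner_diff_left cadjoint[OF bopD(1)[OF A]] cadjoint_left[OF bopD(1)[OF A]] z)
  qed
qed

section \<open>Orthonormal bases and traces\<close>

definition orthonormal :: "'a::chilbert_space set \<Rightarrow> bool" where
  "orthonormal B \<longleftrightarrow> (\<forall>x\<in>B. \<forall>y\<in>B. cinner x y = (if x = y then 1 else 0))"

lemma orthonormal_subset: "orthonormal B \<Longrightarrow> Y \<subseteq> B \<Longrightarrow> orthonormal Y"
  unfolding orthonormal_def by (simp add: subset_iff)

lemma orthonormal_insert:
  assumes "orthonormal B" "cinner e e = 1" "\<And>b. b \<in> B \<Longrightarrow> cinner e b = 0"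
  shows "orthonormal (insert e B)"
proof -
  have "cinner b e = 0" if "b \<in> B" for b using assms(3)[OF that] by (simp add: cinner_zero_commute)
  moreover have "e \<notin> B" using assms(2,3) by force
  ultimately show ?thesis using assms unfolding orthonormal_def by auto
qed

lemma is_onb_altdef: "is_onb V B \<longleftrightarrow> B \<subseteq> V \<and> orthonormal B \<and> closed_span B = V"
  by (simp add: is_onb_def orthonormal_def)

lemma cinner_fourier_sum:
  assumes "finite F" "orthonormal F" "b \<in> F"
  shows "cinner (\<Sum>e\<in>F. c e *\<^sub>C e) b = c b"
proof -
  have "cinner (\<Sum>e\<in>F. c e *\<^sub>C e) b = (\<Sum>e\<in>F. if e = b then c e else 0)"
    unfolding cinner_sum_left cinner_scaleC_left
    using assms(2,3) by (intro sum.cong) (auto simp: orthonormal_def)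
  then show ?thesis using assms by simp
qed

lemma orthonormal_independent:
  assumes "finite F" "orthonormal F"
  shows "cvec.independent F"
proof
  assume "cvec.dependent F"
  then obtain u v where "v \<in> F" "u v \<noteq> 0" "(\<Sum>v\<in>F. u v *\<^sub>C v) = 0"
    using cvec.dependent_finite[OF assms(1)] by auto
  then show False using cinner_fourier_sum[OF assms, of v u] by simp
qed

lemma fourier_sum_orth:
  assumes "finite F" "orthonormal F" "z \<in> cvec.span F"
  shows "cinner (x - (\<Sum>e\<in>F. cinner x e *\<^sub>C e)) z = 0"
proof -
  define r where "r = x - (\<Sum>e\<in>F. cinner x e *\<^sub>C e)"
  have "cinner z r = 0"
    using assms(3)
  proof (induction rule: cvec.span_induct_alt)
    case (step c e y)
    have "cinner r e = 0"
      unfolding r_def cinner_diff_left cinner_fourier_sum[OF assms(1,2) step(1)] by simp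
    then show ?case using step
      by (simp add: cinner_add_left cinner_scaleC_left cinner_zero_commute)
  qed simp
  then show ?thesis unfolding r_def cinner_zero_commute[of z] .
qed

lemma norm_fourier_sum_diff_le:
  assumes "finite F" "orthonormal F" "z \<in> cvec.span F"
  shows "norm (x - (\<Sum>e\<in>F. cinner x e *\<^sub>C e)) \<le> norm (x - z)"
proof (rule power2_le_imp_le)
  let ?y = "\<Sum>e\<in>F. cinner x e *\<^sub>C e"
  have "?y - z \<in> cvec.span F"
    by (intro cvec.span_diff cvec.span_sum cvec.span_scale assms(3)) (auto intro: cvec.span_base)
  then have "cinner (x - ?y) (?y - z) = 0" by (rule fourier_sum_orth[OF assms(1,2)])
  from norm_orthogonal_add[OF this] show "(norm (x - ?y))\<^sup>2 \<le> (norm (x - z))\<^sup>2" by simp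
qed simp

text \<open>Finite Fourier sums are best approximations from the span. Once Y contains the vectors
  of one good approximation, its Fourier sum is at least as good, which is convergence along finite
  subsets.\<close>

lemma onb_has_sum:
  assumes B: "is_onb V B" and x: "x \<in> V"
  shows "((\<lambda>e. cinner x e *\<^sub>C e) has_sum x) B"
  unfolding has_sum_def tendsto_iff eventually_finite_subsets_at_top
proof (intro allI impI)
  fix d :: real assume "0 < d"
  moreover have "x \<in> closure (cvec.span B)" using B x by (simp add: is_onb_altdef closed_span_def)
  ultimately obtain s where s: "s \<in> cvec.span B" "dist s x < d"
    unfolding closure_approachable by blast
  then obtain F r where F: "finite F" "F \<subseteq> B" "s = (\<Sum>a\<in>F. r a *\<^sub>C a)"
    unfolding cvec.span_explicit by auto
  show "\<exists>X. finite X \<and> X \<subseteq> B \<and>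
      (\<forall>Y. finite Y \<and> X \<subseteq> Y \<and> Y \<subseteq> B \<longrightarrow> dist (\<Sum>e\<in>Y. cinner x e *\<^sub>C e) x < d)"
  proof (intro exI conjI allI impI)
    fix Y assume Y: "finite Y \<and> F \<subseteq> Y \<and> Y \<subseteq> B"
    have "s \<in> cvec.span Y" unfolding F(3)
      using Y by (intro cvec.span_sum cvec.span_scale cvec.span_base) auto
    moreover have "orthonormal Y" using B Y orthonormal_subset by (auto simp: is_onb_altdef)
    ultimately have "norm (x - (\<Sum>e\<in>Y. cinner x e *\<^sub>C e)) \<le> norm (x - s)"
      using Y by (intro norm_fourier_sum_diff_le) auto
    then show "dist (\<Sum>e\<in>Y. cinner x e *\<^sub>C e) x < d"
      using s(2) by (simp add: dist_norm norm_minus_commute)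
  qed (use F in auto)
qed

lemma onb_parseval:
  assumes B: "is_onb V B"
  shows "((\<lambda>e. cinner x e * cinner e y) has_sum cinner (orth_proj V x) y) B"
proof -
  have V: "closed_csubspace V"
    using B closed_csubspace_closed_span[of B] by (simp add: is_onb_altdef)
  have "((\<lambda>e. cinner (cinner (orth_proj V x) e *\<^sub>C e) y) has_sum cinner (orth_proj V x) y) B"
    by (rule has_sum_bounded_linear[OF bounded_linear_cinner_left])
      (rule onb_has_sum[OF B orth_proj_in[OF V]])
  then show ?thesis
    by (rule has_sum_cong[THEN iffD1, rotated])
      (use B cinner_orth_proj_left[OF V] in \<open>auto simp: cinner_scaleC_left is_onb_altdef\<close>)
qed

text \<open>Zorn's lemma for orthonormal subsets of V: a vector of V outside the closed span of a
  maximal set would leave a residual whose normalization enlarges the set.\<close>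

lemma onb_exists:
  assumes V: "closed_csubspace V"
  shows "\<exists>B. is_onb V B"
proof -
  define \<A> where "\<A> = {B. B \<subseteq> V \<and> orthonormal B}"
  have "\<exists>B\<in>\<A>. \<forall>X\<in>\<A>. B \<subseteq> X \<longrightarrow> X = B"
  proof (rule subset_Zorn')
    fix C assume C: "subset.chain \<A> C"
    have "cinner x y = (if x = y then 1 else 0)" if "X \<in> C" "x \<in> X" "Y \<in> C" "y \<in> Y" for x y X Y
    proof -
      have "X \<subseteq> Y \<or> Y \<subseteq> X" using C that unfolding subset_chain_def by blast
      then obtain Z where "Z \<in> C" "x \<in> Z" "y \<in> Z"
        using \<open>X \<in> C\<close> \<open>x \<in> X\<close> \<open>Y \<in> C\<close> \<open>y \<in> Y\<close> by (meson subsetD)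
      then show ?thesis using C unfolding subset_chain_def \<A>_def orthonormal_def by blast
    qed
    then have "orthonormal (\<Union>C)" unfolding orthonormal_def by blast
    moreover have "\<Union>C \<subseteq> V" using C unfolding subset_chain_def \<A>_def by blast
    ultimately show "\<Union>C \<in> \<A>" unfolding \<A>_def by blast
  qed
  then obtain B where B: "B \<subseteq> V" "orthonormal B"
    and max: "\<And>X. X \<subseteq> V \<Longrightarrow> orthonormal X \<Longrightarrow> B \<subseteq> X \<Longrightarrow> X = B"
    unfolding \<A>_def by (metis (no_types, lifting) mem_Collect_eq)
  have "closed_span B = V"
  proof
    show "closed_span B \<subseteq> V" by (rule closed_span_minimal[OF V B(1)])
    show "V \<subseteq> closed_span B"
    proof
      fix x assume x: "x \<in> V"
      define y where "y = x - orth_proj (closed_span B) x"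
      have yV: "y \<in> V" unfolding y_def
        using closed_csubspaceD(4)[OF V x] \<open>closed_span B \<subseteq> V\<close>
          orth_proj_in[OF closed_csubspace_closed_span] by blast
      have orth: "cinner y b = 0" if "b \<in> B" for b
        unfolding y_def
        by (rule orth_proj_orth[OF closed_csubspace_closed_span closed_span_superset[OF that]])
      have "y = 0"
      proof (rule ccontr)
        assume "y \<noteq> 0"
        define e where "e = of_real (1 / norm y) *\<^sub>C y"
        have "norm e = 1" using \<open>y \<noteq> 0\<close> by (simp add: e_def norm_scaleC norm_divide)
        then have e: "cinner e e = 1" by (simp add: cinner_self)
        have eb: "cinner e b = 0" if "b \<in> B" for b
          using orth[OF that] by (simp add: e_def cinner_scaleC_left)
        have "insert e B = B"
        proof (rule max)
          show "orthonormal (insert e B)" by (rule orthonormal_insert[OF B(2) e eb])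
        qed (use B yV closed_csubspaceD(3)[OF V] in \<open>auto simp: e_def\<close>)
        then show False using eb[of e] e by auto
      qed
      then show "x \<in> closed_span B"
        using orth_proj_in[OF closed_csubspace_closed_span, of B x] by (simp add: y_def)
    qed
  qed
  then show ?thesis using B by (auto simp: is_onb_altdef)
qed

text \<open>The basis in \<open>trace_on\<close> is an arbitrary choice, so a trace is determined by
  obtaining the same sum for every basis.\<close>

lemma trace_on_eqI:
  assumes "closed_csubspace V" "\<And>B. is_onb V B \<Longrightarrow> ((\<lambda>e. cinner (A e) e) has_sum t) B"
  shows "trace_on V A = t"
  unfolding trace_on_def
  by (rule infsumI, rule assms(2), rule someI_ex, rule onb_exists[OF assms(1)])

lemma has_sum_finite_sum:
  fixes f :: "'u \<Rightarrow> 'a \<Rightarrow> 'b::topological_comm_monoid_add"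
  assumes "finite U" "\<And>u. u \<in> U \<Longrightarrow> (f u has_sum s u) B"
  shows "((\<lambda>e. \<Sum>u\<in>U. f u e) has_sum (\<Sum>u\<in>U. s u)) B"
  using assms by (induction U rule: finite_induct) (auto intro!: has_sum_add)

text \<open>Parseval is applied to each rank one term; the projection appears because
  \<open>g u\<close> may lie outside V. Stating the hypothesis for the quadratic form on V makes it
  directly applicable to products of operators.\<close>

lemma trace_on_finite_rank:
  assumes V: "closed_csubspace V" and U: "finite U"
    and A: "\<And>e. e \<in> V \<Longrightarrow> cinner (A e) e = (\<Sum>u\<in>U. cinner e (f u) * cinner (g u) e)"
  shows "trace_on V A = (\<Sum>u\<in>U. cinner (orth_proj V (g u)) (f u))"
proof (rule trace_on_eqI[OF V])
  fix B assume B: "is_onb V B"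
  have "((\<lambda>e. \<Sum>u\<in>U. cinner (g u) e * cinner e (f u)) has_sum
      (\<Sum>u\<in>U. cinner (orth_proj V (g u)) (f u))) B"
    by (intro has_sum_finite_sum U onb_parseval[OF B])
  then show "((\<lambda>e. cinner (A e) e) has_sum (\<Sum>u\<in>U. cinner (orth_proj V (g u)) (f u))) B"
  proof (rule has_sum_cong[THEN iffD1, rotated])
    fix e assume "e \<in> B"
    then have "e \<in> V" using B by (auto simp: is_onb_altdef)
    from A[OF this] show "(\<Sum>u\<in>U. cinner (g u) e * cinner e (f u)) = cinner (A e) e"
      by (simp add: mult.commute)
  qed
qed

text \<open>Orthonormal sets are independent, so those in V have at most \<open>card S\<close>
  elements and one of largest cardinality exists. A nonzero residual of the expansion would enlarge
  it.\<close>

lemma finite_onb_exists: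
  assumes V: "cvec.subspace (V :: 'a::chilbert_space set)" and S: "finite S" "V \<subseteq> cvec.span S"
  shows "\<exists>B. finite B \<and> orthonormal B \<and> B \<subseteq> V \<and> (\<forall>x\<in>V. x = (\<Sum>b\<in>B. cinner x b *\<^sub>C b))"
proof -
  define P where "P B \<longleftrightarrow> finite B \<and> orthonormal B \<and> B \<subseteq> V" for B
  have "card B < Suc (card S)" if "P B" for B
  proof -
    have "card B \<le> card S"
      using cvec.independent_span_bound[OF S(1), of B] orthonormal_independent[of B] that S(2)
      unfolding P_def by (meson subset_trans)
    then show ?thesis by simp
  qed
  moreover have "P {}" by (simp add: P_def orthonormal_def)
  ultimately obtain B where B: "P B" and max: "\<And>X. P X \<Longrightarrow> card X \<le> card B"
    using ex_has_greatest_nat[of P "{}" card "Suc (card S)"] by blast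
  have "x = (\<Sum>b\<in>B. cinner x b *\<^sub>C b)" if x: "x \<in> V" for x
  proof (rule ccontr)
    define y where "y = x - (\<Sum>b\<in>B. cinner x b *\<^sub>C b)"
    assume "x \<noteq> (\<Sum>b\<in>B. cinner x b *\<^sub>C b)"
    then have "y \<noteq> 0" by (simp add: y_def)
    have yV: "y \<in> V" unfolding y_def
      using B x by (intro cvec.subspace_diff[OF V] cvec.subspace_sum[OF V] cvec.subspace_scale[OF V])
        (auto simp: P_def)
    have orth: "cinner y b = 0" if "b \<in> B" for b
      unfolding y_def using B that by (intro fourier_sum_orth cvec.span_base) (auto simp: P_def)
    define e where "e = of_real (1 / norm y) *\<^sub>C y"
    have "norm e = 1" using \<open>y \<noteq> 0\<close> by (simp add: e_def norm_scaleC norm_divide)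
    then have e: "cinner e e = 1" by (simp add: cinner_self)
    have eb: "cinner e b = 0" if "b \<in> B" for b
      using orth[OF that] by (simp add: e_def cinner_scaleC_left)
    have "e \<notin> B" using eb[of e] e by auto
    moreover have "e \<in> V" unfolding e_def by (rule cvec.subspace_scale[OF V yV])
    then have "P (insert e B)" using B orthonormal_insert[OF _ e eb] by (simp add: P_def)
    ultimately show False using max[of "insert e B"] B by (auto simp: P_def)
  qed
  then show ?thesis using B by (auto simp: P_def)
qed

section \<open>Square roots of positive operators\<close>

text \<open>Complex polarization: f vanishes on the diagonal because \<open>cinner (R z) z\<close>
  is real. Expanding at x + y gives f x y + f y x = 0, expanding at x + i y gives f y x = f x
  y.\<close>

lemma positive_op_selfadjoint:
  assumes R: "bounded_clinear R" "positive_op R"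
  shows "cinner (R x) y = cinner x (R y)"
proof -
  define f where "f x y = cinner (R x) y - cinner x (R y)" for x y
  note lin = bounded_clinearD[OF R(1)]
  have diag: "f z z = 0" for z
  proof -
    have "cinner (R z) z \<in> \<real>" using R(2) by (simp add: positive_op_def)
    then show ?thesis using cinner_commute[of z "R z"] by (simp add: f_def Reals_cnj_iff)
  qed
  have add: "f (x + y) (x + y) = f x x + f x y + f y x + f y y" for x y
    by (simp add: f_def lin cinner_add_left cinner_add_right)
  have sum0: "f x y + f y x = 0" using add[of x y] by (simp add: diag)
  have "- \<i> * f x y + \<i> * f y x = 0"
    using add[of x "\<i> *\<^sub>C y"] unfolding diag
    by (simp add: f_def lin cinner_scaleC_left cinner_scaleC_right algebra_simps)
  then have "\<i> * (f y x - f x y) = 0" by (simp add: algebra_simps)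
  then have "f y x = f x y" by simp
  with sum0 have "2 * f x y = 0" by simp
  then have "f x y = 0" by simp
  then show ?thesis by (simp add: f_def)
qed

text \<open>\<open>nonneg_poly C X r\<close>: the operator \<open>X\<close> is \<open>p(C)\<close> for a polynomial \<open>p\<close> with nonnegative
  coefficients and \<open>p(1) = r\<close>. If \<open>C\<close> is a contraction then \<open>r\<close> bounds the norm of \<open>X\<close>.\<close>

inductive nonneg_poly :: "('a::chilbert_space \<Rightarrow> 'a) \<Rightarrow> ('a \<Rightarrow> 'a) \<Rightarrow> real \<Rightarrow> bool" for C where
  zero: "nonneg_poly C (\<lambda>x. 0) 0"
| gen: "nonneg_poly C C 1"
| add: "nonneg_poly C X r \<Longrightarrow> nonneg_poly C Z s \<Longrightarrow> nonneg_poly C (\<lambda>x. X x + Z x) (r + s)"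
| half: "nonneg_poly C X r \<Longrightarrow> nonneg_poly C (\<lambda>x. (1 / 2) *\<^sub>C X x) (r / 2)"
| comp: "nonneg_poly C X r \<Longrightarrow> nonneg_poly C Z s \<Longrightarrow> nonneg_poly C (\<lambda>x. X (Z x)) (r * s)"

context
  fixes C :: "'a::chilbert_space \<Rightarrow> 'a"
  assumes C: "bounded_clinear C" and sa: "\<And>x y. cinner (C x) y = cinner x (C y)"
    and contr: "\<And>x. norm (C x) \<le> norm x"
begin

lemma nonneg_poly_bounded:
  "nonneg_poly C X r \<Longrightarrow> bounded_clinear X \<and> r \<ge> 0 \<and> (\<forall>x. norm (X x) \<le> r * norm x)"
proof (induction rule: nonneg_poly.induct)
  case zero
  then show ?case by (auto intro: bounded_clinearI[where K = 0])
next
  case gen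
  then show ?case using C contr by simp
next
  case (add X r Z s)
  have le: "norm (X x + Z x) \<le> (r + s) * norm x" for x
    using norm_triangle_mono[of "X x" "r * norm x" "Z x" "s * norm x"] add.IH by (simp add: distrib_right)
  then have "bounded_clinear (\<lambda>x. X x + Z x)"
    using add.IH by (intro bounded_clinearI[where K = "r + s"]) (simp_all add: bounded_clinearD scaleC_add_right)
  then show ?case using add.IH le by auto
next
  case (half X r)
  have le: "norm ((1 / 2) *\<^sub>C X x) \<le> (r / 2) * norm x" for x
    using half.IH by (simp add: norm_scaleC norm_divide)
  then have "bounded_clinear (\<lambda>x. (1 / 2) *\<^sub>C X x)"
    using half.IH by (intro bounded_clinearI[where K = "r / 2"])
      (simp_all add: bounded_clinearD scaleC_add_right scaleC_scaleC)
  then show ?case using half.IH le by auto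
next
  case (comp X r Z s)
  have "norm (X (Z x)) \<le> (r * s) * norm x" for x
  proof -
    have "norm (X (Z x)) \<le> r * norm (Z x)" using comp.IH by blast
    also have "\<dots> \<le> r * (s * norm x)" using comp.IH by (intro mult_left_mono) auto
    finally show ?thesis by simp
  qed
  then show ?case using comp.IH bounded_clinear_compose[of X Z] by auto
qed

lemma nonneg_poly_commute_gen:
  "nonneg_poly C X r \<Longrightarrow> X (C x) = C (X x)"
  by (induction arbitrary: x rule: nonneg_poly.induct) (simp_all add: bounded_clinearD[OF C])

lemma nonneg_poly_commute:
  assumes "nonneg_poly C X r" "nonneg_poly C Z s"
  shows "X (Z x) = Z (X x)"
proof -
  note lin = bounded_clinearD[OF conjunct1[OF nonneg_poly_bounded[OF assms(2)]]]
  show ?thesis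
    using assms(1)
    by (induction arbitrary: x rule: nonneg_poly.induct)
      (simp_all add: lin nonneg_poly_commute_gen[OF assms(2)])
qed

lemma nonneg_poly_selfadjoint:
  "nonneg_poly C X r \<Longrightarrow> cinner (X x) y = cinner x (X y)"
proof (induction arbitrary: x y rule: nonneg_poly.induct)
  case (comp X r Z s)
  then show ?case using nonneg_poly_commute[OF comp(1,2)] by simp
qed (simp_all add: sa cinner_add_left cinner_add_right cinner_scaleC_left cinner_scaleC_right)

text \<open>Iteration for Z = (C + Z^2) / 2, whose solution satisfies (I - Z)^2 = I - C. Starting at
  0 keeps all iterates and increments polynomials in C with nonnegative coefficients.\<close>

private primrec Y :: "nat \<Rightarrow> 'a \<Rightarrow> 'a" where
  "Y 0 = (\<lambda>x. 0)"
| "Y (Suc m) = (\<lambda>x. (1 / 2) *\<^sub>C (C x + Y m (Y m x)))"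

text \<open>The same iteration with C replaced by the number 1, that is the coefficient sum of the
  polynomial \<open>Y m\<close>, which bounds its norm.\<close>

private primrec y :: "nat \<Rightarrow> real" where
  "y 0 = 0"
| "y (Suc m) = (1 + y m * y m) / 2"

private lemma Y_poly: "nonneg_poly C (Y m) (y m)"
proof (induction m)
  case (Suc m)
  then show ?case
    unfolding Y.simps y.simps by (intro nonneg_poly.half nonneg_poly.add nonneg_poly.gen nonneg_poly.comp)
qed (simp add: nonneg_poly.zero)

private lemma y_bounds: "0 \<le> y m" "y m \<le> 1"
proof -
  have "0 \<le> y m \<and> y m \<le> 1"
    by (induction m) (auto simp: mult_le_one)
  then show "0 \<le> y m" "y m \<le> 1" by auto
qed

text \<open>Because the iterates commute, the next increment is half the product of the sum and the
  difference of the two previous iterates; nonnegative coefficients are inherited.\<close>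

private lemma Y_diff_Suc: "nonneg_poly C (\<lambda>x. Y (Suc m) x - Y m x) (y (Suc m) - y m)"
proof (induction m)
  case 0
  have "nonneg_poly C (\<lambda>x. (1 / 2) *\<^sub>C C x) (1 / 2)" by (intro nonneg_poly.intros)
  then show ?case by simp
next
  case (Suc m)
  let ?D = "\<lambda>x. Y (Suc m) x - Y m x"
  have "nonneg_poly C (\<lambda>x. (1 / 2) *\<^sub>C (Y (Suc m) (?D x) + Y m (?D x)))
      ((y (Suc m) * (y (Suc m) - y m) + y m * (y (Suc m) - y m)) / 2)"
    by (intro nonneg_poly.half nonneg_poly.add nonneg_poly.comp[OF Y_poly Suc])
  moreover have "(1 / 2) *\<^sub>C (Y (Suc m) (?D x) + Y m (?D x)) = Y (Suc (Suc m)) x - Y (Suc m) x" for x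
  proof -
    have lin: "Y l (a - b) = Y l a - Y l b" for l a b
      using nonneg_poly_bounded[OF Y_poly[of l]] by (simp add: bounded_clinearD)
    have comm: "Y m (Y (Suc m) x) = Y (Suc m) (Y m x)"
      by (rule nonneg_poly_commute[OF Y_poly Y_poly])
    have "Y (Suc m) (?D x) + Y m (?D x) = (C x + Y (Suc m) (Y (Suc m) x)) - (C x + Y m (Y m x))"
      unfolding lin comm by simp
    then show ?thesis by (simp only: cvec.scale_right_diff_distrib Y.simps(2)[of "Suc m"] Y.simps(2)[of m])
  qed
  moreover have "(y (Suc m) * (y (Suc m) - y m) + y m * (y (Suc m) - y m)) / 2
      = y (Suc (Suc m)) - y (Suc m)"
    by (simp add: field_simps)
  ultimately show ?case by (simp only:)
qed

private lemma Y_diff: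
  assumes "m \<le> l"
  shows "nonneg_poly C (\<lambda>x. Y l x - Y m x) (y l - y m)"
  using assms
proof (induction l rule: dec_induct)
  case base
  then show ?case using nonneg_poly.zero[of C] by simp
next
  case (step l)
  from nonneg_poly.add[OF Y_diff_Suc[of l] step.IH] show ?case
    by (simp del: Y.simps y.simps)
qed

text \<open>Increments of \<open>Y m x\<close> are bounded by those of y times
  \<open>norm x\<close>, and y is increasing and bounded by 1. So the iterates converge pointwise to
  a contraction Z, and R = I - Z is the root; it is positive because Z is a contraction.\<close>

lemma contraction_sqrt_exists:
  "\<exists>R. bounded_clinear R \<and> positive_op R \<and> R \<circ> R = (\<lambda>x. x - C x)"
proof -
  have diff: "norm (Y l x - Y m x) \<le> (y l - y m) * norm x" "y m \<le> y l" if "m \<le> l" for l m x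
    using nonneg_poly_bounded[OF Y_diff[OF that]] by auto
  have "incseq y" using diff(2) by (simp add: incseq_def)
  then have "Cauchy y"
    using incseq_convergent[of y 1] y_bounds by (metis LIMSEQ_imp_Cauchy)
  have "convergent (\<lambda>m. Y m x)" for x
  proof (rule Cauchy_convergent, rule metric_CauchyI)
    fix e :: real assume "0 < e"
    then have "0 < e / (norm x + 1)" by (simp add: add_nonneg_pos)
    then obtain N where N: "\<And>m l. m \<ge> N \<Longrightarrow> l \<ge> N \<Longrightarrow> dist (y m) (y l) < e / (norm x + 1)"
      using metric_CauchyD[OF \<open>Cauchy y\<close>] by blast
    have le: "dist (Y m x) (Y l x) < e" if "N \<le> m" "m \<le> l" for m l
    proof -
      have "y l - y m \<le> e / (norm x + 1)" using N[of m l] that by (simp add: dist_real_def)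
      then have "(y l - y m) * norm x \<le> e / (norm x + 1) * norm x" by (rule mult_right_mono) simp
      also have "\<dots> < e / (norm x + 1) * (norm x + 1)"
        using \<open>0 < e / (norm x + 1)\<close> by (intro mult_strict_left_mono) auto
      also have "\<dots> = e" using norm_ge_zero[of x] by (simp add: add_nonneg_eq_0_iff)
      finally show ?thesis using diff(1)[OF that(2), of x] by (simp add: dist_norm norm_minus_commute)
    qed
    have "dist (Y m x) (Y l x) < e" if "m \<ge> N" "l \<ge> N" for m l
      using le[of m l] le[of l m] that by (cases "m \<le> l") (auto simp: dist_commute)
    then show "\<exists>N. \<forall>m\<ge>N. \<forall>n\<ge>N. dist (Y m x) (Y n x) < e" by blast
  qed
  then obtain Z where Z: "\<And>x. (\<lambda>m. Y m x) \<longlonglongrightarrow> Z x" unfolding convergent_def by metis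
  have Ylin: "Y m (a + b) = Y m a + Y m b" "Y m (c *\<^sub>C a) = c *\<^sub>C Y m a" "norm (Y m a) \<le> norm a"
    "Y m (a - b) = Y m a - Y m b" for m a b c
  proof -
    have "norm (Y m a) \<le> y m * norm a" using nonneg_poly_bounded[OF Y_poly[of m]] by blast
    also have "\<dots> \<le> 1 * norm a" by (rule mult_right_mono[OF y_bounds(2)]) simp
    finally show "norm (Y m a) \<le> norm a" by simp
  qed (use nonneg_poly_bounded[OF Y_poly[of m]] in \<open>simp_all add: bounded_clinearD\<close>)
  have Znorm: "norm (Z x) \<le> norm x" for x
    by (rule LIMSEQ_le_const2[OF tendsto_norm[OF Z]]) (use Ylin(3) in blast)
  have Zlin: "bounded_clinear Z"
  proof (rule bounded_clinearI[where K = 1])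
    fix a b c
    show "Z (a + b) = Z a + Z b"
      using LIMSEQ_unique[OF Z tendsto_add[OF Z[of a] Z[of b], folded Ylin(1)]] by simp
    show "Z (c *\<^sub>C a) = c *\<^sub>C Z a"
      using LIMSEQ_unique[OF Z bounded_linear.tendsto[OF bounded_linear_scaleC Z[of a], folded Ylin(2)]] by simp
  qed (simp add: Znorm)
  have Zsa: "cinner (Z a) b = cinner a (Z b)" for a b
  proof -
    have "(\<lambda>m. cinner (Y m a) b) \<longlonglongrightarrow> cinner (Z a) b"
      by (rule bounded_linear.tendsto[OF bounded_linear_cinner_left Z])
    moreover have "(\<lambda>m. cinner (Y m b) a) \<longlonglongrightarrow> cinner (Z b) a"
      by (rule bounded_linear.tendsto[OF bounded_linear_cinner_left Z])
    then have "(\<lambda>m. cnj (cinner (Y m b) a)) \<longlonglongrightarrow> cnj (cinner (Z b) a)" by (rule tendsto_cnj)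
    then have "(\<lambda>m. cinner (Y m a) b) \<longlonglongrightarrow> cinner a (Z b)"
      using nonneg_poly_selfadjoint[OF Y_poly] by (simp add: cinner_commute[symmetric])
    ultimately show ?thesis by (rule LIMSEQ_unique)
  qed
  have Zfix: "Z x = (1 / 2) *\<^sub>C (C x + Z (Z x))" for x
  proof -
    \<comment> \<open>The bound \<open>norm (Y m a) \<le> norm a\<close>, uniform in m, lets the
      limit pass through the square.\<close>
    have "(\<lambda>m. Y m (Y m x - Z x)) \<longlonglongrightarrow> 0"
    proof (rule Lim_null_comparison)
      show "\<forall>\<^sub>F m in sequentially. norm (Y m (Y m x - Z x)) \<le> norm (Y m x - Z x)"
        using Ylin(3) by simp
      show "(\<lambda>m. norm (Y m x - Z x)) \<longlonglongrightarrow> 0"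
        using Z[of x] by (simp add: LIM_zero tendsto_norm_zero)
    qed
    from tendsto_add[OF this Z[of "Z x"]] have "(\<lambda>m. Y m (Y m x)) \<longlonglongrightarrow> Z (Z x)"
      by (simp add: Ylin(4))
    then have "(\<lambda>m. Y (Suc m) x) \<longlonglongrightarrow> (1 / 2) *\<^sub>C (C x + Z (Z x))"
      unfolding Y.simps by (intro bounded_linear.tendsto[OF bounded_linear_scaleC] tendsto_add tendsto_const)
    moreover have "(\<lambda>m. Y (Suc m) x) \<longlonglongrightarrow> Z x" using Z[of x] by (rule LIMSEQ_Suc)
    ultimately show ?thesis using LIMSEQ_unique by blast
  qed
  define R where "R x = x - Z x" for x
  have "bounded_clinear R"
  proof (rule bounded_clinearI[where K = 2])
    fix a
    show "norm (R a) \<le> 2 * norm a"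
      using norm_triangle_ineq4[of a "Z a"] Znorm[of a] by (simp add: R_def)
  qed (simp_all add: R_def bounded_clinearD[OF Zlin] cvec.scale_right_diff_distrib)
  moreover have "positive_op R"
    unfolding positive_op_def
  proof (intro allI conjI)
    fix x
    have "cnj (cinner (R x) x) = cinner (R x) x"
      unfolding R_def cinner_diff_left by (simp add: cinner_commute[symmetric] Zsa)
    then show "cinner (R x) x \<in> \<real>" by (simp add: Reals_cnj_iff)
    have "Re (cinner (Z x) x) \<le> norm (Z x) * norm x"
      using complex_Re_le_cmod norm_cinner_le order_trans by blast
    also have "\<dots> \<le> norm x * norm x" by (intro mult_right_mono Znorm) simp
    finally show "0 \<le> Re (cinner (R x) x)"
      by (simp add: R_def cinner_diff_left cinner_self power2_eq_square)
  qed
  moreover have "R (R x) = x - C x" for x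
  proof -
    have "Z x + Z x = C x + Z (Z x)"
      using arg_cong[OF Zfix[of x], of "(*\<^sub>C) 2"]
      by (simp add: scaleC_scaleC scaleC_one scaleC_add_left[of 1 1, simplified])
    then show ?thesis by (simp add: R_def bounded_clinearD[OF Zlin] algebra_simps)
  qed
  ultimately show ?thesis by (intro exI[of _ R]) (auto simp: o_def fun_eq_iff)
qed

end

section \<open>Square-summable families\<close>

lemma ell2_eqI: "(\<And>i. coord x i = coord y i) \<Longrightarrow> x = y"
  by (simp add: coord_inject[symmetric] fun_eq_iff)

lemmas coord_simps [simp] =
  plus_ell2.rep_eq minus_ell2.rep_eq zero_ell2.rep_eq scaleC_ell2.rep_eq uminus_ell2.rep_eq

lemma coord_sum: "coord (sum f A) i = (\<Sum>a\<in>A. coord (f a) i)"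
  by (induction A rule: infinite_finite_induct) simp_all

lemma bounded_clinear_coord: "bounded_clinear (\<lambda>x. coord x i)"
  by (rule bounded_clinearI[where K = 1]) (simp_all add: ell2_coord_le)

lemma continuous_on_coord: "continuous_on S (\<lambda>x. coord x i)"
  by (intro linear_continuous_on bounded_clinearD(3) bounded_clinear_coord)

lemma closed_csubspace_Collect_all:
  "(\<And>i. closed_csubspace {x. P i x}) \<Longrightarrow> closed_csubspace {x. \<forall>i. P i x}"
  unfolding closed_csubspace_def cvec.subspace_def by (simp add: closed_Collect_all)

lemma closed_csubspace_Collect_conj:
  "closed_csubspace {x. P x} \<Longrightarrow> closed_csubspace {x. Q x} \<Longrightarrow> closed_csubspace {x. P x \<and> Q x}"
  unfolding closed_csubspace_def cvec.subspace_def by (simp add: closed_Collect_conj)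

lemma closed_csubspace_Collect_imp:
  "(c \<Longrightarrow> closed_csubspace {x. P x}) \<Longrightarrow> closed_csubspace {x. c \<longrightarrow> P x}"
  by (cases c) (simp_all add: closed_csubspace_UNIV)

lemma closed_csubspace_coord:
  "closed_csubspace {x. coord x i = 0}" "closed_csubspace {x. coord x i = coord x l}"
  unfolding closed_csubspace_def cvec.subspace_def
  by (auto intro!: closed_Collect_eq continuous_on_coord)

lemma closed_csubspace_coord_mem:
  assumes D: "closed_csubspace D"
  shows "closed_csubspace {x. coord x i \<in> D}"
proof -
  have "closed {x. coord x i \<in> D}"
    using continuous_closed_vimage[OF closed_csubspaceD(5)[OF D]
        linear_continuous_at[OF bounded_clinearD(3)[OF bounded_clinear_coord]], of i]
    by (simp add: vimage_def)
  then show ?thesis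
    unfolding closed_csubspace_def cvec.subspace_def by (auto intro: closed_csubspaceD[OF D])
qed

lift_definition single :: "'i \<Rightarrow> 'e::chilbert_space \<Rightarrow> ('i, 'e) ell2" is
  "\<lambda>j v i. if i = j then v else 0"
  by (rule finite_nonzero_values_imp_summable_on) (rule finite_subset[of _ "{_}"], auto)

lemma cinner_single_right: "cinner x (single i v) = cinner (coord x i) v"
proof -
  have "cinner x (single i v) = (\<Sum>\<^sub>\<infinity>l\<in>{i}. cinner (coord x l) (coord (single i v) l))"
    unfolding cinner_ell2_def by (rule infsum_cong_neutral) (auto simp: single.rep_eq)
  then show ?thesis by (simp add: single.rep_eq)
qed

text \<open>Pythagoras: the squared error of a partial sum is the missing part of the squared norm.
  S is any set containing the support, since the Berezin kernel is a sum over words.\<close>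

lemma ell2_has_sum_single:
  fixes x :: "('i, 'e::chilbert_space) ell2"
  assumes supp: "\<And>i. coord x i \<noteq> 0 \<Longrightarrow> i \<in> S"
  shows "((\<lambda>i. single i (coord x i)) has_sum x) S"
  unfolding has_sum_def tendsto_iff eventually_finite_subsets_at_top
proof (intro allI impI)
  fix e :: real assume "0 < e"
  have "((\<lambda>i. (norm (coord x i))\<^sup>2) has_sum (norm x)\<^sup>2) UNIV"
    unfolding ell2_norm_sq by (rule has_sum_infsum[OF coord_summable])
  then have "((\<lambda>i. (norm (coord x i))\<^sup>2) has_sum (norm x)\<^sup>2) S"
    by (rule has_sum_cong_neutral[THEN iffD1, rotated 3]) (use supp in auto)
  moreover have "0 < e\<^sup>2" using \<open>0 < e\<close> by simp
  ultimately obtain X where X: "finite X" "X \<subseteq> S"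
    "\<And>Y. finite Y \<Longrightarrow> X \<subseteq> Y \<Longrightarrow> Y \<subseteq> S \<Longrightarrow> dist (\<Sum>i\<in>Y. (norm (coord x i))\<^sup>2) ((norm x)\<^sup>2) < e\<^sup>2"
    unfolding has_sum_def tendsto_iff eventually_finite_subsets_at_top by metis
  show "\<exists>X. finite X \<and> X \<subseteq> S \<and> (\<forall>Y. finite Y \<and> X \<subseteq> Y \<and> Y \<subseteq> S \<longrightarrow>
      dist (\<Sum>i\<in>Y. single i (coord x i)) x < e)"
  proof (intro exI conjI allI impI)
    fix Y assume Y: "finite Y \<and> X \<subseteq> Y \<and> Y \<subseteq> S"
    define s where "s = (\<Sum>i\<in>Y. single i (coord x i))"
    have s: "coord s i = coord x i" if "i \<in> Y" for i
      using that Y by (simp add: s_def coord_sum single.rep_eq sum.delta)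
    have "cinner s s = cinner s (\<Sum>i\<in>Y. single i (coord x i))" by (simp add: s_def)
    also have "\<dots> = of_real (\<Sum>i\<in>Y. (norm (coord x i))\<^sup>2)"
      unfolding cinner_sum_right cinner_single_right using s by (simp add: cinner_self)
    finally have ss: "(norm s)\<^sup>2 = (\<Sum>i\<in>Y. (norm (coord x i))\<^sup>2)"
      unfolding cinner_self using of_real_eq_iff by blast
    have "cinner (x - s) (\<Sum>i\<in>Y. single i (coord x i)) = 0"
      unfolding cinner_sum_right cinner_single_right using s by simp
    from norm_orthogonal_add[of "x - s" s] this
    have "(norm (x - s))\<^sup>2 = (norm x)\<^sup>2 - (\<Sum>i\<in>Y. (norm (coord x i))\<^sup>2)"
      by (simp add: ss s_def[symmetric])
    also have "\<dots> < e\<^sup>2" using X(3)[of Y] Y by (simp add: dist_real_def)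
    finally show "dist (\<Sum>i\<in>Y. single i (coord x i)) x < e"
      using \<open>0 < e\<close> by (simp add: s_def dist_norm norm_minus_commute power_less_imp_less_base)
  qed (use X in auto)
qed

text \<open>Diagonal projections. Homogeneous components, the vacuum projection and the range
  projections of index shifts all have this form.\<close>

lift_definition ell2_restrict :: "'i set \<Rightarrow> ('i, 'e::chilbert_space) ell2 \<Rightarrow> ('i, 'e) ell2" is
  "\<lambda>S f i. if i \<in> S then f i else 0"
  subgoal for S f by (rule summable_on_comparison_test[of "\<lambda>i. (norm (f i))\<^sup>2"]) auto
  done

lemma cinner_restrict_left: "cinner (ell2_restrict S x) y = cinner x (ell2_restrict S y)"
  unfolding cinner_ell2_def by (rule infsum_cong) (simp add: ell2_restrict.rep_eq)

lemma restrict_restrict: "ell2_restrict S (ell2_restrict T x) = ell2_restrict (S \<inter> T) x"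
  by (rule ell2_eqI) (simp add: ell2_restrict.rep_eq)

lemma norm_restrict_le: "norm (ell2_restrict S x) \<le> norm x"
proof (rule power2_le_imp_le)
  show "(norm (ell2_restrict S x))\<^sup>2 \<le> (norm x)\<^sup>2"
    unfolding ell2_norm_sq
    by (intro infsum_mono coord_summable) (simp add: ell2_restrict.rep_eq)
qed simp

lemma bounded_clinear_restrict: "bounded_clinear (ell2_restrict S)"
  by (rule bounded_clinearI[where K = 1]) (simp_all add: ell2_eqI ell2_restrict.rep_eq norm_restrict_le)

text \<open>The adjoint of the isometry sending the basis vector of i to that of h i. The test
  \<open>inj h\<close> makes the operation total: otherwise a coordinate could be repeated
  infinitely often and summability be lost.\<close>

lift_definition pull_back :: "('i \<Rightarrow> 'i) \<Rightarrow> ('i, 'e::chilbert_space) ell2 \<Rightarrow> ('i, 'e) ell2" is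
  "\<lambda>h f i. if inj h then f (h i) else 0"
proof -
  fix h :: "'i \<Rightarrow> 'i" and f :: "'i \<Rightarrow> 'e"
  assume f: "(\<lambda>i. (norm (f i))\<^sup>2) summable_on UNIV"
  show "(\<lambda>i. (norm (if inj h then f (h i) else 0))\<^sup>2) summable_on UNIV"
  proof (cases "inj h")
    case True
    have "(\<lambda>i. (norm (f i))\<^sup>2) summable_on range h"
      using f by (rule summable_on_subset_banach) simp
    then show ?thesis using True by (subst (asm) summable_on_reindex) (auto simp: o_def)
  qed simp
qed

lemma cinner_pull_back:
  assumes "inj h"
  shows "cinner (pull_back h x) (pull_back h y) = cinner (ell2_restrict (range h) x) y"
proof -
  have "cinner (ell2_restrict (range h) x) y = (\<Sum>\<^sub>\<infinity>i\<in>range h. cinner (coord x i) (coord y i))"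
    unfolding cinner_ell2_def by (rule infsum_cong_neutral) (auto simp: ell2_restrict.rep_eq)
  then show ?thesis
    by (simp add: infsum_reindex[OF assms] o_def cinner_ell2_def pull_back.rep_eq assms)
qed

lemma bounded_clinear_pull_back: "bounded_clinear (pull_back h)"
proof (rule bounded_clinearI[where K = 1])
  fix x :: "('a, 'b) ell2"
  show "norm (pull_back h x) \<le> 1 * norm x"
  proof (cases "inj h")
    case True
    have "cinner (pull_back h x) (pull_back h x)
        = cinner (ell2_restrict (range h) x) (ell2_restrict (range h) x)"
      by (simp add: cinner_pull_back[OF True] cinner_restrict_left restrict_restrict)
    then have "(norm (pull_back h x))\<^sup>2 = (norm (ell2_restrict (range h) x))\<^sup>2"
      unfolding cinner_self using of_real_eq_iff by blast
    then have "norm (pull_back h x) = norm (ell2_restrict (range h) x)" by (simp add: power2_eq_iff_nonneg)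
    then show ?thesis by (simp add: norm_restrict_le)
  next
    case False
    then have "pull_back h x = 0" by (intro ell2_eqI) (simp add: pull_back.rep_eq)
    then show ?thesis by simp
  qed
qed (simp_all add: ell2_eqI pull_back.rep_eq)

text \<open>\<open>map_coord u\<close> is \<open>I \<otimes> u\<close>, and \<open>0\<close> if \<open>u\<close> is not bounded.\<close>

lift_definition map_coord ::
  "('e::chilbert_space \<Rightarrow> 'f::chilbert_space) \<Rightarrow> ('i, 'e) ell2 \<Rightarrow> ('i, 'f) ell2" is
  "\<lambda>u f i. if bounded_clinear u then u (f i) else 0"
proof -
  fix u :: "'e \<Rightarrow> 'f" and f :: "'i \<Rightarrow> 'e"
  assume f: "(\<lambda>i. (norm (f i))\<^sup>2) summable_on UNIV"
  show "(\<lambda>i. (norm (if bounded_clinear u then u (f i) else 0))\<^sup>2) summable_on UNIV"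
  proof (cases "bounded_clinear u")
    case True
    obtain K where K: "K \<ge> 0" "\<And>x. norm (u x) \<le> norm x * K"
      using bounded_linear.nonneg_bounded[OF bounded_clinearD(3)[OF True]] by blast
    have "(norm (u (f i)))\<^sup>2 \<le> (norm (f i))\<^sup>2 * K\<^sup>2" for i
      using power_mono[OF K(2)[of "f i"], of 2] by (simp add: power_mult_distrib)
    then show ?thesis
      using summable_on_comparison_test[OF summable_on_cmult_left[OF f, of "K\<^sup>2"]] True by auto
  qed simp
qed

lemma bounded_clinear_map_coord:
  assumes u: "bounded_clinear u"
  shows "bounded_clinear (map_coord u)"
proof -
  obtain K where K: "K \<ge> 0" "\<And>x. norm (u x) \<le> norm x * K"
    using bounded_linear.nonneg_bounded[OF bounded_clinearD(3)[OF u]] by blast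
  show ?thesis
  proof (rule bounded_clinearI[where K = K])
    fix x
    have "(norm (u v))\<^sup>2 \<le> (norm v)\<^sup>2 * K\<^sup>2" for v
      using power_mono[OF K(2)[of v], of 2] by (simp add: power_mult_distrib)
    then have "(norm (map_coord u x))\<^sup>2 \<le> (\<Sum>\<^sub>\<infinity>i. (norm (coord x i))\<^sup>2 * K\<^sup>2)"
      unfolding ell2_norm_sq using coord_summable[of "map_coord u x"]
      by (intro infsum_mono coord_summable summable_on_cmult_left)
        (simp_all add: map_coord.rep_eq u)
    also have "\<dots> = (norm x)\<^sup>2 * K\<^sup>2" by (simp add: infsum_cmult_left' ell2_norm_sq)
    finally have "(norm (map_coord u x))\<^sup>2 \<le> (K * norm x)\<^sup>2"
      by (simp add: power_mult_distrib mult.commute)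
    then show "norm (map_coord u x) \<le> K * norm x"
      by (rule power2_le_imp_le) (simp add: K(1))
  qed (simp_all add: ell2_eqI map_coord.rep_eq u bounded_clinearD[OF u])
qed

lemma cinner_map_coord:
  assumes u: "bounded_clinear u"
  shows "cinner (map_coord u x) y = cinner x (map_coord (cadjoint u) y)"
  unfolding cinner_ell2_def
  by (rule infsum_cong) (simp add: map_coord.rep_eq u bounded_clinear_cadjoint cadjoint)

section \<open>Symmetric Fock spaces\<close>

text \<open>Two words have the same multiset of letters iff a permutation of positions carries one
  to the other. This makes multisets the index set of the basis.\<close>

lemma sym_tensors_altdef:
  "sym_tensors n p = {f. (\<forall>w. w \<notin> lists {1..n} \<or> length w \<noteq> p \<longrightarrow> coord f w = 0) \<and>
     (\<forall>w w'. mset w = mset w' \<longrightarrow> coord f w = coord f w')}"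
proof -
  have "(\<forall>w \<sigma>. \<sigma> permutes {..<length w} \<longrightarrow> coord f (permute_list \<sigma> w) = coord f w) \<longleftrightarrow>
      (\<forall>w w'. mset w = mset w' \<longrightarrow> coord f w = coord f w')" for f :: "(nat list, complex) ell2"
  proof (intro iffI allI impI)
    fix w w' :: "nat list"
    assume *: "\<forall>w \<sigma>. \<sigma> permutes {..<length w} \<longrightarrow> coord f (permute_list \<sigma> w) = coord f w"
      and "mset w = mset w'"
    then obtain \<sigma> where "\<sigma> permutes {..<length w'}" "permute_list \<sigma> w' = w"
      using mset_eq_permutation by blast
    then show "coord f w = coord f w'" using * by auto
  qed (use mset_permute_list in blast)
  then show ?thesis unfolding sym_tensors_def by blast
qed

text \<open>The symmetric Fock space with all degrees at once, cut out by closed linear conditions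
  on coordinates.\<close>

definition sym_words :: "nat \<Rightarrow> (nat list, complex) ell2 set" where
  "sym_words n = {f. (\<forall>w. w \<notin> lists {1..n} \<longrightarrow> coord f w = 0) \<and>
     (\<forall>w w'. mset w = mset w' \<longrightarrow> coord f w = coord f w')}"

lemma sym_wordsD:
  assumes "f \<in> sym_words n"
  shows "w \<notin> lists {1..n} \<Longrightarrow> coord f w = 0" "mset w = mset w' \<Longrightarrow> coord f w = coord f w'"
  using assms unfolding sym_words_def by blast+

lemma closed_csubspace_sym_words: "closed_csubspace (sym_words n)"
  unfolding sym_words_def
  by (intro closed_csubspace_Collect_conj closed_csubspace_Collect_all closed_csubspace_Collect_imp
      closed_csubspace_coord)

lemma closed_csubspace_sym_tensors: "closed_csubspace (sym_tensors n p)"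
  unfolding sym_tensors_altdef
  by (intro closed_csubspace_Collect_conj closed_csubspace_Collect_all closed_csubspace_Collect_imp
      closed_csubspace_coord)

lemma restrict_sym_words:
  "f \<in> sym_words n \<Longrightarrow> ell2_restrict {w. length w = p} f \<in> sym_tensors n p"
  unfolding sym_tensors_altdef
  by (auto simp: ell2_restrict.rep_eq dest: mset_eq_length intro: sym_wordsD)

text \<open>For a family in \<open>sym_words n\<close> the residual z of the projection is again in
  it. Its degree components are symmetric tensors, hence orthogonal to z; but the inner product of z
  with a component is the squared norm of that component.\<close>

lemma sym_fock_eq: "sym_fock n = sym_words n"
proof
  have st: "sym_tensors n p \<subseteq> sym_words n" for p
    unfolding sym_words_def sym_tensors_altdef by blast
  then show sub: "sym_fock n \<subseteq> sym_words n"
    unfolding sym_fock_def by (intro closed_span_minimal closed_csubspace_sym_words) blast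
  have cl: "closed_csubspace (sym_fock n)"
    unfolding sym_fock_def by (rule closed_csubspace_closed_span)
  show "sym_words n \<subseteq> sym_fock n"
  proof
    fix f assume f: "f \<in> sym_words n"
    define z where "z = f - orth_proj (sym_fock n) f"
    have z: "z \<in> sym_words n"
      unfolding z_def using f orth_proj_in[OF cl] sub
      by (intro closed_csubspaceD(4)[OF closed_csubspace_sym_words]) auto
    have "ell2_restrict {w. length w = p} z = 0" for p
    proof -
      have "ell2_restrict {w. length w = p} z \<in> sym_fock n"
        unfolding sym_fock_def
        by (rule closed_span_superset) (use restrict_sym_words[OF z] in blast)
      then have "cinner z (ell2_restrict {w. length w = p} z) = 0"
        unfolding z_def by (rule orth_proj_orth[OF cl])
      then have "cinner (ell2_restrict {w. length w = p} z) (ell2_restrict {w. length w = p} z) = 0"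
        by (simp only: cinner_restrict_left restrict_restrict Int_absorb)
      then show ?thesis by simp
    qed
    then have "coord (ell2_restrict {v. length v = length w} z) w = 0" for w by simp
    then have "z = 0" by (intro ell2_eqI) (simp add: ell2_restrict.rep_eq)
    then show "f \<in> sym_fock n" using orth_proj_in[OF cl, of f] by (simp add: z_def)
  qed
qed

lemma closed_csubspace_sym_fock: "closed_csubspace (sym_fock n)"
  by (simp add: sym_fock_eq closed_csubspace_sym_words)

lemma degree_proj_sym_fock:
  assumes "f \<in> sym_fock n"
  shows "degree_proj n p f = ell2_restrict {w. length w = p} f"
  unfolding degree_proj_def
proof (rule orth_proj_eqI[OF closed_csubspace_sym_tensors])
  show "ell2_restrict {w. length w = p} f \<in> sym_tensors n p"
    using assms by (simp add: sym_fock_eq restrict_sym_words)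
  fix z assume "z \<in> sym_tensors n p"
  then have "coord z w = 0" if "length w \<noteq> p" for w
    using that unfolding sym_tensors_altdef by blast
  then have "ell2_restrict {w. length w = p} z = z"
    by (intro ell2_eqI) (simp add: ell2_restrict.rep_eq)
  then show "cinner (f - ell2_restrict {w. length w = p} f) z = 0"
    by (simp add: cinner_diff_left cinner_restrict_left)
qed

lemma cinner_left_creation:
  "cinner (left_creation j f) g = cinner f (pull_back ((#) j) g)"
proof -
  have "cinner (left_creation j f) g
      = (\<Sum>\<^sub>\<infinity>w\<in>range ((#) j). cinner (coord (left_creation j f) w) (coord g w))"
    unfolding cinner_ell2_def
    by (rule infsum_cong_neutral) (auto simp: left_creation.rep_eq split: list.splits)
  also have "\<dots> = cinner f (pull_back ((#) j) g)"
    by (subst infsum_reindex) (auto simp: cinner_ell2_def pull_back.rep_eq left_creation.rep_eq o_def)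
  finally show ?thesis .
qed

section \<open>Tensor products of symmetric Fock spaces\<close>

definition words :: "nat \<Rightarrow> (nat \<Rightarrow> nat) \<Rightarrow> (nat \<Rightarrow> nat list) set" where
  "words k n = PiE {1..k} (\<lambda>i. lists {1..n i})"

lemma words_iff:
  "\<beta> \<in> words k n \<longleftrightarrow> \<beta> \<in> extensional {1..k} \<and> (\<forall>i\<in>{1..k}. set (\<beta> i) \<subseteq> {1..n i})"
  unfolding words_def PiE_iff lists_eq_set by blast

text \<open>Coordinate form of \<open>fock_tensor k n D\<close>, see \<open>fock_tensor_eq\<close>:
  coordinates depend only on the multisets of letters in the factors. Invariance under annihilation
  and the orthonormal basis are read off from it.\<close>

definition sym_family ::
    "nat \<Rightarrow> (nat \<Rightarrow> nat) \<Rightarrow> 'e::chilbert_space set \<Rightarrow> (nat \<Rightarrow> nat list, 'e) ell2 set" where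
  "sym_family k n D = {x. (\<forall>\<beta>. \<beta> \<notin> words k n \<longrightarrow> coord x \<beta> = 0) \<and>
     (\<forall>\<beta> \<gamma>. \<beta> \<in> words k n \<and> \<gamma> \<in> words k n \<and> (\<forall>i\<in>{1..k}. mset (\<beta> i) = mset (\<gamma> i)) \<longrightarrow>
        coord x \<beta> = coord x \<gamma>) \<and>
     (\<forall>\<beta>. coord x \<beta> \<in> D)}"

definition rearrangements :: "nat \<Rightarrow> (nat \<Rightarrow> nat multiset) \<Rightarrow> (nat \<Rightarrow> nat list) set" where
  "rearrangements k \<mu> = PiE {1..k} (\<lambda>i. permutations_of_multiset (\<mu> i))"

lemma finite_rearrangements: "finite (rearrangements k \<mu>)"
  unfolding rearrangements_def by (intro finite_PiE) auto

lemma rearrangements_iff: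
  "\<beta> \<in> rearrangements k \<mu> \<longleftrightarrow> \<beta> \<in> extensional {1..k} \<and> (\<forall>i\<in>{1..k}. mset (\<beta> i) = \<mu> i)"
  by (auto simp: rearrangements_def PiE_def permutations_of_multiset_def)

lemma card_rearrangements_pos: "card (rearrangements k \<mu>) > 0"
  unfolding rearrangements_def by (subst card_PiE) (auto intro!: prod_pos simp: card_gt_0_iff)

lemma sym_familyD:
  assumes "x \<in> sym_family k n D"
  shows "\<beta> \<notin> words k n \<Longrightarrow> coord x \<beta> = 0" "coord x \<beta> \<in> D"
    "\<beta> \<in> words k n \<Longrightarrow> \<gamma> \<in> words k n \<Longrightarrow> (\<And>i. i \<in> {1..k} \<Longrightarrow> mset (\<beta> i) = mset (\<gamma> i)) \<Longrightarrow>
      coord x \<beta> = coord x \<gamma>"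
  using assms unfolding sym_family_def by blast+

lemma sym_familyI:
  assumes "\<And>\<beta>. \<beta> \<notin> words k n \<Longrightarrow> coord x \<beta> = 0" "\<And>\<beta>. coord x \<beta> \<in> D"
    "\<And>\<beta> \<gamma>. \<beta> \<in> words k n \<Longrightarrow> \<gamma> \<in> words k n \<Longrightarrow> \<forall>i\<in>{1..k}. mset (\<beta> i) = mset (\<gamma> i) \<Longrightarrow>
      coord x \<beta> = coord x \<gamma>"
  shows "x \<in> sym_family k n D"
  using assms unfolding sym_family_def by blast

lemma closed_csubspace_sym_family:
  assumes D: "closed_csubspace D"
  shows "closed_csubspace (sym_family k n D)"
  unfolding sym_family_def
  by (intro closed_csubspace_Collect_conj closed_csubspace_Collect_all closed_csubspace_Collect_imp
      closed_csubspace_coord closed_csubspace_coord_mem D)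

lemma elem_tensor_in_sym_family:
  assumes f: "\<And>i. i \<in> {1..k} \<Longrightarrow> f i \<in> sym_fock (n i)" and v: "v \<in> D" and D: "closed_csubspace D"
  shows "elem_tensor k f v \<in> sym_family k n D"
proof (rule sym_familyI)
  fix \<beta> assume \<beta>: "\<beta> \<notin> words k n"
  show "coord (elem_tensor k f v) \<beta> = 0"
  proof (cases "\<beta> \<in> extensional {1..k}")
    case True
    then obtain i where i: "i \<in> {1..k}" "\<beta> i \<notin> lists {1..n i}"
      using \<beta> unfolding words_def PiE_iff by blast
    then have "coord (f i) (\<beta> i) = 0" using f[OF i(1)] sym_wordsD(1) unfolding sym_fock_eq by blast
    then have "(\<Prod>i = 1..k. coord (f i) (\<beta> i)) = 0" using i(1) by (intro prod_zero) auto
    then show ?thesis by (simp add: elem_tensor.rep_eq cvec.scale_zero_left)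
  qed (simp add: elem_tensor.rep_eq)
next
  fix \<beta> \<gamma> assume *: "\<beta> \<in> words k n" "\<gamma> \<in> words k n" "\<forall>i\<in>{1..k}. mset (\<beta> i) = mset (\<gamma> i)"
  have "coord (f i) (\<beta> i) = coord (f i) (\<gamma> i)" if "i \<in> {1..k}" for i
    using f[OF that] * that sym_wordsD(2) unfolding sym_fock_eq by blast
  then have "(\<Prod>i = 1..k. coord (f i) (\<beta> i)) = (\<Prod>i = 1..k. coord (f i) (\<gamma> i))"
    by (intro prod.cong) auto
  then show "coord (elem_tensor k f v) \<beta> = coord (elem_tensor k f v) \<gamma>"
    using *(1,2) by (simp add: elem_tensor.rep_eq words_def PiE_iff)
next
  fix \<beta> show "coord (elem_tensor k f v) \<beta> \<in> D"
    using v closed_csubspaceD[OF D] by (simp add: elem_tensor.rep_eq)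
qed

definition multiset_vec :: "nat multiset \<Rightarrow> (nat list, complex) ell2" where
  "multiset_vec A = (\<Sum>w\<in>permutations_of_multiset A. ket w)"

lemma coord_multiset_vec: "coord (multiset_vec A) w = (if mset w = A then 1 else 0)"
  unfolding multiset_vec_def coord_sum ket.rep_eq
  by (subst sum.delta') (auto simp: permutations_of_multiset_def[of A] finite_permutations_of_multiset[of A, unfolded permutations_of_multiset_def])

lemma multiset_vec_in_sym_fock:
  assumes "set_mset A \<subseteq> {1..n}"
  shows "multiset_vec A \<in> sym_fock n"
  unfolding sym_fock_eq sym_words_def
  using assms by (auto simp: coord_multiset_vec in_lists_conv_set)

lemma elem_tensor_multiset_vec:
  "elem_tensor k (\<lambda>i. multiset_vec (\<mu> i)) v = (\<Sum>\<beta>\<in>rearrangements k \<mu>. single \<beta> v)"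
proof (rule ell2_eqI)
  fix \<gamma>
  have prod: "(\<Prod>i = 1..k. coord (multiset_vec (\<mu> i)) (\<gamma> i))
      = (if \<forall>i\<in>{1..k}. mset (\<gamma> i) = \<mu> i then 1 else 0)"
    unfolding coord_multiset_vec by (auto intro!: prod.neutral prod_zero)
  have "coord (\<Sum>\<beta>\<in>rearrangements k \<mu>. single \<beta> v) \<gamma> = (if \<gamma> \<in> rearrangements k \<mu> then v else 0)"
    unfolding coord_sum single.rep_eq by (subst sum.delta') (simp_all add: finite_rearrangements)
  then show "coord (elem_tensor k (\<lambda>i. multiset_vec (\<mu> i)) v) \<gamma>
      = coord (\<Sum>\<beta>\<in>rearrangements k \<mu>. single \<beta> v) \<gamma>"
    unfolding elem_tensor.rep_eq prod rearrangements_iff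
    by (simp add: scaleC_one cvec.scale_zero_left)
qed

lemma sym_family_cinner_rearrangements:
  assumes x: "x \<in> sym_family k n D" and \<beta>: "\<beta> \<in> words k n" "\<beta> \<in> rearrangements k \<mu>"
  shows "cinner x (\<Sum>\<gamma>\<in>rearrangements k \<mu>. single \<gamma> v)
    = of_nat (card (rearrangements k \<mu>)) * cinner (coord x \<beta>) v"
proof -
  have "coord x \<gamma> = coord x \<beta>" if "\<gamma> \<in> rearrangements k \<mu>" for \<gamma>
  proof -
    have eq: "mset (\<gamma> i) = mset (\<beta> i)" if "i \<in> {1..k}" for i
      using \<open>\<gamma> \<in> rearrangements k \<mu>\<close> \<beta>(2) that by (simp add: rearrangements_iff)
    have "set (\<gamma> i) = set (\<beta> i)" if "i \<in> {1..k}" for i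
      using eq[OF that] by (rule mset_eq_setD)
    then have "\<gamma> \<in> words k n"
      using that \<beta>(1) unfolding words_iff rearrangements_iff by simp
    then show ?thesis using sym_familyD(3)[OF x _ \<beta>(1)] eq by blast
  qed
  then show ?thesis by (simp add: cinner_sum_right cinner_single_right)
qed

text \<open>A residual z is paired with the elementary tensor of multiset vectors carrying the
  coefficient \<open>coord z \<beta>\<close>. The result is 0 by orthogonality, and it is a positive
  multiple of the squared norm of that coefficient.\<close>

lemma fock_tensor_eq:
  assumes D: "closed_csubspace D"
  shows "fock_tensor k n D = sym_family k n D"
proof
  let ?E = "{elem_tensor k f v | f v. (\<forall>i\<in>{1..k}. f i \<in> sym_fock (n i)) \<and> v \<in> D}"
  show sub: "fock_tensor k n D \<subseteq> sym_family k n D"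
    unfolding fock_tensor_def
    by (intro closed_span_minimal closed_csubspace_sym_family D)
      (auto intro: elem_tensor_in_sym_family[OF _ _ D])
  have cl: "closed_csubspace (fock_tensor k n D)"
    unfolding fock_tensor_def by (rule closed_csubspace_closed_span)
  show "sym_family k n D \<subseteq> fock_tensor k n D"
  proof
    fix x assume x: "x \<in> sym_family k n D"
    define z where "z = x - orth_proj (fock_tensor k n D) x"
    have z: "z \<in> sym_family k n D"
      unfolding z_def using x orth_proj_in[OF cl] sub
      by (intro closed_csubspaceD(4)[OF closed_csubspace_sym_family[OF D]]) auto
    have "coord z \<beta> = 0" if \<beta>: "\<beta> \<in> words k n" for \<beta>
    proof -
      define \<mu> where "\<mu> = (\<lambda>i. mset (\<beta> i))"
      have "set_mset (\<mu> i) \<subseteq> {1..n i}" if "i \<in> {1..k}" for i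
        using \<beta> that unfolding \<mu>_def words_iff set_mset_mset by blast
      then have "elem_tensor k (\<lambda>i. multiset_vec (\<mu> i)) (coord z \<beta>)
          \<in> fock_tensor k n D"
        unfolding fock_tensor_def using z
        by (intro closed_span_superset) (blast intro: multiset_vec_in_sym_fock sym_familyD(2))
      then have "cinner z (\<Sum>\<gamma>\<in>rearrangements k \<mu>. single \<gamma> (coord z \<beta>)) = 0"
        unfolding elem_tensor_multiset_vec z_def by (rule orth_proj_orth[OF cl])
      moreover have "\<beta> \<in> rearrangements k \<mu>"
        using \<beta> unfolding rearrangements_iff \<mu>_def words_iff by simp
      ultimately show ?thesis
        using sym_family_cinner_rearrangements[OF z \<beta>, of \<mu>] card_rearrangements_pos[of k \<mu>]
        by simp
    qed
    then have "z = 0" using sym_familyD(1)[OF z] by (intro ell2_eqI) (metis zero_ell2.rep_eq)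
    then show "x \<in> fock_tensor k n D" using orth_proj_in[OF cl, of x] by (simp add: z_def)
  qed
qed

lemma closed_csubspace_fock_tensor: "closed_csubspace (fock_tensor k n D)"
  unfolding fock_tensor_def by (rule closed_csubspace_closed_span)

lemma elem_tensor_in_fock_tensor:
  "(\<And>i. i \<in> {1..k} \<Longrightarrow> f i \<in> sym_fock (n i)) \<Longrightarrow> v \<in> D \<Longrightarrow> elem_tensor k f v \<in> fock_tensor k n D"
  unfolding fock_tensor_def by (intro closed_span_superset) blast

text \<open>The sum over index tuples factors by distributivity for absolutely summable
  families.\<close>

lemma cinner_elem_tensor:
  "cinner (elem_tensor k f v) (elem_tensor k g w) = (\<Prod>i = 1..k. cinner (f i) (g i)) * cinner v w"
proof -
  have "cinner (elem_tensor k f v) (elem_tensor k g w) = (\<Sum>\<^sub>\<infinity>\<beta>\<in>PiE {1..k} (\<lambda>_. UNIV).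
      (\<Prod>i\<in>{1..k}. coord (f i) (\<beta> i) * cnj (coord (g i) (\<beta> i))) * cinner v w)"
    unfolding cinner_ell2_def
    by (rule infsum_cong_neutral)
      (auto simp: elem_tensor.rep_eq PiE_def cinner_scaleC_left cinner_scaleC_right prod.distrib)
  also have "\<dots> = (\<Sum>\<^sub>\<infinity>\<beta>\<in>PiE {1..k} (\<lambda>_. UNIV).
      \<Prod>i\<in>{1..k}. coord (f i) (\<beta> i) * cnj (coord (g i) (\<beta> i))) * cinner v w"
    by (rule infsum_cmult_left')
  also have "\<dots> = (\<Prod>i\<in>{1..k}. \<Sum>\<^sub>\<infinity>w. coord (f i) w * cnj (coord (g i) w)) * cinner v w"
  proof (subst infsum_prod_PiE_abs)
    fix i
    show "(\<lambda>w. norm (coord (f i) w * cnj (coord (g i) w))) summable_on UNIV"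
      using ell2_cinner_summable[of "f i" "g i"]
      by (simp add: cinner_complex_def summable_on_iff_abs_summable_on_complex[symmetric])
  qed auto
  finally show ?thesis by (simp add: cinner_ell2_def[of "f _"] cinner_complex_def)
qed

text \<open>Bounded operators that agree on elementary tensors and vanish on the complement of the
  Fock space coincide, so the definite description in \<open>tensor_op\<close> is resolved by any
  such X.\<close>

lemma tensor_op_eqI:
  assumes X: "X \<in> bop (fock_tensor k n D) (fock_tensor k n D)"
    and elem: "\<And>f v. v \<in> D \<Longrightarrow> (\<And>i. i \<in> {1..k} \<Longrightarrow> f i \<in> sym_fock (n i)) \<Longrightarrow>
      X (elem_tensor k f v) = elem_tensor k (\<lambda>i. A i (f i)) v"
  shows "tensor_op k n A D = X"
  unfolding tensor_op_def
proof (rule the_equality)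
  define E where "E = {elem_tensor k f v | f v. (\<forall>i\<in>{1..k}. f i \<in> sym_fock (n i)) \<and> v \<in> D}"
  define F where "F = fock_tensor k n D"
  have FE: "F = closed_span E" by (simp add: F_def E_def fock_tensor_def)
  have cl: "closed_csubspace F" unfolding F_def by (rule closed_csubspace_fock_tensor)
  have XF: "X \<in> bop F F" using X by (simp add: F_def)
  fix X' assume "X' \<in> bop (fock_tensor k n D) (fock_tensor k n D) \<and>
      (\<forall>f. \<forall>v\<in>D. (\<forall>i\<in>{1..k}. f i \<in> sym_fock (n i)) \<longrightarrow>
      X' (elem_tensor k f v) = elem_tensor k (\<lambda>i. A i (f i)) v)"
  then have X': "X' \<in> bop F F" and elem': "\<And>f v. v \<in> D \<Longrightarrow> (\<And>i. i \<in> {1..k} \<Longrightarrow> f i \<in> sym_fock (n i)) \<Longrightarrow>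
      X' (elem_tensor k f v) = elem_tensor k (\<lambda>i. A i (f i)) v"
    by (auto simp: F_def)
  show "X' = X"
  proof
    fix x
    have "X' (orth_proj F x) = X (orth_proj F x)"
    proof (rule bounded_clinear_eq_on_closed_span[OF bopD(1)[OF X'] bopD(1)[OF XF]])
      show "orth_proj F x \<in> closed_span E" using orth_proj_in[OF cl] by (simp only: FE[symmetric])
      fix y assume "y \<in> E"
      then obtain f v where "y = elem_tensor k f v" "v \<in> D" "\<And>i. i \<in> {1..k} \<Longrightarrow> f i \<in> sym_fock (n i)"
        unfolding E_def by blast
      then show "X' y = X y" using elem elem' by simp
    qed
    then show "X' x = X x" by (simp only: bop_orth_proj[OF X' cl] bop_orth_proj[OF XF cl])
  qed
qed (use X elem in auto)

definition degree_words :: "nat \<Rightarrow> (nat \<Rightarrow> nat) \<Rightarrow> (nat \<Rightarrow> nat) \<Rightarrow> (nat \<Rightarrow> nat list) set" where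
  "degree_words k n q = {\<beta> \<in> words k n. \<forall>i\<in>{1..k}. length (\<beta> i) = q i}"

lemma restrict_degree_words:
  assumes x: "x \<in> sym_family k n D" and D: "closed_csubspace D"
  shows "ell2_restrict (degree_words k n q) x \<in> sym_family k n D"
proof (rule sym_familyI)
  fix \<beta> \<gamma> assume *: "\<beta> \<in> words k n" "\<gamma> \<in> words k n" "\<forall>i\<in>{1..k}. mset (\<beta> i) = mset (\<gamma> i)"
  then have "length (\<beta> i) = length (\<gamma> i)" if "i \<in> {1..k}" for i using that mset_eq_length by blast
  then have "\<beta> \<in> degree_words k n q \<longleftrightarrow> \<gamma> \<in> degree_words k n q" using * by (simp add: degree_words_def)
  moreover have "coord x \<beta> = coord x \<gamma>" using sym_familyD(3)[OF x *(1,2)] *(3) by blast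
  ultimately show "coord (ell2_restrict (degree_words k n q) x) \<beta>
      = coord (ell2_restrict (degree_words k n q) x) \<gamma>"
    by (simp add: ell2_restrict.rep_eq)
qed (use sym_familyD(1,2)[OF x] closed_csubspaceD(1)[OF D] in \<open>simp_all add: ell2_restrict.rep_eq\<close>)

lemma Q_op_eq:
  assumes D: "closed_csubspace D"
  shows "Q_op k n q D = (\<lambda>x. ell2_restrict (degree_words k n q) (orth_proj (fock_tensor k n D) x))"
  unfolding Q_op_def
proof (rule tensor_op_eqI)
  let ?F = "fock_tensor k n D"
  show "(\<lambda>x. ell2_restrict (degree_words k n q) (orth_proj ?F x)) \<in> bop ?F ?F"
    unfolding bop_def
  proof (intro CollectI conjI ballI)
    show "bounded_clinear (\<lambda>x. ell2_restrict (degree_words k n q) (orth_proj ?F x))"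
      by (intro bounded_clinear_compose[OF bounded_clinear_restrict] bounded_clinear_orth_proj
          closed_csubspace_fock_tensor)
    show "range (\<lambda>x. ell2_restrict (degree_words k n q) (orth_proj ?F x)) \<subseteq> ?F"
      using restrict_degree_words[OF _ D] orth_proj_in[OF closed_csubspace_fock_tensor, of k n D]
      unfolding fock_tensor_eq[OF D] by blast
    fix x assume "x \<in> orth_compl_in UNIV ?F"
    then have "orth_proj ?F x = 0"
      by (intro orth_proj_eq_zero closed_csubspace_fock_tensor) (simp add: orth_compl_in_def)
    then show "ell2_restrict (degree_words k n q) (orth_proj ?F x) = 0"
      by (simp add: bounded_clinearD(4)[OF bounded_clinear_restrict])
  qed
next
  fix f and v :: 'a assume v: "v \<in> D" and f: "\<And>i. i \<in> {1..k} \<Longrightarrow> f i \<in> sym_fock (n i)"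
  have "coord (ell2_restrict (degree_words k n q) (elem_tensor k f v)) \<beta>
      = coord (elem_tensor k (\<lambda>i. degree_proj (n i) (q i) (f i)) v) \<beta>" for \<beta>
  proof (cases "\<beta> \<in> extensional {1..k}")
    case True
    have "(\<Prod>i = 1..k. coord (degree_proj (n i) (q i) (f i)) (\<beta> i))
        = (\<Prod>i = 1..k. if length (\<beta> i) = q i then coord (f i) (\<beta> i) else 0)"
      by (intro prod.cong) (auto simp: degree_proj_sym_fock f ell2_restrict.rep_eq)
    also have "\<dots> = (if \<beta> \<in> degree_words k n q then \<Prod>i = 1..k. coord (f i) (\<beta> i) else 0)"
    proof (cases "\<beta> \<in> degree_words k n q")
      case False
      then obtain i where "i \<in> {1..k}" "\<beta> i \<notin> lists {1..n i} \<or> length (\<beta> i) \<noteq> q i"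
        using True unfolding degree_words_def words_def PiE_iff by blast
      then have "i \<in> {1..k}" "length (\<beta> i) \<noteq> q i \<or> coord (f i) (\<beta> i) = 0"
        using f[of i] sym_wordsD(1)[of "f i" "n i" "\<beta> i"] unfolding sym_fock_eq by blast+
      then have "\<exists>i\<in>{1..k}. (if length (\<beta> i) = q i then coord (f i) (\<beta> i) else 0) = 0"
        by auto
      then show ?thesis using False by (simp add: prod_zero)
    qed (simp add: degree_words_def)
    finally show ?thesis using True by (simp add: elem_tensor.rep_eq ell2_restrict.rep_eq cvec.scale_zero_left)
  qed (simp add: elem_tensor.rep_eq ell2_restrict.rep_eq)
  then show "ell2_restrict (degree_words k n q) (orth_proj (fock_tensor k n D) (elem_tensor k f v))
      = elem_tensor k (\<lambda>i. degree_proj (n i) (q i) (f i)) v"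
    using elem_tensor_in_fock_tensor[OF f v]
    by (simp add: orth_proj_ident[OF closed_csubspace_fock_tensor] ell2_eqI)
qed

text \<open>The adjoint of the \<open>j\<close>-th creation operator in the \<open>i\<close>-th factor, on the full Fock space.\<close>

definition annihilation ::
    "nat \<Rightarrow> nat \<Rightarrow> (nat \<Rightarrow> nat list, 'e::chilbert_space) ell2 \<Rightarrow> (nat \<Rightarrow> nat list, 'e) ell2" where
  "annihilation i j = pull_back (\<lambda>\<beta>. \<beta>(i := j # \<beta> i))"

lemma inj_prepend: "inj (\<lambda>\<beta>. \<beta>(i := j # \<beta> i))"
proof (rule injI)
  fix \<beta> \<gamma> :: "'a \<Rightarrow> 'b list" assume eq: "\<beta>(i := j # \<beta> i) = \<gamma>(i := j # \<gamma> i)"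
  show "\<beta> = \<gamma>"
  proof
    fix l show "\<beta> l = \<gamma> l" using fun_cong[OF eq, of l] by (cases "l = i") auto
  qed
qed

lemma coord_annihilation: "coord (annihilation i j x) \<beta> = coord x (\<beta>(i := j # \<beta> i))"
  by (simp add: annihilation_def pull_back.rep_eq inj_prepend)

lemma bounded_clinear_annihilation: "bounded_clinear (annihilation i j)"
  unfolding annihilation_def by (rule bounded_clinear_pull_back)

lemma prepend_in_words:
  assumes "i \<in> {1..k}" "j \<in> {1..n i}"
  shows "\<beta>(i := j # \<beta> i) \<in> words k n \<longleftrightarrow> \<beta> \<in> words k n"
proof -
  have "(\<beta>(i := j # \<beta> i)) l \<in> lists {1..n l} \<longleftrightarrow> \<beta> l \<in> lists {1..n l}" for l
    using assms by (cases "l = i") auto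
  moreover have "\<beta>(i := j # \<beta> i) \<in> extensional {1..k} \<longleftrightarrow> \<beta> \<in> extensional {1..k}"
    using assms by (auto simp: extensional_def)
  ultimately show ?thesis unfolding words_def PiE_iff by blast
qed

lemma annihilation_in_sym_family:
  assumes x: "x \<in> sym_family k n D" and ij: "i \<in> {1..k}" "j \<in> {1..n i}"
  shows "annihilation i j x \<in> sym_family k n D"
proof (rule sym_familyI)
  fix \<beta> \<gamma> assume *: "\<beta> \<in> words k n" "\<gamma> \<in> words k n" "\<forall>i\<in>{1..k}. mset (\<beta> i) = mset (\<gamma> i)"
  then have "mset ((\<beta>(i := j # \<beta> i)) l) = mset ((\<gamma>(i := j # \<gamma> i)) l)" if "l \<in> {1..k}" for l
    using that by auto
  then show "coord (annihilation i j x) \<beta> = coord (annihilation i j x) \<gamma>"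
    using sym_familyD(3)[OF x] * prepend_in_words[of i k j n, OF ij] unfolding coord_annihilation by blast
qed (use sym_familyD[OF x] prepend_in_words[of i k j n, OF ij] in \<open>auto simp: coord_annihilation\<close>)

lemma annihilation_in_fock_tensor:
  assumes "x \<in> fock_tensor k n D" "i \<in> {1..k}" "j \<in> {1..n i}" "closed_csubspace D"
  shows "annihilation i j x \<in> fock_tensor k n D"
  using annihilation_in_sym_family assms by (simp add: fock_tensor_eq)

lemma annihilation_elem_tensor:
  assumes "i \<in> {1..k}"
  shows "annihilation i j (elem_tensor k g w) = elem_tensor k (g(i := pull_back ((#) j) (g i))) w"
proof (rule ell2_eqI)
  fix \<beta>
  have "(\<beta>(i := j # \<beta> i)) \<in> extensional {1..k} \<longleftrightarrow> \<beta> \<in> extensional {1..k}"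
    using assms by (auto simp: extensional_def)
  moreover have "(\<Prod>l = 1..k. coord (g l) ((\<beta>(i := j # \<beta> i)) l))
      = (\<Prod>l = 1..k. coord ((g(i := pull_back ((#) j) (g i))) l) (\<beta> l))"
    by (intro prod.cong) (auto simp: pull_back.rep_eq)
  ultimately show "coord (annihilation i j (elem_tensor k g w)) \<beta>
      = coord (elem_tensor k (g(i := pull_back ((#) j) (g i))) w) \<beta>"
    by (simp add: coord_annihilation elem_tensor.rep_eq)
qed

text \<open>Annihilation maps the symmetric space to itself, so its adjoint already contains the
  symmetrization that creation requires. On elementary tensors the identity is checked by pairing
  with elementary tensors, factor by factor.\<close>

lemma shift_op_eq:
  assumes D: "closed_csubspace D" and ij: "i \<in> {1..k}" "j \<in> {1..n i}"
  shows "shift_op k n i j D = cadjoint (\<lambda>x. annihilation i j (orth_proj (fock_tensor k n D) x))"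
  unfolding shift_op_def
proof (rule tensor_op_eqI)
  let ?F = "fock_tensor k n D"
  note cl = closed_csubspace_fock_tensor[of k n D]
  define X where "X = cadjoint (\<lambda>x. annihilation i j (orth_proj ?F x))"
  have bd: "bounded_clinear (\<lambda>x. annihilation i j (orth_proj ?F x))"
    by (rule bounded_clinear_compose[OF bounded_clinear_annihilation bounded_clinear_orth_proj[OF cl]])
  have X: "cinner (X y) z = cinner y (annihilation i j (orth_proj ?F z))" for y z
    unfolding X_def by (rule cadjoint_left[OF bd])
  have XF: "X y \<in> ?F" for y
  proof -
    have "orth_proj ?F (X y) = X y"
      by (rule cinner_eqI)
        (simp add: orth_proj_selfadjoint[OF cl] X orth_proj_ident[OF cl orth_proj_in[OF cl]])
    then show ?thesis using orth_proj_in[OF cl, of "X y"] by simp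
  qed
  have LF: "annihilation i j (orth_proj ?F z) \<in> ?F" for z
    by (intro annihilation_in_fock_tensor orth_proj_in cl ij D)
  have "X \<in> bop ?F ?F"
    unfolding bop_def
  proof (intro CollectI conjI ballI)
    show "bounded_clinear X" unfolding X_def by (rule bounded_clinear_cadjoint[OF bd])
    show "range X \<subseteq> ?F" using XF by auto
    fix y assume "y \<in> orth_compl_in UNIV ?F"
    then show "X y = 0" using LF by - (rule cinner_eqI, simp add: X orth_compl_in_def)
  qed
  then show "cadjoint (\<lambda>x. annihilation i j (orth_proj ?F x)) \<in> bop ?F ?F" by (simp add: X_def)
  fix f and v :: 'a assume v: "v \<in> D" and f: "\<And>i. i \<in> {1..k} \<Longrightarrow> f i \<in> sym_fock (n i)"
  let ?A = "\<lambda>l. if l = i then sym_creation (n i) j else orth_proj (sym_fock (n l))"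
  note sf = closed_csubspace_sym_fock
  have AF: "elem_tensor k (\<lambda>l. ?A l (f l)) v \<in> ?F"
    using v by (intro elem_tensor_in_fock_tensor) (auto simp: sym_creation_def orth_proj_in[OF sf])
  \<comment> \<open>This difference lies in the Fock space and is orthogonal to every elementary
    tensor, hence to itself.\<close>
  define d where "d = X (elem_tensor k f v) - elem_tensor k (\<lambda>l. ?A l (f l)) v"
  have dF: "d \<in> ?F" unfolding d_def by (rule closed_csubspaceD(4)[OF cl XF AF])
  have "cinner d z = 0"
    if zE: "z \<in> {elem_tensor k f v | f v. (\<forall>i\<in>{1..k}. f i \<in> sym_fock (n i)) \<and> v \<in> D}" for z
  proof -
    obtain g w where z: "z = elem_tensor k g w" and g: "\<And>i. i \<in> {1..k} \<Longrightarrow> g i \<in> sym_fock (n i)"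
      and w: "w \<in> D" using zE by blast
    have "cinner (f l) ((g(i := pull_back ((#) j) (g i))) l) = cinner (?A l (f l)) (g l)"
      if l: "l \<in> {1..k}" for l
      using f[OF l] g[OF l] ij
      by (auto simp: sym_creation_def cinner_orth_proj_left[OF sf] cinner_left_creation orth_proj_ident[OF sf])
    then have "(\<Prod>l = 1..k. cinner (f l) ((g(i := pull_back ((#) j) (g i))) l))
        = (\<Prod>l = 1..k. cinner (?A l (f l)) (g l))" by (intro prod.cong) auto
    then show ?thesis
      using elem_tensor_in_fock_tensor[OF g w] annihilation_elem_tensor[OF ij(1), of j g w]
      by (simp add: d_def cinner_diff_left X orth_proj_ident[OF cl] z cinner_elem_tensor del: fun_upd_apply)
  qed
  then have "cinner d d = 0"
    by (rule orth_closed_span) (use dF in \<open>simp_all add: fock_tensor_def\<close>)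
  then show "cadjoint (\<lambda>x. annihilation i j (orth_proj ?F x)) (elem_tensor k f v)
      = elem_tensor k (\<lambda>l. ?A l (f l)) v"
    by (simp add: d_def X_def)
qed

section \<open>Monotone bounded nets over multi-indices\<close>

lemma multi_indices_iff: "q \<in> multi_indices k \<longleftrightarrow> q \<in> extensional {1..k}"
  by (simp add: multi_indices_def PiE_def)

lemma multi_indices_upd:
  "q \<in> multi_indices k \<Longrightarrow> i \<in> {1..k} \<Longrightarrow> q(i := r) \<in> multi_indices k"
  by (auto simp: multi_indices_iff extensional_def)

lemma multi_indices_Suc_upd: "q \<in> multi_indices k \<Longrightarrow> q(Suc k := r) \<in> multi_indices (Suc k)"
  by (auto simp: multi_indices_iff extensional_def)

lemma multi_indices_Suc_cases:
  assumes "q \<in> multi_indices (Suc k)"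
  obtains s r where "s \<in> multi_indices k" "q = s(Suc k := r)"
proof
  show "q(Suc k := undefined) \<in> multi_indices k"
    using assms by (auto simp: multi_indices_iff extensional_def)
  show "q = (q(Suc k := undefined))(Suc k := q (Suc k))" by simp
qed

locale bounded_increasing_net =
  fixes k :: nat and a :: "(nat \<Rightarrow> nat) \<Rightarrow> real" and C :: real
  assumes step: "\<And>q i. q \<in> multi_indices k \<Longrightarrow> i \<in> {1..k} \<Longrightarrow> a q \<le> a (q(i := Suc (q i)))"
    and nonneg: "\<And>q. q \<in> multi_indices k \<Longrightarrow> 0 \<le> a q"
    and upper: "\<And>q. q \<in> multi_indices k \<Longrightarrow> a q \<le> C"
begin

definition L where "L = (SUP q\<in>multi_indices k. a q)"

lemma multi_indices_nonempty: "multi_indices k \<noteq> {}"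
  by (auto simp: multi_indices_def PiE_eq_empty_iff)

lemma bdd: "bdd_above (a ` multi_indices k)"
  using upper by (intro bdd_aboveI[of _ C]) auto

lemma le_L: "q \<in> multi_indices k \<Longrightarrow> a q \<le> L"
  unfolding L_def by (rule cSUP_upper[OF _ bdd])

text \<open>Induction on the total gap between q and q': one coordinate in which they differ is
  raised by 1.\<close>

lemma mono:
  assumes "q \<in> multi_indices k" "q' \<in> multi_indices k" "\<And>i. i \<in> {1..k} \<Longrightarrow> q i \<le> q' i"
  shows "a q \<le> a q'"
  using assms
proof (induction "\<Sum>i=1..k. q' i - q i" arbitrary: q rule: less_induct)
  case less
  show ?case
  proof (cases "q = q'")
    case False
    then obtain i where "q i \<noteq> q' i" by blast
    then have i: "i \<in> {1..k}"
      using less.prems(1,2) unfolding multi_indices_iff extensional_def by fastforce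
    with less.prems(3) \<open>q i \<noteq> q' i\<close> have "q i < q' i" using le_neq_implies_less by blast
    note i = i this
    have "(\<Sum>l=1..k. q' l - (q(i := Suc (q i))) l) < (\<Sum>l=1..k. q' l - q l)"
      using i by (intro sum_strict_mono_ex1) (auto intro!: bexI[of _ i])
    then have "a (q(i := Suc (q i))) \<le> a q'"
    proof (rule less.hyps)
      fix l assume "l \<in> {1..k}"
      then show "(q(i := Suc (q i))) l \<le> q' l" using less.prems(3)[of l] i by auto
    qed (use less.prems i multi_indices_upd in blast)+
    with step[OF less.prems(1) i(1)] show ?thesis by simp
  qed simp
qed

lemma close_to_L:
  assumes "0 < e"
  obtains N where "N \<in> multi_indices k" "L - e < a N"
    "\<And>q. q \<in> multi_indices k \<Longrightarrow> \<forall>i\<in>{1..k}. N i \<le> q i \<Longrightarrow> a N \<le> a q"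
proof -
  have "L - e < L" using assms by simp
  then obtain N where "N \<in> multi_indices k" "L - e < a N"
    unfolding L_def less_cSUP_iff[OF multi_indices_nonempty bdd] by blast
  then show ?thesis using that mono by blast
qed

lemma tendsto_multi_at_top: "(a \<longlongrightarrow> L) (multi_at_top k)"
proof (rule tendstoI)
  fix e :: real assume "0 < e"
  then obtain N where N: "N \<in> multi_indices k" "L - e < a N"
    "\<And>q. q \<in> multi_indices k \<Longrightarrow> \<forall>i\<in>{1..k}. N i \<le> q i \<Longrightarrow> a N \<le> a q"
    using close_to_L[of e] by blast
  have "dist (a q) L < e" if "q \<in> multi_indices k" "\<forall>i\<in>{1..k}. N i \<le> q i" for q
    using N(2) N(3)[OF that] le_L[OF that(1)] \<open>0 < e\<close> by (simp add: dist_real_def)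
  then have "\<forall>\<^sub>F q in principal {q \<in> multi_indices k. \<forall>i\<in>{1..k}. N i \<le> q i}. dist (a q) L < e"
    by (simp add: eventually_principal)
  then show "\<forall>\<^sub>F q in multi_at_top k. dist (a q) L < e"
    unfolding multi_at_top_def by (rule filter_leD[OF INF_lower[OF N(1)]])
qed

text \<open>In the limit almost all of \<open>A m\<close> lies above a given N, where monotonicity
  keeps a above a N and so near L. The remaining terms are at least 0, and no term exceeds L. Shells
  and simplices are the two instances.\<close>

lemma average_tendsto:
  assumes A: "\<And>m. finite (A m)" "\<And>m. A m \<subseteq> multi_indices k"
    and ratio: "\<And>N. N \<in> multi_indices k \<Longrightarrow>
      (\<lambda>m. real (card {q \<in> A m. \<forall>i\<in>{1..k}. N i \<le> q i}) / real (card (A m))) \<longlonglongrightarrow> 1"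
  shows "(\<lambda>m. (\<Sum>q\<in>A m. a q) / real (card (A m))) \<longlonglongrightarrow> L"
proof (rule LIMSEQ_I)
  fix e :: real assume "0 < e"
  then obtain N where N: "N \<in> multi_indices k" "L - e < a N"
    "\<And>q. q \<in> multi_indices k \<Longrightarrow> \<forall>i\<in>{1..k}. N i \<le> q i \<Longrightarrow> a N \<le> a q"
    using close_to_L[of e] by blast
  define r where "r m = real (card {q \<in> A m. \<forall>i\<in>{1..k}. N i \<le> q i}) / real (card (A m))" for m
  have r: "r \<longlonglongrightarrow> 1" unfolding r_def by (rule ratio[OF N(1)])
  have "(\<lambda>m. a N * r m) \<longlonglongrightarrow> a N * 1" by (intro tendsto_intros r)
  then have "\<forall>\<^sub>F m in sequentially. L - e < a N * r m" using N(2) by (intro order_tendstoD(1)) auto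
  moreover have "\<forall>\<^sub>F m in sequentially. 0 < r m" using r by (rule order_tendstoD) simp
  ultimately have "\<forall>\<^sub>F m in sequentially. norm ((\<Sum>q\<in>A m. a q) / real (card (A m)) - L) < e"
  proof eventually_elim
    fix m assume m: "L - e < a N * r m" "0 < r m"
    \<comment> \<open>Division by 0 yields 0, so a positive proportion excludes an empty
      \<open>A m\<close>.\<close>
    then have card: "0 < real (card (A m))" by (cases "card (A m) = 0") (auto simp: r_def)
    have "(\<Sum>q\<in>A m. a q) \<le> (\<Sum>q\<in>A m. L)" using A le_L by (intro sum_mono) auto
    then have "(\<Sum>q\<in>A m. a q) / real (card (A m)) \<le> L" using card by (simp add: field_simps)
    moreover have "a N * r m \<le> (\<Sum>q\<in>A m. a q) / real (card (A m))"
    proof -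
      have "a N * real (card {q \<in> A m. \<forall>i\<in>{1..k}. N i \<le> q i})
          = (\<Sum>q | q \<in> A m \<and> (\<forall>i\<in>{1..k}. N i \<le> q i). a N)" by (simp add: mult.commute)
      also have "\<dots> \<le> (\<Sum>q | q \<in> A m \<and> (\<forall>i\<in>{1..k}. N i \<le> q i). a q)"
        using A(2) N(3) by (intro sum_mono) auto
      also have "\<dots> \<le> (\<Sum>q\<in>A m. a q)" using A nonneg by (intro sum_mono2) auto
      finally show ?thesis using card by (simp add: r_def divide_right_mono)
    qed
    ultimately show "norm ((\<Sum>q\<in>A m. a q) / real (card (A m)) - L) < e" using m(1) \<open>0 < e\<close> by simp
  qed
  then show "\<exists>no. \<forall>n\<ge>no. norm ((\<Sum>q\<in>A n. a q) / real (card (A n)) - L) < e"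
    by (simp add: eventually_sequentially)
qed

end

section \<open>Counting multi-indices in shells and simplices\<close>

definition shell :: "nat \<Rightarrow> nat \<Rightarrow> (nat \<Rightarrow> nat) set" where
  "shell k m = {q \<in> multi_indices k. (\<Sum>i=1..k. q i) = m}"

lemma bij_betw_shell_lists:
  "bij_betw (\<lambda>q. map q [1..<Suc k]) (shell k m) {l. length l = k \<and> sum_list l = m}"
proof (rule bij_betw_byWitness[where f' = "\<lambda>l. \<lambda>i\<in>{1..k}. l ! (i - 1)"])
  have sum: "sum_list (map q [1..<Suc k]) = (\<Sum>i=1..k. q i)" for q :: "nat \<Rightarrow> nat"
    by (simp add: interv_sum_list_conv_sum_set_nat atLeastLessThanSuc_atLeastAtMost del: upt_Suc)
  show "\<forall>q\<in>shell k m. (\<lambda>i\<in>{1..k}. map q [1..<Suc k] ! (i - 1)) = q"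
    by (auto simp: shell_def multi_indices_iff extensional_def fun_eq_iff simp del: upt_Suc)
  have inv: "map (\<lambda>i\<in>{1..k}. l ! (i - 1)) [1..<Suc k] = l" if "length l = k" for l :: "nat list"
    using that by (intro nth_equalityI) (auto simp del: upt_Suc)
  then show "\<forall>l\<in>{l. length l = k \<and> sum_list l = m}. map (\<lambda>i\<in>{1..k}. l ! (i - 1)) [1..<Suc k] = l"
    by blast
  show "(\<lambda>q. map q [1..<Suc k]) ` shell k m \<subseteq> {l. length l = k \<and> sum_list l = m}"
    unfolding shell_def using sum by (auto simp del: upt_Suc)
  show "(\<lambda>l. \<lambda>i\<in>{1..k}. l ! (i - 1)) ` {l. length l = k \<and> sum_list l = m} \<subseteq> shell k m"
  proof
    fix q assume "q \<in> (\<lambda>l. \<lambda>i\<in>{1..k}. l ! (i - 1)) ` {l. length l = k \<and> sum_list l = m}"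
    then obtain l where l: "length l = k" "sum_list l = m" and q: "q = (\<lambda>i\<in>{1..k}. l ! (i - 1))" by blast
    have "(\<Sum>i=1..k. q i) = m" unfolding sum[symmetric] q inv[OF l(1)] by (rule l(2))
    then show "q \<in> shell k m" by (simp add: shell_def multi_indices_iff q)
  qed
qed

lemma finite_lists_sum: "finite {l::nat list. length l = k \<and> sum_list l = m}"
proof (rule finite_subset)
  show "{l::nat list. length l = k \<and> sum_list l = m} \<subseteq> {l. set l \<subseteq> {..m} \<and> length l = k}"
    using member_le_sum_list by fastforce
qed (rule finite_lists_length_eq, simp)

lemma finite_shell: "finite (shell k m)"
  using bij_betw_finite[OF bij_betw_shell_lists] finite_lists_sum by blast

lemma card_shell:
  assumes "k \<ge> 1"
  shows "card (shell k m) = (m + (k - 1)) choose (k - 1)"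
proof -
  have "card (shell k m) = (m + k - 1) choose m"
    using bij_betw_same_card[OF bij_betw_shell_lists, of k m] card_length_sum_list by simp
  then show ?thesis using assms binomial_symmetric[of m "m + k - 1"] by simp
qed

lemma sum_diff_pointwise:
  fixes q N :: "nat \<Rightarrow> nat"
  shows "\<forall>i\<in>A. N i \<le> q i \<Longrightarrow> (\<Sum>i\<in>A. q i - N i) = sum q A - sum N A"
  by (rule sum_subtractf_nat) auto

text \<open>Subtracting N is a bijection that lowers the total by the total of N. The predicates P
  and P' on the total let shells and simplices share the argument.\<close>

lemma card_translate:
  assumes N: "N \<in> multi_indices k"
    and P: "\<And>q. \<forall>i\<in>{1..k}. N i \<le> q i \<Longrightarrow>
      P (\<Sum>i=1..k. q i) \<longleftrightarrow> P' ((\<Sum>i=1..k. q i) - (\<Sum>i=1..k. N i))"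
  shows "card {q \<in> multi_indices k. P (\<Sum>i=1..k. q i) \<and> (\<forall>i\<in>{1..k}. N i \<le> q i)}
    = card {q \<in> multi_indices k. P' (\<Sum>i=1..k. q i)}"
proof (rule bij_betw_same_card[symmetric],
    rule bij_betw_byWitness[where f = "\<lambda>q. \<lambda>i\<in>{1..k}. q i + N i" and f' = "\<lambda>q. \<lambda>i\<in>{1..k}. q i - N i"])
  let ?C = "{q \<in> multi_indices k. P (\<Sum>i=1..k. q i) \<and> (\<forall>i\<in>{1..k}. N i \<le> q i)}"
  let ?C' = "{q \<in> multi_indices k. P' (\<Sum>i=1..k. q i)}"
  show "\<forall>q\<in>?C'. (\<lambda>i\<in>{1..k}. (\<lambda>i\<in>{1..k}. q i + N i) i - N i) = q"
    by (auto simp: multi_indices_iff extensional_def fun_eq_iff)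
  show "\<forall>q\<in>?C. (\<lambda>i\<in>{1..k}. (\<lambda>i\<in>{1..k}. q i - N i) i + N i) = q"
    by (auto simp: multi_indices_iff extensional_def fun_eq_iff)
  show "(\<lambda>q. \<lambda>i\<in>{1..k}. q i + N i) ` ?C' \<subseteq> ?C"
  proof (rule image_subsetI)
    fix q assume "q \<in> ?C'"
    then show "(\<lambda>i\<in>{1..k}. q i + N i) \<in> ?C"
      using P[of "\<lambda>i\<in>{1..k}. q i + N i"] by (simp add: multi_indices_iff sum.distrib)
  qed
  show "(\<lambda>q. \<lambda>i\<in>{1..k}. q i - N i) ` ?C \<subseteq> ?C'"
  proof (rule image_subsetI)
    fix q assume "q \<in> ?C"
    then show "(\<lambda>i\<in>{1..k}. q i - N i) \<in> ?C'"
      using P[of q] by (simp add: multi_indices_iff sum_diff_pointwise)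
  qed
qed

lemma ratio_shift_tendsto: "(\<lambda>m. (real m + c) / (real m + d)) \<longlonglongrightarrow> 1"
proof -
  have top: "filterlim (\<lambda>m. real m + d) at_top sequentially"
    using filterlim_tendsto_add_at_top[OF tendsto_const filterlim_real_sequentially, of d]
    by (simp add: add.commute)
  have "(\<lambda>m. 1 + (c - d) / (real m + d)) \<longlonglongrightarrow> 1 + 0"
    by (intro tendsto_add tendsto_const tendsto_divide_0[OF tendsto_const]
        filterlim_at_top_imp_at_infinity top)
  moreover have "\<forall>\<^sub>F m in sequentially. 1 + (c - d) / (real m + d) = (real m + c) / (real m + d)"
    using filterlim_at_top_dense[THEN iffD1, OF top, rule_format, of 0]
    by eventually_elim (simp add: field_simps)
  ultimately show ?thesis by (simp add: tendsto_cong)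
qed

text \<open>For fixed j and s the quotient is a product of j fractions, each linear over linear in m
  with leading coefficients 1.\<close>

lemma binomial_ratio_tendsto:
  "(\<lambda>m. real ((m - s + j) choose j) / real ((m + j) choose j)) \<longlonglongrightarrow> 1"
proof -
  have "(\<lambda>m. \<Prod>i=0..<j. (real m + (real j - real i - real s)) / (real m + (real j - real i)))
      \<longlonglongrightarrow> (\<Prod>i=0..<j. 1)"
    by (intro tendsto_prod ratio_shift_tendsto)
  moreover have "\<forall>\<^sub>F m in sequentially.
      (\<Prod>i=0..<j. (real m + (real j - real i - real s)) / (real m + (real j - real i)))
      = real ((m - s + j) choose j) / real ((m + j) choose j)"
    \<comment> \<open>From s on the truncated difference \<open>m - s\<close> is the true
      one.\<close>
    using eventually_ge_at_top[of s]
  proof eventually_elim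
    fix m assume m: "s \<le> m"
    have "real ((m - s + j) choose j) / real ((m + j) choose j)
        = (\<Prod>i=0..<j. (real (m - s + j - i) / real (j - i)) / (real (m + j - i) / real (j - i)))"
      by (simp only: binomial_altdef_of_nat[of j "m - s + j"] binomial_altdef_of_nat[of j "m + j"]
          le_add2 prod_dividef)
    also have "\<dots> = (\<Prod>i=0..<j. (real m + (real j - real i - real s)) / (real m + (real j - real i)))"
    proof (rule prod.cong)
      fix i assume i: "i \<in> {0..<j}"
      have eq: "real (m - s + j - i) = real m + (real j - real i - real s)"
        "real (m + j - i) = real m + (real j - real i)"
        using m i by (auto simp: of_nat_diff)
      have "real (j - i) \<noteq> 0" using i by simp
      then show "(real (m - s + j - i) / real (j - i)) / (real (m + j - i) / real (j - i))
          = (real m + (real j - real i - real s)) / (real m + (real j - real i))"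
        unfolding eq by simp
    qed simp
    finally show "(\<Prod>i=0..<j. (real m + (real j - real i - real s)) / (real m + (real j - real i)))
      = real ((m - s + j) choose j) / real ((m + j) choose j)" by simp
  qed
  ultimately show ?thesis by (simp add: tendsto_cong)
qed

lemma card_shell_ge:
  assumes "N \<in> multi_indices k" "(\<Sum>i=1..k. N i) \<le> m"
  shows "card {q \<in> shell k m. \<forall>i\<in>{1..k}. N i \<le> q i} = card (shell k (m - (\<Sum>i=1..k. N i)))"
proof -
  have "(\<Sum>i=1..k. q i) = m \<longleftrightarrow> (\<Sum>i=1..k. q i) - (\<Sum>i=1..k. N i) = m - (\<Sum>i=1..k. N i)"
    if "\<forall>i\<in>{1..k}. N i \<le> q i" for q
    using sum_mono[of "{1..k}" N q] that assms(2) by force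
  from card_translate[OF assms(1), of "\<lambda>s. s = m" "\<lambda>s. s = m - (\<Sum>i=1..k. N i)", OF this]
  show ?thesis by (simp add: shell_def conj_assoc)
qed

lemma shell_ratio_tendsto:
  assumes "k \<ge> 1" "N \<in> multi_indices k"
  shows "(\<lambda>m. real (card {q \<in> shell k m. \<forall>i\<in>{1..k}. N i \<le> q i}) / real (card (shell k m))) \<longlonglongrightarrow> 1"
proof (rule Lim_transform_eventually[OF binomial_ratio_tendsto])
  show "\<forall>\<^sub>F m in sequentially.
      real ((m - (\<Sum>i=1..k. N i) + (k - 1)) choose (k - 1)) / real ((m + (k - 1)) choose (k - 1))
      = real (card {q \<in> shell k m. \<forall>i\<in>{1..k}. N i \<le> q i}) / real (card (shell k m))"
    using eventually_ge_at_top[of "\<Sum>i=1..k. N i"]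
  proof eventually_elim
    case (elim m)
    show ?case unfolding card_shell_ge[OF assms(2) elim] card_shell[OF assms(1)] by (rule refl)
  qed
qed

definition corner :: "nat \<Rightarrow> nat \<Rightarrow> (nat \<Rightarrow> nat) set" where
  "corner k m = {q \<in> multi_indices k. (\<Sum>i=1..k. q i) \<le> m}"

lemma corner_eq: "corner k m = (\<Union>l\<le>m. shell k l)"
  by (auto simp: corner_def shell_def)

lemma finite_corner: "finite (corner k m)"
  by (simp add: corner_eq finite_shell)

text \<open>Summing the shell sizes is the hockey stick identity.\<close>

lemma card_corner:
  assumes "k \<ge> 1"
  shows "card (corner k m) = (m + k) choose k"
proof -
  have "card (corner k m) = (\<Sum>l\<le>m. card (shell k l))"
    unfolding corner_eq by (rule card_UN_disjoint) (auto simp: finite_shell, auto simp: shell_def)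
  also have "\<dots> = (\<Sum>l\<le>m. ((k - 1) + l) choose (k - 1))" by (simp add: card_shell[OF assms] add.commute)
  also have "\<dots> = (m + k) choose k" using assms unfolding choose_rising_sum(1) by (simp add: add.commute)
  finally show ?thesis .
qed

lemma card_corner_ge:
  assumes "N \<in> multi_indices k" "(\<Sum>i=1..k. N i) \<le> m"
  shows "card {q \<in> corner k m. \<forall>i\<in>{1..k}. N i \<le> q i} = card (corner k (m - (\<Sum>i=1..k. N i)))"
proof -
  have "(\<Sum>i=1..k. q i) \<le> m \<longleftrightarrow> (\<Sum>i=1..k. q i) - (\<Sum>i=1..k. N i) \<le> m - (\<Sum>i=1..k. N i)"
    if "\<forall>i\<in>{1..k}. N i \<le> q i" for q
    using sum_mono[of "{1..k}" N q] that assms(2) by force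
  from card_translate[OF assms(1), of "\<lambda>s. s \<le> m" "\<lambda>s. s \<le> m - (\<Sum>i=1..k. N i)", OF this]
  show ?thesis by (simp add: corner_def conj_assoc)
qed

lemma corner_ratio_tendsto:
  assumes "k \<ge> 1" "N \<in> multi_indices k"
  shows "(\<lambda>m. real (card {q \<in> corner k m. \<forall>i\<in>{1..k}. N i \<le> q i}) / real (card (corner k m))) \<longlonglongrightarrow> 1"
proof (rule Lim_transform_eventually[OF binomial_ratio_tendsto])
  show "\<forall>\<^sub>F m in sequentially.
      real ((m - (\<Sum>i=1..k. N i) + k) choose k) / real ((m + k) choose k)
      = real (card {q \<in> corner k m. \<forall>i\<in>{1..k}. N i \<le> q i}) / real (card (corner k m))"
    using eventually_ge_at_top[of "\<Sum>i=1..k. N i"]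
  proof eventually_elim
    case (elim m)
    show ?case unfolding card_corner_ge[OF assms(2) elim] card_corner[OF assms(1)] by (rule refl)
  qed
qed

text \<open>Weighted Cesaro means: weights of at least 1 make the total weight exceed m, so finitely
  many early terms become negligible.\<close>

lemma weighted_average_tendsto:
  fixes w x :: "nat \<Rightarrow> real"
  assumes w: "\<And>r. w r \<ge> 1" and x: "x \<longlonglongrightarrow> l"
  shows "(\<lambda>m. (\<Sum>r=0..m. w r * x r) / (\<Sum>r=0..m. w r)) \<longlonglongrightarrow> l"
proof (rule LIMSEQ_I)
  fix e :: real assume e: "0 < e"
  then obtain N where N: "\<And>r. r \<ge> N \<Longrightarrow> norm (x r - l) < e / 2"
    using LIMSEQ_D[OF x, of "e / 2"] by auto
  \<comment> \<open>The contribution of the terms up to N, independent of m. The bound M makes it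
    smaller than e / 2 times the total weight.\<close>
  define K where "K = (\<Sum>r=0..N. w r * \<bar>x r - l\<bar>)"
  obtain M where M: "real M > 2 * K / e" using reals_Archimedean2 by blast
  have "norm ((\<Sum>r=0..m. w r * x r) / (\<Sum>r=0..m. w r) - l) < e" if m: "m \<ge> max N M" for m
  proof -
    define W where "W = (\<Sum>r=0..m. w r)"
    have "real (Suc m) = (\<Sum>r=0..m. 1)" by simp
    also have "\<dots> \<le> W" unfolding W_def by (intro sum_mono w)
    finally have W: "real m < W" by simp
    then have W0: "0 < W" by linarith
    have w0: "0 \<le> w r" for r using w[of r] by linarith
    have "\<bar>\<Sum>r=0..m. w r * (x r - l)\<bar> \<le> (\<Sum>r=0..m. w r * \<bar>x r - l\<bar>)"
      by (rule order_trans[OF sum_abs]) (simp add: abs_mult w0)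
    also have "\<dots> \<le> (\<Sum>r=0..m. (if r \<le> N then w r * \<bar>x r - l\<bar> else 0) + w r * (e / 2))"
    proof (rule sum_mono)
      fix r
      show "w r * \<bar>x r - l\<bar> \<le> (if r \<le> N then w r * \<bar>x r - l\<bar> else 0) + w r * (e / 2)"
      proof (cases "r \<le> N")
        case False
        then have "\<bar>x r - l\<bar> \<le> e / 2" using N[of r] by simp
        from mult_left_mono[OF this w0[of r]] show ?thesis using False by simp
      qed (use w0[of r] e in simp)
    qed
    also have "\<dots> = K + W * (e / 2)"
    proof -
      have "{0..m} \<inter> {r. r \<le> N} = {0..N}" using m by auto
      then show ?thesis unfolding sum.distrib K_def W_def
        by (simp add: sum.If_cases sum_distrib_right)
    qed
    finally have "\<bar>\<Sum>r=0..m. w r * (x r - l)\<bar> \<le> K + W * (e / 2)" .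
    moreover have "K < W * (e / 2)"
    proof -
      have "2 * K / e < W" using M m W by linarith
      then show ?thesis using e by (simp add: field_simps)
    qed
    ultimately have "\<bar>\<Sum>r=0..m. w r * (x r - l)\<bar> < W * e" by (simp add: field_simps)
    moreover have "(\<Sum>r=0..m. w r * x r) / W - l = (\<Sum>r=0..m. w r * (x r - l)) / W"
      using W0 by (simp add: field_simps W_def sum_subtractf sum_distrib_left right_diff_distrib)
    ultimately show ?thesis using W0 unfolding W_def[symmetric]
      by (simp add: abs_divide pos_divide_less_eq mult.commute)
  qed
  then show "\<exists>no. \<forall>m\<ge>no. norm ((\<Sum>r=0..m. w r * x r) / (\<Sum>r=0..m. w r) - l) < e" by blast
qed

definition lower_box :: "nat \<Rightarrow> (nat \<Rightarrow> nat) \<Rightarrow> (nat \<Rightarrow> nat) set" where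
  "lower_box k q = PiE {1..k} (\<lambda>i. {0..q i})"

lemma finite_lower_box: "finite (lower_box k q)"
  unfolding lower_box_def by (intro finite_PiE) auto

lemma lower_box_subset: "lower_box k q \<subseteq> multi_indices k"
  by (auto simp: lower_box_def multi_indices_def)

text \<open>With \<open>w i r\<close> the dimension of the degree r component of factor i and a the
  normalized traces, this is the trace quotient for the projection onto all degrees up to q.\<close>

definition box_average ::
    "(nat \<Rightarrow> nat \<Rightarrow> real) \<Rightarrow> nat \<Rightarrow> ((nat \<Rightarrow> nat) \<Rightarrow> real) \<Rightarrow> (nat \<Rightarrow> nat) \<Rightarrow> real" where
  "box_average w k a q = (\<Sum>s\<in>lower_box k q. (\<Prod>i=1..k. w i (s i)) * a s) / (\<Sum>s\<in>lower_box k q. \<Prod>i=1..k. w i (s i))"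

lemma sum_lower_box_Suc:
  fixes f :: "(nat \<Rightarrow> nat) \<Rightarrow> real"
  shows "(\<Sum>s\<in>lower_box (Suc k) (q(Suc k := r)). f s) = (\<Sum>s\<in>lower_box k q. \<Sum>t=0..r. f (s(Suc k := t)))"
proof -
  have "bij_betw (\<lambda>(s, t). s(Suc k := t)) (lower_box k q \<times> {0..r}) (lower_box (Suc k) (q(Suc k := r)))"
  proof (rule bij_betw_byWitness[where f' = "\<lambda>s. (s(Suc k := undefined), s (Suc k))"])
    show "\<forall>p\<in>lower_box k q \<times> {0..r}. (\<lambda>s. (s(Suc k := undefined), s (Suc k))) ((\<lambda>(s, t). s(Suc k := t)) p) = p"
      by (auto simp: lower_box_def PiE_iff extensional_def fun_eq_iff)
    show "(\<lambda>(s, t). s(Suc k := t)) ` (lower_box k q \<times> {0..r}) \<subseteq> lower_box (Suc k) (q(Suc k := r))"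
      by (auto simp: lower_box_def PiE_iff extensional_def)
    show "(\<lambda>s. (s(Suc k := undefined), s (Suc k))) ` lower_box (Suc k) (q(Suc k := r)) \<subseteq> lower_box k q \<times> {0..r}"
    proof
      fix p assume "p \<in> (\<lambda>s. (s(Suc k := undefined), s (Suc k))) ` lower_box (Suc k) (q(Suc k := r))"
      then obtain s where s: "s \<in> lower_box (Suc k) (q(Suc k := r))" and p: "p = (s(Suc k := undefined), s (Suc k))"
        by blast
      have le: "s i \<le> (q(Suc k := r)) i" if "i \<in> {1..Suc k}" for i
        using s that by (auto simp: lower_box_def PiE_iff)
      have "s(Suc k := undefined) \<in> lower_box k q"
        unfolding lower_box_def PiE_iff
      proof (intro conjI ballI)
        fix i assume "i \<in> {1..k}"
        then show "(s(Suc k := undefined)) i \<in> {0..q i}" using le[of i] by auto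
      qed (use s in \<open>auto simp: lower_box_def PiE_iff extensional_def\<close>)
      then show "p \<in> lower_box k q \<times> {0..r}" using le[of "Suc k"] by (simp add: p)
    qed
    show "\<forall>s\<in>lower_box (Suc k) (q(Suc k := r)).
        (\<lambda>(s, t). s(Suc k := t)) (s(Suc k := undefined), s (Suc k)) = s" by simp
  qed
  then have "(\<Sum>s\<in>lower_box (Suc k) (q(Suc k := r)). f s)
      = (\<Sum>p\<in>lower_box k q \<times> {0..r}. f (case p of (s, t) \<Rightarrow> s(Suc k := t)))"
    by (rule sum.reindex_bij_betw[symmetric])
  also have "\<dots> = (\<Sum>(s, t)\<in>lower_box k q \<times> {0..r}. f (s(Suc k := t)))"
    by (rule sum.cong) (auto simp only: prod.case split: prod.split)
  finally show ?thesis by (simp only: sum.cartesian_product)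
qed

text \<open>Product weights separate the last coordinate: a weighted mean over it gives a function
  of the other coordinates, whose box average remains.\<close>

lemma box_average_Suc:
  assumes w: "\<And>i r. w i r \<ge> 1"
  shows "box_average w (Suc k) a (q(Suc k := r))
    = box_average w k (\<lambda>s. (\<Sum>t=0..r. w (Suc k) t * a (s(Suc k := t))) / (\<Sum>t=0..r. w (Suc k) t)) q"
proof -
  define W where "W = (\<Sum>t=0..r. w (Suc k) t)"
  have "0 < w (Suc k) t" for t using w[of "Suc k" t] by linarith
  then have W: "0 < W" unfolding W_def by (intro sum_pos) auto
  have prod: "(\<Prod>i=1..Suc k. w i ((s(Suc k := t)) i)) = (\<Prod>i=1..k. w i (s i)) * w (Suc k) t"
    for s :: "nat \<Rightarrow> nat" and t
  proof -
    have "(\<Prod>i=1..k. w i ((s(Suc k := t)) i)) = (\<Prod>i=1..k. w i (s i))" by (rule prod.cong) auto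
    then show ?thesis by simp
  qed
  have "box_average w (Suc k) a (q(Suc k := r))
      = (\<Sum>s\<in>lower_box k q. (\<Prod>i=1..k. w i (s i)) * (\<Sum>t=0..r. w (Suc k) t * a (s(Suc k := t))))
        / (\<Sum>s\<in>lower_box k q. (\<Prod>i=1..k. w i (s i)) * W)"
    unfolding box_average_def sum_lower_box_Suc prod W_def by (simp add: sum_distrib_left mult.assoc)
  also have "\<dots> = (\<Sum>s\<in>lower_box k q. (\<Prod>i=1..k. w i (s i)) * (\<Sum>t=0..r. w (Suc k) t * a (s(Suc k := t))))
        / W / (\<Sum>s\<in>lower_box k q. \<Prod>i=1..k. w i (s i))"
    unfolding sum_distrib_right[symmetric] by (simp add: mult.commute)
  also have "(\<Sum>s\<in>lower_box k q. (\<Prod>i=1..k. w i (s i)) * (\<Sum>t=0..r. w (Suc k) t * a (s(Suc k := t)))) / W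
      = (\<Sum>s\<in>lower_box k q. (\<Prod>i=1..k. w i (s i)) * ((\<Sum>t=0..r. w (Suc k) t * a (s(Suc k := t))) / W))"
    by (simp only: sum_divide_distrib[of _ "lower_box k q"] times_divide_eq_right)
  finally show ?thesis unfolding box_average_def W_def .
qed

text \<open>Induction on k: as the last coordinate grows, the inner weighted mean tends to the
  supremum a' of a over that coordinate. The function a' is again bounded and increasing and has the
  same supremum, so the induction hypothesis applies to it.\<close>

lemma box_average_iterated_lim:
  assumes w: "\<And>i r. w i r \<ge> 1" and a: "bounded_increasing_net k a C"
  shows "has_iterated_lim k (\<lambda>q. complex_of_real (box_average w k a q))
    (complex_of_real (bounded_increasing_net.L k a))"
  using a
proof (induction k arbitrary: a)
  case 0
  \<comment> \<open>The single multi-index for k = 0; the average over it is the value of a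
    there.\<close>
  have "multi_indices 0 = {\<lambda>_. undefined}" "lower_box 0 q = {\<lambda>_. undefined}" for q :: "nat \<Rightarrow> nat"
    by (auto simp: multi_indices_def lower_box_def)
  then show ?case by (simp add: box_average_def bounded_increasing_net.L_def[OF 0])
next
  case (Suc k)
  interpret S: bounded_increasing_net "Suc k" a C by (rule Suc.prems)
  define a' where "a' s = (SUP t. a (s(Suc k := t)))" for s
  have bdd': "bdd_above (range (\<lambda>t. a (s(Suc k := t))))" if "s \<in> multi_indices k" for s
    using S.upper[OF multi_indices_Suc_upd[OF that]] by (intro bdd_aboveI[of _ C]) auto
  have le_a': "a (s(Suc k := t)) \<le> a' s" if "s \<in> multi_indices k" for s t
    unfolding a'_def by (rule cSUP_upper[OF _ bdd'[OF that]]) simp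
  have lim: "(\<lambda>t. a (s(Suc k := t))) \<longlonglongrightarrow> a' s" if "s \<in> multi_indices k" for s
    unfolding a'_def
  proof (rule LIMSEQ_incseq_SUP[OF bdd'[OF that]])
    show "incseq (\<lambda>t. a (s(Suc k := t)))"
      using S.step[OF multi_indices_Suc_upd[OF that], of "Suc k"] by (intro incseq_SucI) simp
  qed
  have net: "bounded_increasing_net k a' C"
  proof
    fix q assume q: "q \<in> multi_indices k"
    show "a' q \<le> C" unfolding a'_def
      by (rule cSUP_least) (use S.upper[OF multi_indices_Suc_upd[OF q]] in auto)
    show "0 \<le> a' q" using le_a'[OF q, of 0] S.nonneg[OF multi_indices_Suc_upd[OF q], of 0] by linarith
    fix i assume i: "i \<in> {1..k}"
    show "a' q \<le> a' (q(i := Suc (q i)))" unfolding a'_def[of q]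
    proof (rule cSUP_least)
      fix t
      have "a (q(Suc k := t)) \<le> a ((q(i := Suc (q i)))(Suc k := t))"
        using S.step[OF multi_indices_Suc_upd[OF q], of i t] i
        by (simp add: fun_upd_twist[of i "Suc k"])
      also have "\<dots> \<le> a' (q(i := Suc (q i)))" by (rule le_a'[OF multi_indices_upd[OF q i]])
      finally show "a (q(Suc k := t)) \<le> a' (q(i := Suc (q i)))" .
    qed simp
  qed
  interpret S': bounded_increasing_net k a' C by (rule net)
  have "S'.L = S.L"
  proof (rule antisym)
    show "S'.L \<le> S.L" unfolding S'.L_def a'_def
      by (intro cSUP_least S'.multi_indices_nonempty S.le_L multi_indices_Suc_upd) auto
    show "S.L \<le> S'.L" unfolding S.L_def
    proof (rule cSUP_least[OF S.multi_indices_nonempty])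
      fix q assume "q \<in> multi_indices (Suc k)"
      then obtain s r where s: "s \<in> multi_indices k" and q: "q = s(Suc k := r)"
        by (rule multi_indices_Suc_cases)
      show "a q \<le> S'.L" unfolding q using le_a'[OF s] S'.le_L[OF s] by (rule order_trans)
    qed
  qed
  moreover have "(\<lambda>r. complex_of_real (box_average w (Suc k) a (q(Suc k := r))))
      \<longlonglongrightarrow> complex_of_real (box_average w k a' q)" if q: "q \<in> multi_indices k" for q
  proof (rule tendsto_of_real)
    have "0 < (\<Prod>i=1..k. w i (s i))" for s using w by (intro prod_pos) (metis less_le_trans zero_less_one)
    moreover have "(\<lambda>i\<in>{1..k}. 0) \<in> lower_box k q" by (auto simp: lower_box_def)
    ultimately have "0 < (\<Sum>s\<in>lower_box k q. \<Prod>i=1..k. w i (s i))"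
      by (intro sum_pos finite_lower_box) auto
    then show "(\<lambda>r. box_average w (Suc k) a (q(Suc k := r))) \<longlonglongrightarrow> box_average w k a' q"
      unfolding box_average_Suc[OF w] unfolding box_average_def
      using lower_box_subset[of k q]
      by (intro tendsto_divide tendsto_sum tendsto_mult tendsto_const weighted_average_tendsto w lim) auto
  qed
  ultimately show ?case using Suc.IH[OF net]
    by (auto intro!: exI[of _ "\<lambda>q. complex_of_real (box_average w k a' q)"])
qed

section \<open>The orthonormal basis of symmetric tensors\<close>

definition multi_types :: "nat \<Rightarrow> (nat \<Rightarrow> nat) \<Rightarrow> (nat \<Rightarrow> nat) \<Rightarrow> (nat \<Rightarrow> nat multiset) set" where
  "multi_types k n q = PiE {1..k} (\<lambda>i. multisets_of_size {1..n i} (q i))"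

text \<open>The symmetric tensor of content \<mu> has equal coordinates at
  \<open>card (rearrangements k \<mu>)\<close> words, whence the root that normalizes it.\<close>

definition sym_vec ::
    "nat \<Rightarrow> (nat \<Rightarrow> nat multiset) \<Rightarrow> 'e::chilbert_space \<Rightarrow> (nat \<Rightarrow> nat list, 'e) ell2" where
  "sym_vec k \<mu> b = complex_of_real (1 / sqrt (card (rearrangements k \<mu>))) *\<^sub>C
     (\<Sum>\<beta>\<in>rearrangements k \<mu>. single \<beta> b)"

lemma multi_typesD:
  assumes "\<mu> \<in> multi_types k n q" "i \<in> {1..k}"
  shows "set_mset (\<mu> i) \<subseteq> {1..n i}" "size (\<mu> i) = q i"
  using PiE_mem[OF assms[unfolded multi_types_def]] by (auto simp: multisets_of_size_def)

lemma finite_multi_types: "finite (multi_types k n q)"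
  unfolding multi_types_def by (intro finite_PiE) auto

lemma card_multi_types: "card (multi_types k n q) = (\<Prod>i=1..k. card (multisets_of_size {1..n i} (q i)))"
  unfolding multi_types_def by (simp add: card_PiE)

lemma card_multisets_of_size_pos:
  assumes "n \<ge> (1 :: nat)" shows "card (multisets_of_size {1..n} p) > 0"
proof -
  have "replicate_mset p 1 \<in> multisets_of_size {1..n} p"
    using assms by (auto simp: multisets_of_size_def split: if_splits)
  then show ?thesis using finite_multisets_of_size[of "{1..n}" p] by (auto simp: card_gt_0_iff)
qed

lemma rearrangements_degree_words:
  assumes \<mu>: "\<mu> \<in> multi_types k n q" and \<beta>: "\<beta> \<in> rearrangements k \<mu>"
  shows "\<beta> \<in> degree_words k n q"
proof -
  have "set (\<beta> i) \<subseteq> {1..n i} \<and> length (\<beta> i) = q i" if "i \<in> {1..k}" for i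
  proof -
    have "mset (\<beta> i) = \<mu> i" using \<beta> that by (simp add: rearrangements_iff)
    then show ?thesis using multi_typesD[OF \<mu> that] by (metis set_mset_mset size_mset)
  qed
  then show ?thesis using \<beta> unfolding degree_words_def words_iff rearrangements_iff by simp
qed

lemma degree_words_type:
  assumes "\<beta> \<in> degree_words k n q"
  shows "(\<lambda>i\<in>{1..k}. mset (\<beta> i)) \<in> multi_types k n q" "\<beta> \<in> rearrangements k (\<lambda>i\<in>{1..k}. mset (\<beta> i))"
  using assms
  by (auto simp: degree_words_def words_iff multi_types_def multisets_of_size_def rearrangements_iff)

lemma multi_types_eqI:
  assumes "\<mu> \<in> multi_types k n q" "\<beta> \<in> rearrangements k \<mu>"
  shows "\<mu> = (\<lambda>i\<in>{1..k}. mset (\<beta> i))"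
  using assms by (auto simp: multi_types_def rearrangements_iff PiE_iff extensional_def fun_eq_iff)

lemma coord_sym_vec:
  "coord (sym_vec k \<mu> b) \<beta>
    = (if \<beta> \<in> rearrangements k \<mu> then complex_of_real (1 / sqrt (card (rearrangements k \<mu>))) *\<^sub>C b else 0)"
proof -
  have "coord (\<Sum>\<beta>\<in>rearrangements k \<mu>. single \<beta> b) \<beta> = (if \<beta> \<in> rearrangements k \<mu> then b else 0)"
    unfolding coord_sum single.rep_eq by (subst sum.delta') (simp_all add: finite_rearrangements)
  then show ?thesis by (simp add: sym_vec_def)
qed

lemma sym_vec_in_fock_tensor:
  assumes \<mu>: "\<mu> \<in> multi_types k n q"
  shows "sym_vec k \<mu> b \<in> fock_tensor k n UNIV"
  unfolding fock_tensor_eq[OF closed_csubspace_UNIV]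
proof (rule sym_familyI)
  fix \<beta> assume "\<beta> \<notin> words k n"
  then have "\<beta> \<notin> rearrangements k \<mu>"
    using rearrangements_degree_words[OF \<mu>] by (auto simp: degree_words_def)
  then show "coord (sym_vec k \<mu> b) \<beta> = 0" by (simp add: coord_sym_vec)
next
  fix \<beta> \<gamma> assume *: "\<beta> \<in> words k n" "\<gamma> \<in> words k n" "\<forall>i\<in>{1..k}. mset (\<beta> i) = mset (\<gamma> i)"
  then have "\<beta> \<in> rearrangements k \<mu> \<longleftrightarrow> \<gamma> \<in> rearrangements k \<mu>"
    unfolding rearrangements_iff words_iff by simp
  then show "coord (sym_vec k \<mu> b) \<beta> = coord (sym_vec k \<mu> b) \<gamma>" by (simp add: coord_sym_vec)
qed simp

lemma cinner_sym_vec: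
  assumes x: "x \<in> fock_tensor k n UNIV" and \<mu>: "\<mu> \<in> multi_types k n q" and \<beta>: "\<beta> \<in> rearrangements k \<mu>"
  shows "cinner x (sym_vec k \<mu> b)
    = complex_of_real (sqrt (card (rearrangements k \<mu>))) * cinner (coord x \<beta>) b"
proof -
  define c where "c = real (card (rearrangements k \<mu>))"
  have c: "c > 0" using card_rearrangements_pos[of k \<mu>] by (simp add: c_def)
  have "\<beta> \<in> words k n" using rearrangements_degree_words[OF \<mu> \<beta>] by (simp add: degree_words_def)
  from sym_family_cinner_rearrangements[OF x[unfolded fock_tensor_eq[OF closed_csubspace_UNIV]] this \<beta>]
  have "cinner x (sym_vec k \<mu> b) = complex_of_real (1 / sqrt c * c) * cinner (coord x \<beta>) b"
    by (simp add: sym_vec_def cinner_scaleC_right c_def)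
  also have "1 / sqrt c * c = sqrt c" using c by (simp add: real_div_sqrt)
  finally show ?thesis by (simp add: c_def)
qed

lemma norm_sym_vec:
  assumes \<mu>: "\<mu> \<in> multi_types k n q"
  shows "cinner (sym_vec k \<mu> b) (sym_vec k \<mu> b) = cinner b b"
proof -
  obtain \<beta> where \<beta>: "\<beta> \<in> rearrangements k \<mu>"
    using card_rearrangements_pos[of k \<mu>] by (auto simp: card_gt_0_iff)
  define c where "c = sqrt (card (rearrangements k \<mu>))"
  have "c > 0" using card_rearrangements_pos[of k \<mu>] by (simp add: c_def)
  have "cinner (sym_vec k \<mu> b) (sym_vec k \<mu> b)
      = complex_of_real c * (complex_of_real (1 / c) * cinner b b)"
    using \<beta> by (simp add: cinner_sym_vec[OF sym_vec_in_fock_tensor[OF \<mu>] \<mu> \<beta>] coord_sym_vec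
        cinner_scaleC_left c_def)
  also have "\<dots> = complex_of_real (c * (1 / c)) * cinner b b" by (simp only: of_real_mult mult.assoc)
  also have "\<dots> = cinner b b" using \<open>c > 0\<close> by simp
  finally show ?thesis .
qed

text \<open>For the finite dimensional coefficient space an exact finite expansion takes the place
  of the closed span in \<open>is_onb\<close>.\<close>

definition finite_onb :: "'e::chilbert_space set \<Rightarrow> bool" where
  "finite_onb B \<longleftrightarrow> finite B \<and> orthonormal B \<and> (\<forall>v. v = (\<Sum>b\<in>B. cinner v b *\<^sub>C b))"

lemma finite_onbD:
  assumes "finite_onb B"
  shows "finite B" "b \<in> B \<Longrightarrow> cinner b b = 1" "(\<Sum>b\<in>B. cinner v b *\<^sub>C b) = v"
  using assms unfolding finite_onb_def orthonormal_def by auto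

lemma finite_onb_complex: "finite_onb {1 :: complex}"
  by (simp add: finite_onb_def orthonormal_def cinner_complex_def scaleC_complex_def)

text \<open>At a word \<beta> of degree q the sum over contents collapses, since \<beta> rearranges
  exactly one \<mu>; the remaining sum over b is the expansion of
  \<open>coord x \<beta>\<close>.\<close>

lemma sym_vec_expansion:
  assumes x: "x \<in> fock_tensor k n UNIV" and B: "finite_onb B"
  shows "ell2_restrict (degree_words k n q) x
    = (\<Sum>(\<mu>, b)\<in>multi_types k n q \<times> B. cinner x (sym_vec k \<mu> b) *\<^sub>C sym_vec k \<mu> b)"
proof (rule ell2_eqI)
  fix \<beta> :: "nat \<Rightarrow> nat list"
  let ?\<mu> = "\<lambda>i\<in>{1..k}. mset (\<beta> i)"
  have summand: "(\<Sum>b\<in>B. coord (cinner x (sym_vec k \<mu> b) *\<^sub>C sym_vec k \<mu> b) \<beta>)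
      = (if \<beta> \<in> rearrangements k \<mu> then coord x \<beta> else 0)" if \<mu>: "\<mu> \<in> multi_types k n q" for \<mu>
  proof (cases "\<beta> \<in> rearrangements k \<mu>")
    case True
    define c where "c = sqrt (card (rearrangements k \<mu>))"
    have c: "c > 0" using card_rearrangements_pos[of k \<mu>] by (simp add: c_def)
    have "coord (cinner x (sym_vec k \<mu> b) *\<^sub>C sym_vec k \<mu> b) \<beta> = cinner (coord x \<beta>) b *\<^sub>C b" for b
    proof -
      have "coord (cinner x (sym_vec k \<mu> b) *\<^sub>C sym_vec k \<mu> b) \<beta>
          = (complex_of_real c * cinner (coord x \<beta>) b * complex_of_real (1 / c)) *\<^sub>C b"
        using True by (simp add: cinner_sym_vec[OF x \<mu> True] coord_sym_vec scaleC_scaleC c_def)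
      also have "complex_of_real c * cinner (coord x \<beta>) b * complex_of_real (1 / c) = cinner (coord x \<beta>) b"
        using c by simp
      finally show ?thesis .
    qed
    then show ?thesis using True by (simp add: finite_onbD(3)[OF B])
  qed (simp add: coord_sym_vec cvec.scale_zero_right)
  have "coord (\<Sum>(\<mu>, b)\<in>multi_types k n q \<times> B. cinner x (sym_vec k \<mu> b) *\<^sub>C sym_vec k \<mu> b) \<beta>
      = (\<Sum>\<mu>\<in>multi_types k n q. \<Sum>b\<in>B. coord (cinner x (sym_vec k \<mu> b) *\<^sub>C sym_vec k \<mu> b) \<beta>)"
    unfolding coord_sum sum.cartesian_product by (rule sum.cong) auto
  also have "\<dots> = (\<Sum>\<mu>\<in>multi_types k n q. if \<beta> \<in> rearrangements k \<mu> then coord x \<beta> else 0)"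
    by (rule sum.cong) (simp_all only: summand)
  also have "\<dots> = (\<Sum>\<mu>\<in>multi_types k n q. if \<mu> = ?\<mu> then (if \<beta> \<in> degree_words k n q then coord x \<beta> else 0) else 0)"
  proof (rule sum.cong)
    fix \<mu> assume \<mu>: "\<mu> \<in> multi_types k n q"
    show "(if \<beta> \<in> rearrangements k \<mu> then coord x \<beta> else 0)
        = (if \<mu> = ?\<mu> then (if \<beta> \<in> degree_words k n q then coord x \<beta> else 0) else 0)"
    proof -
      have "\<beta> \<in> rearrangements k \<mu> \<longleftrightarrow> \<mu> = ?\<mu> \<and> \<beta> \<in> degree_words k n q"
        using multi_types_eqI[OF \<mu>, of \<beta>] rearrangements_degree_words[OF \<mu>, of \<beta>]
          degree_words_type(2)[of \<beta> k n q] by blast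
      then show ?thesis by (simp only: if_split conj_commute) simp
    qed
  qed simp
  also have "\<dots> = (if ?\<mu> \<in> multi_types k n q then (if \<beta> \<in> degree_words k n q then coord x \<beta> else 0) else 0)"
    by (rule sum.delta[OF finite_multi_types])
  also have "\<dots> = coord (ell2_restrict (degree_words k n q) x) \<beta>"
    using degree_words_type(1)[of \<beta> k n q] by (auto simp: ell2_restrict.rep_eq)
  finally show "coord (ell2_restrict (degree_words k n q) x) \<beta>
      = coord (\<Sum>(\<mu>, b)\<in>multi_types k n q \<times> B. cinner x (sym_vec k \<mu> b) *\<^sub>C sym_vec k \<mu> b) \<beta>" ..
qed

section \<open>Traces in the basis of symmetric tensors\<close>

definition proj_weight ::
    "nat \<Rightarrow> (nat \<Rightarrow> nat) \<Rightarrow> (nat \<Rightarrow> nat list, 'e::chilbert_space) ell2 set \<Rightarrow> 'e set \<Rightarrow> (nat \<Rightarrow> nat) \<Rightarrow> real" where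
  "proj_weight k n M B q = (\<Sum>(\<mu>, b)\<in>multi_types k n q \<times> B. (norm (orth_proj M (sym_vec k \<mu> b)))\<^sup>2)"

lemma cinner_orth_proj_self:
  assumes "closed_csubspace M"
  shows "cinner (orth_proj M x) x = of_real ((norm (orth_proj M x))\<^sup>2)"
  using orth_proj_selfadjoint[OF assms, of "orth_proj M x" x]
  by (simp add: orth_proj_ident[OF assms orth_proj_in[OF assms]] cinner_self)

text \<open>Taking a finite set S of degrees covers both a single homogeneous component and a whole
  box.\<close>

lemma trace_proj_sum_Q:
  fixes B :: "'e::chilbert_space set"
  assumes M: "closed_csubspace M" "M \<subseteq> fock_tensor k n UNIV" and B: "finite_onb B" and S: "finite S"
  shows "trace_on (fock_tensor k n UNIV) (orth_proj M \<circ> (\<lambda>x. \<Sum>s\<in>S. Q_op k n s UNIV x))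
    = complex_of_real (\<Sum>s\<in>S. proj_weight k n M B s)"
proof -
  let ?F = "fock_tensor k n (UNIV :: 'e set)"
  let ?U = "SIGMA s:S. multi_types k n s \<times> B"
  let ?u = "\<lambda>(s :: nat \<Rightarrow> nat, \<mu>, b). sym_vec k \<mu> b"
  note cl = closed_csubspace_fock_tensor[of k n "UNIV :: 'e set"]
  note Plin = bounded_clinearD[OF bounded_clinear_orth_proj[OF M(1)]]
  have fin: "finite ?U"
    using finite_onbD(1)[OF B] S by (intro finite_SigmaI finite_cartesian_product finite_multi_types)
  have exp: "(\<Sum>s\<in>S. Q_op k n s UNIV e) = (\<Sum>u\<in>?U. cinner e (?u u) *\<^sub>C ?u u)" if e: "e \<in> ?F" for e
  proof -
    have "(\<Sum>s\<in>S. Q_op k n s UNIV e)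
        = (\<Sum>s\<in>S. \<Sum>(\<mu>, b)\<in>multi_types k n s \<times> B. cinner e (sym_vec k \<mu> b) *\<^sub>C sym_vec k \<mu> b)"
      unfolding Q_op_eq[OF closed_csubspace_UNIV] orth_proj_ident[OF cl e] sym_vec_expansion[OF e B] ..
    also have "\<dots> = (\<Sum>(s, \<mu>, b)\<in>?U. cinner e (sym_vec k \<mu> b) *\<^sub>C sym_vec k \<mu> b)"
      using finite_onbD(1)[OF B] S by (subst sum.Sigma) (auto simp: finite_multi_types split_beta)
    finally show ?thesis by (simp add: case_prod_unfold)
  qed
  have "trace_on ?F (orth_proj M \<circ> (\<lambda>x. \<Sum>s\<in>S. Q_op k n s UNIV x))
      = (\<Sum>u\<in>?U. cinner (orth_proj ?F (orth_proj M (?u u))) (?u u))"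
  proof (rule trace_on_finite_rank[OF cl fin])
    fix e assume e: "e \<in> ?F"
    show "cinner ((orth_proj M \<circ> (\<lambda>x. \<Sum>s\<in>S. Q_op k n s UNIV x)) e) e
        = (\<Sum>u\<in>?U. cinner e (?u u) * cinner (orth_proj M (?u u)) e)"
      unfolding o_def exp[OF e] by (simp only: Plin cinner_sum_left cinner_scaleC_left)
  qed
  also have "\<dots> = (\<Sum>u\<in>?U. of_real ((norm (orth_proj M (?u u)))\<^sup>2))"
    using M orth_proj_in[OF M(1)]
    by (intro sum.cong refl) (subst orth_proj_ident[OF cl], auto simp: cinner_orth_proj_self)
  also have "\<dots> = complex_of_real (\<Sum>s\<in>S. proj_weight k n M B s)"
    unfolding proj_weight_def of_real_sum
    using finite_onbD(1)[OF B] S by (subst sum.Sigma) (auto simp: finite_multi_types split_beta)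
  finally show ?thesis .
qed

lemma trace_proj_Q:
  assumes "closed_csubspace M" "M \<subseteq> fock_tensor k n UNIV" "finite_onb B"
  shows "trace_on (fock_tensor k n UNIV) (orth_proj M \<circ> Q_op k n q UNIV)
    = complex_of_real (proj_weight k n M B q)"
  using trace_proj_sum_Q[OF assms, of "{q}"] by simp

lemma trace_proj_Q_le:
  assumes "closed_csubspace M" "M \<subseteq> fock_tensor k n UNIV" "finite_onb B"
  shows "trace_on (fock_tensor k n UNIV) (orth_proj M \<circ> Q_le_op k n q UNIV)
    = complex_of_real (\<Sum>s\<in>lower_box k q. proj_weight k n M B s)"
  unfolding Q_le_op_def lower_box_def[symmetric] by (rule trace_proj_sum_Q[OF assms finite_lower_box])

lemma proj_weight_fock_tensor:
  fixes B :: "'e::chilbert_space set"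
  assumes B: "finite_onb B"
  shows "proj_weight k n (fock_tensor k n UNIV) B q = real (card (multi_types k n q) * card B)"
proof -
  have "(norm (orth_proj (fock_tensor k n UNIV) (sym_vec k \<mu> b)))\<^sup>2 = 1"
    if "\<mu> \<in> multi_types k n q" "b \<in> B" for \<mu> b
  proof -
    have "complex_of_real ((norm (sym_vec k \<mu> b))\<^sup>2) = complex_of_real 1"
      using norm_sym_vec[OF that(1), of b] finite_onbD(2)[OF B that(2)] by (simp add: cinner_self)
    then show ?thesis unfolding of_real_eq_iff
      by (simp add: orth_proj_ident[OF closed_csubspace_fock_tensor sym_vec_in_fock_tensor[OF that(1)]])
  qed
  then have "proj_weight k n (fock_tensor k n UNIV) B q = (\<Sum>(\<mu>, b)\<in>multi_types k n q \<times> B. 1)"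
    unfolding proj_weight_def by (intro sum.cong) auto
  then show ?thesis by (simp add: split_beta card_cartesian_product)
qed

lemma Q_op_in_fock_tensor: "Q_op k n q UNIV x \<in> fock_tensor k n UNIV"
  using restrict_degree_words[OF _ closed_csubspace_UNIV] orth_proj_in[OF closed_csubspace_fock_tensor, of k n UNIV x]
  unfolding Q_op_eq[OF closed_csubspace_UNIV] fock_tensor_eq[OF closed_csubspace_UNIV] by blast

lemma trace_Q:
  "trace_on (fock_tensor k n (UNIV :: complex set)) (Q_op k n q UNIV) = of_nat (card (multi_types k n q))"
proof -
  let ?F = "fock_tensor k n (UNIV :: complex set)"
  note cl = closed_csubspace_fock_tensor[of k n "UNIV :: complex set"]
  have "orth_proj ?F \<circ> Q_op k n q UNIV = Q_op k n q UNIV"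
    by (rule ext) (simp add: orth_proj_ident[OF cl Q_op_in_fock_tensor])
  then show ?thesis
    using trace_proj_Q[OF cl order_refl finite_onb_complex, of q]
    by (simp add: proj_weight_fock_tensor[OF finite_onb_complex])
qed

lemma trace_Q_le:
  "trace_on (fock_tensor k n (UNIV :: complex set)) (Q_le_op k n q UNIV)
    = complex_of_real (\<Sum>s\<in>lower_box k q. real (card (multi_types k n s)))"
proof -
  let ?F = "fock_tensor k n (UNIV :: complex set)"
  note cl = closed_csubspace_fock_tensor[of k n "UNIV :: complex set"]
  have "Q_le_op k n q UNIV x \<in> ?F" for x :: "(nat \<Rightarrow> nat list, complex) ell2"
    unfolding Q_le_op_def
    by (intro cvec.subspace_sum closed_csubspaceD(6)[OF cl] Q_op_in_fock_tensor)
  then have "orth_proj ?F \<circ> Q_le_op k n q UNIV = Q_le_op k n q UNIV"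
    by (intro ext) (simp add: orth_proj_ident[OF cl])
  then show ?thesis
    using trace_proj_Q_le[OF cl order_refl finite_onb_complex, of q]
    by (simp add: proj_weight_fock_tensor[OF finite_onb_complex])
qed

lemma cinner_multiset_vec: "cinner f (multiset_vec A) = (\<Sum>w\<in>permutations_of_multiset A. coord f w)"
proof -
  have "ket w = single w 1" for w :: "nat list" by (rule ell2_eqI) (simp add: ket.rep_eq single.rep_eq)
  then show ?thesis
    by (simp add: multiset_vec_def cinner_sum_right cinner_single_right cinner_complex_def)
qed

text \<open>In a single factor the vectors \<open>multiset_vec A\<close> have squared norm c A, so
  after division by it each multiset of size p contributes 1 to the trace.\<close>

lemma trace_degree_proj:
  "trace_on (sym_fock n) (degree_proj n p) = of_nat (card (multisets_of_size {1..n} p))"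
proof -
  note cl = closed_csubspace_sym_fock[of n]
  define c where "c A = complex_of_nat (card (permutations_of_multiset (A :: nat multiset)))" for A
  have c0: "c A \<noteq> 0" for A by (simp add: c_def card_eq_0_iff)
  have in_sf: "multiset_vec A \<in> sym_fock n" if "A \<in> multisets_of_size {1..n} p" for A
    using that by (intro multiset_vec_in_sym_fock multisets_of_size_subset)
  have inner: "cinner f (multiset_vec A) = c A * coord f w" if "f \<in> sym_fock n" "mset w = A" for f A w
  proof -
    have "coord f v = coord f w" if "v \<in> permutations_of_multiset A" for v
      using sym_wordsD(2)[of f n v w] \<open>f \<in> sym_fock n\<close> \<open>mset w = A\<close> that
      by (simp add: sym_fock_eq permutations_of_multiset_def)
    then show ?thesis by (simp add: cinner_multiset_vec c_def)
  qed
  have exp: "degree_proj n p f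
      = (\<Sum>A\<in>multisets_of_size {1..n} p. (cinner f (multiset_vec A) / c A) *\<^sub>C multiset_vec A)"
    if f: "f \<in> sym_fock n" for f
  proof (rule ell2_eqI)
    fix w
    have "coord ((cinner f (multiset_vec A) / c A) *\<^sub>C multiset_vec A) w
        = (if A = mset w then coord f w else 0)" for A
      using inner[OF f, of w A] c0[of A] by (auto simp: coord_multiset_vec scaleC_complex_def)
    then have "coord (\<Sum>A\<in>multisets_of_size {1..n} p. (cinner f (multiset_vec A) / c A) *\<^sub>C multiset_vec A) w
        = (if mset w \<in> multisets_of_size {1..n} p then coord f w else 0)"
      unfolding coord_sum by (simp add: sum.delta[OF finite_multisets_of_size])
    also have "\<dots> = coord (degree_proj n p f) w"
    proof -
      have "coord f w = 0" if "\<not> set w \<subseteq> {1..n}"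
        using sym_wordsD(1)[of f n w] f that by (simp add: sym_fock_eq lists_eq_set)
      then show ?thesis
        by (auto simp: degree_proj_sym_fock[OF f] ell2_restrict.rep_eq multisets_of_size_def)
    qed
    finally show "coord (degree_proj n p f) w = coord (\<Sum>A\<in>multisets_of_size {1..n} p.
        (cinner f (multiset_vec A) / c A) *\<^sub>C multiset_vec A) w" ..
  qed
  have "trace_on (sym_fock n) (degree_proj n p) = (\<Sum>A\<in>multisets_of_size {1..n} p.
      cinner (orth_proj (sym_fock n) ((1 / c A) *\<^sub>C multiset_vec A)) (multiset_vec A))"
  proof (rule trace_on_finite_rank[OF cl finite_multisets_of_size])
    fix e assume "e \<in> sym_fock n"
    then show "cinner (degree_proj n p e) e = (\<Sum>A\<in>multisets_of_size {1..n} p.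
        cinner e (multiset_vec A) * cinner ((1 / c A) *\<^sub>C multiset_vec A) e)"
      by (simp add: exp cinner_sum_left cinner_scaleC_left)
  qed simp
  also have "\<dots> = (\<Sum>A\<in>multisets_of_size {1..n} p. 1)"
  proof (rule sum.cong)
    fix A assume A: "A \<in> multisets_of_size {1..n} p"
    obtain w where w: "mset w = A" using ex_mset by blast
    have "(1 / c A) *\<^sub>C multiset_vec A \<in> sym_fock n"
      by (intro closed_csubspaceD(3)[OF cl] in_sf A)
    then show "cinner (orth_proj (sym_fock n) ((1 / c A) *\<^sub>C multiset_vec A)) (multiset_vec A) = 1"
      using inner[OF in_sf[OF A] w] c0[of A] w
      by (simp add: orth_proj_ident[OF cl] cinner_scaleC_left coord_multiset_vec)
  qed simp
  finally show ?thesis by simp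
qed

section \<open>Monotonicity of the normalized traces\<close>

text \<open>The ranges of prepending j in factor i are disjoint, so their projections add up to the
  one onto nonempty i-th words. Leading letters outside \<open>{1..n i}\<close> do not occur because
  x is supported on \<open>words k n\<close>.\<close>

lemma sum_annihilation_cinner:
  assumes x: "x \<in> fock_tensor k n UNIV" and i: "i \<in> {1..k}"
  shows "(\<Sum>j=1..n i. cinner (annihilation i j x) (annihilation i j y))
    = cinner (ell2_restrict {\<beta>. \<beta> i \<noteq> []} x) y"
proof -
  let ?h = "\<lambda>j \<beta>. (\<beta> :: nat \<Rightarrow> nat list)(i := j # \<beta> i)"
  have range: "\<beta> \<in> range (?h j) \<longleftrightarrow> (\<exists>w. \<beta> i = j # w)" for \<beta> j
  proof
    assume "\<exists>w. \<beta> i = j # w"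
    then obtain w where "\<beta> i = j # w" by blast
    then have "\<beta> = ?h j (\<beta>(i := w))" by (simp add: fun_eq_iff)
    then show "\<beta> \<in> range (?h j)" by blast
  qed auto
  have "(\<Sum>j=1..n i. ell2_restrict (range (?h j)) x) = ell2_restrict {\<beta>. \<beta> i \<noteq> []} x"
  proof (rule ell2_eqI)
    fix \<beta>
    have "coord (\<Sum>j=1..n i. ell2_restrict (range (?h j)) x) \<beta>
        = (\<Sum>j=1..n i. if \<beta> \<in> range (?h j) then coord x \<beta> else 0)"
      by (simp only: coord_sum ell2_restrict.rep_eq)
    also have "\<dots> = (if \<beta> i \<noteq> [] then coord x \<beta> else 0)"
    proof (cases "coord x \<beta> = 0 \<or> \<beta> i = []")
      case False
      then have "\<beta> \<in> words k n" "\<beta> i \<noteq> []"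
        using x sym_familyD(1)[of x k n UNIV \<beta>] by (auto simp: fock_tensor_eq[OF closed_csubspace_UNIV])
      then obtain j0 w where "\<beta> i = j0 # w" by (cases "\<beta> i") auto
      moreover have "set (\<beta> i) \<subseteq> {1..n i}" using \<open>\<beta> \<in> words k n\<close> i unfolding words_iff by blast
      ultimately have jw: "\<beta> i = j0 # w" "j0 \<in> {1..n i}" by auto
      have "(\<Sum>j=1..n i. if \<beta> \<in> range (?h j) then coord x \<beta> else 0)
          = (\<Sum>j=1..n i. if j = j0 then coord x \<beta> else 0)"
        unfolding range jw(1) by (rule sum.cong) auto
      then show ?thesis using jw by simp
    next
      case True
      then show ?thesis unfolding range by (auto intro!: sum.neutral)
    qed
    finally show "coord (\<Sum>j=1..n i. ell2_restrict (range (?h j)) x) \<beta>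
        = coord (ell2_restrict {\<beta>. \<beta> i \<noteq> []} x) \<beta>" by (simp add: ell2_restrict.rep_eq)
  qed
  then show ?thesis
    by (simp only: annihilation_def cinner_pull_back[OF inj_prepend] cinner_sum_left[symmetric])
qed

lemma sum_norm_annihilation_le:
  assumes x: "x \<in> fock_tensor k n UNIV" and i: "i \<in> {1..k}"
  shows "(\<Sum>j=1..n i. (norm (annihilation i j x))\<^sup>2) \<le> (norm x)\<^sup>2"
proof -
  have "complex_of_real (\<Sum>j=1..n i. (norm (annihilation i j x))\<^sup>2)
      = cinner (ell2_restrict {\<beta>. \<beta> i \<noteq> []} x) (ell2_restrict {\<beta>. \<beta> i \<noteq> []} x)"
    unfolding of_real_sum cinner_self[symmetric] sum_annihilation_cinner[where n = n, OF x i]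
    by (simp add: cinner_restrict_left restrict_restrict)
  then have "(\<Sum>j=1..n i. (norm (annihilation i j x))\<^sup>2) = (norm (ell2_restrict {\<beta>. \<beta> i \<noteq> []} x))\<^sup>2"
    unfolding cinner_self of_real_eq_iff .
  also have "\<dots> \<le> (norm x)\<^sup>2" by (intro power_mono norm_restrict_le) simp
  finally show ?thesis .
qed

lemma rearrangements_remove:
  assumes i: "i \<in> {1..k}"
  shows "\<beta>(i := j # \<beta> i) \<in> rearrangements k \<mu>
    \<longleftrightarrow> j \<in># \<mu> i \<and> \<beta> \<in> rearrangements k (\<mu>(i := \<mu> i - {#j#}))"
proof -
  have "\<beta>(i := j # \<beta> i) \<in> extensional {1..k} \<longleftrightarrow> \<beta> \<in> extensional {1..k}"
    using i by (auto simp: extensional_def)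
  moreover have "add_mset j (mset (\<beta> i)) = \<mu> i \<longleftrightarrow> j \<in># \<mu> i \<and> mset (\<beta> i) = \<mu> i - {#j#}"
    by (metis add_mset_remove_trivial insert_DiffM union_single_eq_member)
  ultimately show ?thesis using i unfolding rearrangements_iff by auto
qed

text \<open>Among the rearrangements of \<mu> i the fraction count / size begins with j.\<close>

lemma card_rearrangements_remove:
  assumes i: "i \<in> {1..k}" and j: "j \<in># \<mu> i"
  shows "real (card (rearrangements k (\<mu>(i := \<mu> i - {#j#}))))
    = real (card (rearrangements k \<mu>)) * (real (count (\<mu> i) j) / real (size (\<mu> i)))"
proof -
  let ?p = "\<lambda>A :: nat multiset. real (card (permutations_of_multiset A))"
  have card: "real (card (rearrangements k \<nu>)) = ?p (\<nu> i) * (\<Prod>l\<in>{1..k} - {i}. ?p (\<nu> l))" for \<nu>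
    unfolding rearrangements_def using i by (simp add: card_PiE prod.remove)
  have "(\<Prod>l\<in>{1..k} - {i}. ?p ((\<mu>(i := \<mu> i - {#j#})) l)) = (\<Prod>l\<in>{1..k} - {i}. ?p (\<mu> l))"
    by (rule prod.cong) auto
  then show ?thesis
    unfolding card by (simp add: real_card_permutations_of_multiset_remove[OF j])
qed

text \<open>Deleting a leading j from the rearrangements of \<mu> leaves those of the smaller
  content, and the two normalizations differ by the root of the ratio of their numbers. If j does
  not occur, both sides vanish.\<close>

lemma annihilation_sym_vec:
  assumes i: "i \<in> {1..k}"
  shows "annihilation i j (sym_vec k \<mu> b)
    = complex_of_real (sqrt (real (count (\<mu> i) j) / real (size (\<mu> i)))) *\<^sub>C sym_vec k (\<mu>(i := \<mu> i - {#j#})) b"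
proof (cases "j \<in># \<mu> i")
  case True
  define c where "c = real (card (rearrangements k \<mu>))"
  define r where "r = real (count (\<mu> i) j) / real (size (\<mu> i))"
  have c: "c > 0" using card_rearrangements_pos[of k \<mu>] by (simp add: c_def)
  have "0 < count (\<mu> i) j" using True by simp
  then have r: "r > 0" using count_le_size[of "\<mu> i" j] unfolding r_def
    by (intro divide_pos_pos) linarith+
  have "1 / sqrt c = sqrt r * (1 / sqrt (c * r))" using c r by (simp add: real_sqrt_mult)
  then have eq: "complex_of_real (1 / sqrt c) = complex_of_real (sqrt r) * complex_of_real (1 / sqrt (c * r))"
    by (simp only: of_real_mult)
  show ?thesis
  proof (rule ell2_eqI)
    fix \<beta>
    show "coord (annihilation i j (sym_vec k \<mu> b)) \<beta> = coord (complex_of_real (sqrt (real (count (\<mu> i) j)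
        / real (size (\<mu> i)))) *\<^sub>C sym_vec k (\<mu>(i := \<mu> i - {#j#})) b) \<beta>"
      unfolding coord_annihilation coord_sym_vec coord_simps rearrangements_remove[OF i]
        card_rearrangements_remove[of i k j \<mu>, OF i True] c_def[symmetric] r_def[symmetric] eq
      using True by (simp add: scaleC_scaleC cvec.scale_zero_right)
  qed
next
  case False
  then have "annihilation i j (sym_vec k \<mu> b) = 0"
    by (intro ell2_eqI) (simp add: coord_annihilation coord_sym_vec rearrangements_remove[OF i])
  then show ?thesis using False by (simp add: not_in_iff cvec.scale_zero_left)
qed

lemma multi_types_upd:
  assumes "i \<in> {1..k}" "j \<in> {1..n i}"
  shows "\<nu>(i := add_mset j (\<nu> i)) \<in> multi_types k n (q(i := Suc (q i))) \<longleftrightarrow> \<nu> \<in> multi_types k n q"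
proof -
  have "\<nu>(i := add_mset j (\<nu> i)) \<in> extensional {1..k} \<longleftrightarrow> \<nu> \<in> extensional {1..k}"
    using assms(1) by (auto simp: extensional_def)
  moreover have "(\<nu>(i := add_mset j (\<nu> i))) l \<in> multisets_of_size {1..n l} ((q(i := Suc (q i))) l)
      \<longleftrightarrow> \<nu> l \<in> multisets_of_size {1..n l} (q l)" for l
    using assms(2) by (auto simp: multisets_of_size_def)
  ultimately show ?thesis unfolding multi_types_def PiE_iff by blast
qed

lemma sum_count_multi_type:
  assumes i: "i \<in> {1..k}" and \<mu>: "\<mu> \<in> multi_types k n q"
  shows "(\<Sum>j=1..n i. real (count (\<mu> i) j)) = real (q i)"
proof -
  note * = multi_typesD[OF \<mu> i]
  have "(\<Sum>j=1..n i. count (\<mu> i) j) = (\<Sum>j\<in>set_mset (\<mu> i). count (\<mu> i) j)"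
    using *(1) by (intro sum.mono_neutral_right) (auto simp: not_in_iff)
  then show ?thesis using *(2) by (simp add: size_multiset_overloaded_eq of_nat_sum[symmetric] del: of_nat_sum)
qed

text \<open>Double counting: a content of the higher degree with a letter j in it corresponds to a
  content \<nu> of degree q with an arbitrary letter j. The weight becomes
  \<open>count (\<nu> i) j + 1\<close> over q i + 1, and the numerators sum to q i + n i.\<close>

lemma sum_multi_types_remove:
  fixes g :: "(nat \<Rightarrow> nat multiset) \<Rightarrow> real"
  assumes i: "i \<in> {1..k}"
  shows "(\<Sum>\<mu>\<in>multi_types k n (q(i := Suc (q i))). \<Sum>j=1..n i.
      real (count (\<mu> i) j) / real (Suc (q i)) * g (\<mu>(i := \<mu> i - {#j#})))
    = real (q i + n i) / real (Suc (q i)) * (\<Sum>\<nu>\<in>multi_types k n q. g \<nu>)"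
proof -
  let ?q' = "q(i := Suc (q i))"
  define G where "G = (\<lambda>(\<mu> :: nat \<Rightarrow> nat multiset, j). real (count (\<mu> i) j) / real (Suc (q i)) * g (\<mu>(i := \<mu> i - {#j#})))"
  let ?S = "{p \<in> multi_types k n ?q' \<times> {1..n i}. snd p \<in># fst p i}"
  have bij: "bij_betw (\<lambda>(\<nu>, j). (\<nu>(i := add_mset j (\<nu> i)), j)) (multi_types k n q \<times> {1..n i}) ?S"
  proof (rule bij_betw_byWitness[where f' = "\<lambda>(\<mu>, j). (\<mu>(i := \<mu> i - {#j#}), j)"])
    show "(\<lambda>(\<nu>, j). (\<nu>(i := add_mset j (\<nu> i)), j)) ` (multi_types k n q \<times> {1..n i}) \<subseteq> ?S"
    proof
      fix p assume "p \<in> (\<lambda>(\<nu>, j). (\<nu>(i := add_mset j (\<nu> i)), j)) ` (multi_types k n q \<times> {1..n i})"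
      then obtain \<nu> j where "\<nu> \<in> multi_types k n q" "j \<in> {1..n i}" "p = (\<nu>(i := add_mset j (\<nu> i)), j)"
        by auto
      then show "p \<in> ?S" using multi_types_upd[OF i, of j n \<nu> q] by simp
    qed
    show "(\<lambda>(\<mu>, j). (\<mu>(i := \<mu> i - {#j#}), j)) ` ?S \<subseteq> multi_types k n q \<times> {1..n i}"
    proof
      fix p assume "p \<in> (\<lambda>(\<mu>, j). (\<mu>(i := \<mu> i - {#j#}), j)) ` ?S"
      then obtain \<mu> j where *: "\<mu> \<in> multi_types k n ?q'" "j \<in> {1..n i}" "j \<in># \<mu> i"
        and p: "p = (\<mu>(i := \<mu> i - {#j#}), j)" by auto
      have "(\<mu>(i := \<mu> i - {#j#}))(i := add_mset j ((\<mu>(i := \<mu> i - {#j#})) i)) = \<mu>"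
        using *(3) by simp
      then have "\<mu>(i := \<mu> i - {#j#}) \<in> multi_types k n q"
        using multi_types_upd[of i k j n, OF i *(2), of "\<mu>(i := \<mu> i - {#j#})" q] *(1) by (simp only:)
      then show "p \<in> multi_types k n q \<times> {1..n i}" using *(2) by (simp only: p mem_Times_iff fst_conv snd_conv)
    qed
  qed auto
  have "(\<Sum>\<mu>\<in>multi_types k n ?q'. \<Sum>j=1..n i.
      real (count (\<mu> i) j) / real (Suc (q i)) * g (\<mu>(i := \<mu> i - {#j#})))
      = (\<Sum>p\<in>multi_types k n ?q' \<times> {1..n i}. G p)"
    by (simp add: sum.cartesian_product G_def)
  \<comment> \<open>Pairs whose letter does not occur carry weight 0.\<close>
  also have "\<dots> = (\<Sum>p\<in>?S. G p)"
    by (rule sum.mono_neutral_right) (auto simp: finite_multi_types G_def not_in_iff)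
  also have "\<dots> = (\<Sum>p\<in>multi_types k n q \<times> {1..n i}. G (case p of (\<nu>, j) \<Rightarrow> (\<nu>(i := add_mset j (\<nu> i)), j)))"
    by (rule sum.reindex_bij_betw[OF bij, symmetric])
  also have "\<dots> = (\<Sum>\<nu>\<in>multi_types k n q. \<Sum>j=1..n i. real (Suc (count (\<nu> i) j)) / real (Suc (q i)) * g \<nu>)"
    unfolding sum.cartesian_product by (rule sum.cong) (auto simp: G_def)
  also have "\<dots> = (\<Sum>\<nu>\<in>multi_types k n q. real (q i + n i) / real (Suc (q i)) * g \<nu>)"
  proof (rule sum.cong)
    fix \<nu> assume "\<nu> \<in> multi_types k n q"
    from sum_count_multi_type[OF i this]
    have "(\<Sum>j=1..n i. real (Suc (count (\<nu> i) j))) = real (q i + n i)" by (simp add: sum.distrib)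
    then show "(\<Sum>j=1..n i. real (Suc (count (\<nu> i) j)) / real (Suc (q i)) * g \<nu>)
        = real (q i + n i) / real (Suc (q i)) * g \<nu>"
      by (simp only: sum_distrib_right[symmetric] sum_divide_distrib[symmetric])
  qed simp
  finally show ?thesis by (simp only: sum_distrib_left)
qed

text \<open>The case g = 1 of the double count; its factor is the one by which the trace grows at
  least.\<close>

lemma card_multi_types_Suc:
  assumes i: "i \<in> {1..k}"
  shows "real (card (multi_types k n (q(i := Suc (q i)))))
    = real (q i + n i) / real (Suc (q i)) * real (card (multi_types k n q))"
proof -
  have "(\<Sum>j=1..n i. real (count (\<mu> i) j) / real (Suc (q i)) * 1) = 1"
    if "\<mu> \<in> multi_types k n (q(i := Suc (q i)))" for \<mu>
    using sum_count_multi_type[OF i that] by (simp add: sum_divide_distrib[symmetric])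
  then show ?thesis using sum_multi_types_remove[OF i, where g = "\<lambda>_. 1" and q = q and n = n] by simp
qed

text \<open>Invariance under the shifts is expressed by their adjoints, which have a simple formula in
  coordinates.\<close>

locale invariant_subspace =
  fixes k :: nat and n :: "nat \<Rightarrow> nat" and M :: "(nat \<Rightarrow> nat list, 'e::chilbert_space) ell2 set"
  assumes closed_M: "closed_csubspace M" and M_subset: "M \<subseteq> fock_tensor k n UNIV"
    and coinvariant: "\<And>x i j. x \<in> orth_compl_in (fock_tensor k n UNIV) M \<Longrightarrow> i \<in> {1..k} \<Longrightarrow> j \<in> {1..n i} \<Longrightarrow>
      annihilation i j x \<in> orth_compl_in (fock_tensor k n UNIV) M"
begin

abbreviation "F \<equiv> fock_tensor k n (UNIV :: 'e set)"
abbreviation "N \<equiv> orth_compl_in F M"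

lemma closed_F: "closed_csubspace F" by (rule closed_csubspace_fock_tensor)

lemma closed_N: "closed_csubspace N" by (rule closed_csubspace_orth_compl_in[OF closed_F])

lemma N_subset: "N \<subseteq> F" by (auto simp: orth_compl_in_def)

lemma orth_proj_N: "orth_proj N x = orth_proj F x - orth_proj M x"
  by (rule orth_proj_orth_compl_in[OF closed_F closed_M M_subset])

text \<open>The step \<open>\<Sum>\<^sub>j B\<^sub>i\<^sub>j P\<^sub>M B\<^sub>i\<^sub>j\<^sup>* \<le> P\<^sub>M\<close>: on the complement the annihilation operators do not lead back
  to \<open>M\<close>, and they form a row contraction.\<close>

lemma sum_norm_proj_annihilation_le:
  assumes x: "x \<in> F" and i: "i \<in> {1..k}"
  shows "(\<Sum>j=1..n i. (norm (orth_proj M (annihilation i j x)))\<^sup>2) \<le> (norm (orth_proj M x))\<^sup>2"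
proof -
  define y where "y = orth_proj M x"
  have y: "y \<in> F" using orth_proj_in[OF closed_M, of x] M_subset by (auto simp: y_def)
  have xy: "x - y \<in> N"
    using orth_proj_in[OF closed_N, of x] orth_proj_ident[OF closed_F x] by (simp add: orth_proj_N y_def)
  have "norm (orth_proj M (annihilation i j x)) \<le> norm (annihilation i j y)" if "j \<in> {1..n i}" for j
  proof -
    have "orth_proj M (annihilation i j (x - y)) = 0"
      using coinvariant[OF xy i that]
      by (intro orth_proj_eq_zero[OF closed_M]) (simp add: orth_compl_in_def)
    then have "orth_proj M (annihilation i j x) = orth_proj M (annihilation i j y)"
      by (simp add: bounded_clinearD[OF bounded_clinear_orth_proj[OF closed_M]]
          bounded_clinearD[OF bounded_clinear_annihilation])
    then show ?thesis by (simp add: norm_orth_proj_le[OF closed_M])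
  qed
  then have "(\<Sum>j=1..n i. (norm (orth_proj M (annihilation i j x)))\<^sup>2)
      \<le> (\<Sum>j=1..n i. (norm (annihilation i j y))\<^sup>2)"
    by (intro sum_mono power_mono) auto
  also have "\<dots> \<le> (norm y)\<^sup>2" by (rule sum_norm_annihilation_le[OF y i])
  finally show ?thesis by (simp add: y_def)
qed

text \<open>The contraction inequality is applied to each basis vector of the higher degree.
  Annihilation turns these into multiples of basis vectors of degree q, whose total multiplicity is
  the double count.\<close>

lemma proj_weight_Suc_ge:
  assumes i: "i \<in> {1..k}" and B: "finite_onb B"
  shows "real (q i + n i) / real (Suc (q i)) * proj_weight k n M B q \<le> proj_weight k n M B (q(i := Suc (q i)))"
proof -
  let ?q' = "q(i := Suc (q i))"
  define g where "g b \<mu> = (norm (orth_proj M (sym_vec k \<mu> b)))\<^sup>2" for b \<mu>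
  have w: "proj_weight k n M B p = (\<Sum>b\<in>B. \<Sum>\<mu>\<in>multi_types k n p. g b \<mu>)" for p
    unfolding proj_weight_def g_def sum.cartesian_product[symmetric] by (rule sum.swap)
  have le: "real (q i + n i) / real (Suc (q i)) * (\<Sum>\<nu>\<in>multi_types k n q. g b \<nu>)
      \<le> (\<Sum>\<mu>\<in>multi_types k n ?q'. g b \<mu>)" for b
    unfolding sum_multi_types_remove[OF i, symmetric]
  proof (rule sum_mono)
    fix \<mu> assume \<mu>: "\<mu> \<in> multi_types k n ?q'"
    have size: "size (\<mu> i) = Suc (q i)" using multi_typesD(2)[OF \<mu> i] by simp
    have "real (count (\<mu> i) j) / real (Suc (q i)) * g b (\<mu>(i := \<mu> i - {#j#}))
        = (norm (orth_proj M (annihilation i j (sym_vec k \<mu> b))))\<^sup>2" for j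
      unfolding annihilation_sym_vec[OF i] bounded_clinearD(2)[OF bounded_clinear_orth_proj[OF closed_M]]
        norm_scaleC g_def size power_mult_distrib by simp
    then show "(\<Sum>j=1..n i. real (count (\<mu> i) j) / real (Suc (q i)) * g b (\<mu>(i := \<mu> i - {#j#}))) \<le> g b \<mu>"
      using sum_norm_proj_annihilation_le[OF sym_vec_in_fock_tensor[OF \<mu>] i, of b] by (simp add: g_def)
  qed
  show ?thesis unfolding w sum_distrib_left[of _ _ B] using le by (rule sum_mono)
qed

lemma bounded_increasing_net_weight:
  assumes B: "finite_onb B" and n: "\<And>i. i \<in> {1..k} \<Longrightarrow> n i \<ge> 1"
  shows "bounded_increasing_net k (\<lambda>q. proj_weight k n M B q / real (card (multi_types k n q))) (real (card B))"
proof
  have card: "real (card (multi_types k n q)) > 0" for q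
    unfolding card_multi_types of_nat_prod
    by (intro prod_pos) (use card_multisets_of_size_pos n in simp)
  fix q assume "q \<in> multi_indices k"
  show "0 \<le> proj_weight k n M B q / real (card (multi_types k n q))"
    by (auto simp: proj_weight_def intro!: divide_nonneg_nonneg sum_nonneg)
  \<comment> \<open>The upper bound comes from comparing M with F, whose weight is the dimension
    times \<open>card B\<close>.\<close>
  have "proj_weight k n M B q \<le> proj_weight k n F B q"
    unfolding proj_weight_def
  proof (rule sum_mono, clarify)
    fix \<mu> b assume "\<mu> \<in> multi_types k n q"
    then show "(norm (orth_proj M (sym_vec k \<mu> b)))\<^sup>2 \<le> (norm (orth_proj F (sym_vec k \<mu> b)))\<^sup>2"
      by (intro power_mono) (simp_all add: orth_proj_ident[OF closed_F sym_vec_in_fock_tensor]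
          norm_orth_proj_le[OF closed_M])
  qed
  then show "proj_weight k n M B q / real (card (multi_types k n q)) \<le> real (card B)"
    using card[of q] by (simp add: proj_weight_fock_tensor[OF B] pos_divide_le_eq mult.commute)
  fix i assume i: "i \<in> {1..k}"
  define r where "r = real (q i + n i) / real (Suc (q i))"
  have r: "r > 0" using n[OF i] by (simp add: r_def)
  have "proj_weight k n M B q / real (card (multi_types k n q))
      = (r * proj_weight k n M B q) / (r * real (card (multi_types k n q)))" using r by simp
  also have "\<dots> \<le> proj_weight k n M B (q(i := Suc (q i))) / (r * real (card (multi_types k n q)))"
    using r proj_weight_Suc_ge[OF i B, of q] by (intro divide_right_mono) (auto simp: r_def)
  also have "r * real (card (multi_types k n q)) = real (card (multi_types k n (q(i := Suc (q i)))))"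
    by (simp only: card_multi_types_Suc[OF i] r_def)
  finally show "proj_weight k n M B q / real (card (multi_types k n q))
      \<le> proj_weight k n M B (q(i := Suc (q i))) / real (card (multi_types k n (q(i := Suc (q i)))))" .
qed

end

section \<open>Compression to a coinvariant subspace\<close>

lemma shift_op_adjoint:
  assumes "closed_csubspace D" "i \<in> {1..k}" "j \<in> {1..n i}"
  shows "cinner (shift_op k n i j D x) y = cinner x (annihilation i j (orth_proj (fock_tensor k n D) y))"
    and "bounded_clinear (shift_op k n i j D)"
  unfolding shift_op_eq[of D i k j n, OF assms]
  by (rule cadjoint_left bounded_clinear_cadjoint;
      rule bounded_clinear_compose[OF bounded_clinear_annihilation
        bounded_clinear_orth_proj[OF closed_csubspace_fock_tensor]])+

text \<open>In different factors the deletions act on different components. In one factor the two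
  words differ in the order of their first two letters, which a symmetric family does not
  see.\<close>

lemma annihilation_commute:
  assumes x: "x \<in> fock_tensor k n UNIV" and "i \<in> {1..k}" "j \<in> {1..n i}" "i' \<in> {1..k}" "j' \<in> {1..n i'}"
  shows "annihilation i j (annihilation i' j' x) = annihilation i' j' (annihilation i j x)"
proof (rule ell2_eqI)
  fix \<beta> :: "nat \<Rightarrow> nat list"
  have x': "x \<in> sym_family k n UNIV" using x by (simp add: fock_tensor_eq[OF closed_csubspace_UNIV])
  show "coord (annihilation i j (annihilation i' j' x)) \<beta> = coord (annihilation i' j' (annihilation i j x)) \<beta>"
  proof (cases "i = i'")
    case True
    define \<gamma> where "\<gamma> = \<beta>(i := j' # j # \<beta> i)"
    define \<gamma>' where "\<gamma>' = \<beta>(i := j # j' # \<beta> i)"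
    have "\<gamma> \<in> extensional {1..k} \<longleftrightarrow> \<gamma>' \<in> extensional {1..k}"
      using assms(2) by (auto simp: extensional_def \<gamma>_def \<gamma>'_def)
    moreover have "set (\<gamma> l) = set (\<gamma>' l)" for l by (auto simp: \<gamma>_def \<gamma>'_def)
    ultimately have w: "\<gamma> \<in> words k n \<longleftrightarrow> \<gamma>' \<in> words k n" unfolding words_iff by simp
    have "mset (\<gamma> l) = mset (\<gamma>' l)" for l by (simp add: \<gamma>_def \<gamma>'_def add_mset_commute)
    then have "coord x \<gamma> = coord x \<gamma>'"
      using sym_familyD(3)[OF x', of \<gamma> \<gamma>'] sym_familyD(1)[OF x'] w by (cases "\<gamma> \<in> words k n") auto
    then show ?thesis using True by (simp add: coord_annihilation \<gamma>_def \<gamma>'_def)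
  qed (simp add: coord_annihilation fun_upd_twist)
qed

text \<open>The projection onto the vectors that are vacuum in the factors of S.\<close>

definition restrict_empty ::
    "nat set \<Rightarrow> (nat \<Rightarrow> nat list, 'e::chilbert_space) ell2 \<Rightarrow> (nat \<Rightarrow> nat list, 'e) ell2" where
  "restrict_empty S = ell2_restrict {\<beta>. \<forall>i\<in>S. \<beta> i = []}"

definition empty_words :: "nat \<Rightarrow> nat \<Rightarrow> nat list" where
  "empty_words k = (\<lambda>i\<in>{1..k}. [])"

lemma restrict_empty_eq_single:
  assumes "x \<in> fock_tensor k n UNIV"
  shows "restrict_empty {1..k} x = single (empty_words k) (coord x (empty_words k))"
proof (rule ell2_eqI)
  fix \<beta>
  show "coord (restrict_empty {1..k} x) \<beta> = coord (single (empty_words k) (coord x (empty_words k))) \<beta>"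
  proof (cases "coord x \<beta> = 0")
    case False
    then have "\<beta> \<in> words k n"
      using sym_familyD(1)[of x k n UNIV \<beta>] assms by (auto simp: fock_tensor_eq[OF closed_csubspace_UNIV])
    then have "(\<forall>i\<in>{1..k}. \<beta> i = []) \<longleftrightarrow> \<beta> = empty_words k"
      unfolding words_iff empty_words_def by (auto simp: extensional_def fun_eq_iff)
    then show ?thesis by (auto simp: restrict_empty_def ell2_restrict.rep_eq single.rep_eq)
  qed (auto simp: restrict_empty_def ell2_restrict.rep_eq single.rep_eq empty_words_def)
qed

lemma cinner_single_left: "cinner (single i v) x = cinner v (coord x i)"
  by (metis cinner_commute cinner_single_right)

text \<open>Taking adjoints reverses a product, so the first letter of the word is deleted first;
  hence \<open>fold\<close>.\<close>

definition word_annihilation ::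
    "nat \<Rightarrow> nat list \<Rightarrow> (nat \<Rightarrow> nat list, 'e::chilbert_space) ell2 \<Rightarrow> (nat \<Rightarrow> nat list, 'e) ell2" where
  "word_annihilation i \<alpha> x = fold (annihilation i) \<alpha> x"

lemma coord_word_annihilation: "coord (word_annihilation i \<alpha> x) \<beta> = coord x (\<beta>(i := \<alpha> @ \<beta> i))"
  unfolding word_annihilation_def
  by (induction \<alpha> arbitrary: x) (simp_all add: coord_annihilation)

context invariant_subspace
begin

abbreviation "T \<equiv> compression k n N"

lemma orth_proj_N_annihilation:
  assumes "i \<in> {1..k}" "j \<in> {1..n i}"
  shows "annihilation i j (orth_proj N x) \<in> N"
    "orth_proj N (annihilation i j (orth_proj N x)) = annihilation i j (orth_proj N x)"
  using coinvariant[OF orth_proj_in[OF closed_N] assms] orth_proj_ident[OF closed_N] by auto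

text \<open>Coinvariance absorbs the outer projection, so the adjoint of the compression is plain
  annihilation on N.\<close>

lemma cinner_T:
  assumes ij: "i \<in> {1..k}" "j \<in> {1..n i}"
  shows "cinner (T i j x) y = cinner x (annihilation i j (orth_proj N y))"
proof -
  have NF: "orth_proj N y \<in> F" using orth_proj_in[OF closed_N] N_subset by blast
  have "cinner (T i j x) y = cinner (orth_proj N x) (annihilation i j (orth_proj N y))"
    by (simp add: compression_def orth_proj_selfadjoint[OF closed_N]
        shift_op_adjoint(1)[of UNIV i k j n, OF closed_csubspace_UNIV ij] orth_proj_ident[OF closed_F NF])
  then show ?thesis by (simp add: orth_proj_selfadjoint[OF closed_N] orth_proj_N_annihilation[OF ij])
qed

lemma cadjoint_T:
  assumes "i \<in> {1..k}" "j \<in> {1..n i}"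
  shows "cadjoint (T i j) = (\<lambda>y. annihilation i j (orth_proj N y))"
  by (rule cadjoint_eqI) (rule cinner_T[OF assms])

lemma T_in_bop:
  assumes ij: "i \<in> {1..k}" "j \<in> {1..n i}"
  shows "T i j \<in> bop N N"
  unfolding bop_def
proof (intro CollectI conjI ballI)
  show "bounded_clinear (T i j)"
    unfolding compression_def o_def
    by (intro bounded_clinear_compose[OF bounded_clinear_orth_proj[OF closed_N]]
        bounded_clinear_compose[OF shift_op_adjoint(2)[of UNIV i k j n, OF closed_csubspace_UNIV ij]]
        bounded_clinear_orth_proj[OF closed_N])
  show "range (T i j) \<subseteq> N" using orth_proj_in[OF closed_N] by (auto simp: compression_def)
  fix x assume "x \<in> orth_compl_in UNIV N"
  then have "cinner x (annihilation i j (orth_proj N z)) = 0" for z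
    using orth_proj_N_annihilation(1)[OF ij, of z] by (simp add: orth_compl_in_def)
  then show "T i j x = 0" by - (rule cinner_eqI, simp add: cinner_T[OF ij])
qed

lemma T_commute:
  assumes ij: "i \<in> {1..k}" "j \<in> {1..n i}" and ij': "i' \<in> {1..k}" "j' \<in> {1..n i'}"
  shows "T i j \<circ> T i' j' = T i' j' \<circ> T i j"
proof
  fix x
  have "orth_proj N z \<in> F" for z using orth_proj_in[OF closed_N] N_subset by blast
  then show "(T i j \<circ> T i' j') x = (T i' j' \<circ> T i j) x"
    by - (rule cinner_eqI, simp add: cinner_T[OF ij] cinner_T[OF ij'] orth_proj_N_annihilation[OF ij]
        orth_proj_N_annihilation[OF ij'] annihilation_commute[where k = k and n = n, OF _ ij ij'])
qed

text \<open>Subtracting Phi for factor i removes the part with nonempty i-th word, which adds i to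
  the set S of factors where only the vacuum survives. General exponents and lists let one induction
  serve the positivity conditions and the defect operator.\<close>

lemma cinner_defect_foldr:
  assumes "\<And>i. i \<in> set is \<Longrightarrow> p i = 0 \<or> p i = (1 :: nat)" "distinct is" "set is \<subseteq> {1..k}"
  shows "cinner (foldr (\<lambda>i. (\<lambda>Y x. Y x - Phi_map (n i) (T i) Y x) ^^ p i) is (orth_proj N) x) y
    = cinner (restrict_empty {i \<in> set is. p i = 1} (orth_proj N x)) (orth_proj N y)"
  using assms
proof (induction "is" arbitrary: x y)
  case Nil
  have "restrict_empty {} z = z" for z :: "(nat \<Rightarrow> nat list, 'e) ell2"
    by (rule ell2_eqI) (simp add: restrict_empty_def ell2_restrict.rep_eq)
  then show ?case
    by (simp add: orth_proj_selfadjoint[OF closed_N] orth_proj_ident[OF closed_N orth_proj_in[OF closed_N]])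
next
  case (Cons i "is")
  define Y where "Y = foldr (\<lambda>i. (\<lambda>Y x. Y x - Phi_map (n i) (T i) Y x) ^^ p i) is (orth_proj N)"
  define S where "S = {i \<in> set is. p i = 1}"
  have i: "i \<in> {1..k}" "i \<notin> S" using Cons.prems by (auto simp: S_def)
  have Y: "cinner (Y x) y = cinner (restrict_empty S (orth_proj N x)) (orth_proj N y)" for x y
    unfolding Y_def S_def using Cons.prems by (intro Cons.IH) auto
  show ?case
  proof (cases "p i = 0")
    case True
    then have "{l \<in> set (i # is). p l = 1} = S" by (auto simp: S_def)
    then show ?thesis using True Y[of x y] by (simp add: Y_def)
  next
    case False
    then have pi: "p i = 1" using Cons.prems(1)[of i] by simp
    then have S: "{l \<in> set (i # is). p l = 1} = insert i S" by (auto simp: S_def)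
    define a where "a = orth_proj N x"
    define b where "b = orth_proj N y"
    have aF: "a \<in> F" using orth_proj_in[OF closed_N] N_subset by (auto simp: a_def)
    \<comment> \<open>Prepending in factor i leaves emptiness in the factors of S unchanged, as i is
      not in S.\<close>
    have comm: "restrict_empty S (annihilation i j z) = annihilation i j (restrict_empty S z)"
      for j and z :: "(nat \<Rightarrow> nat list, 'e) ell2"
    proof (rule ell2_eqI)
      fix \<beta> :: "nat \<Rightarrow> nat list"
      have "(\<forall>l\<in>S. (\<beta>(i := j # \<beta> i)) l = []) \<longleftrightarrow> (\<forall>l\<in>S. \<beta> l = [])"
        using i(2) by (intro ball_cong refl) auto
      then show "coord (restrict_empty S (annihilation i j z)) \<beta> = coord (annihilation i j (restrict_empty S z)) \<beta>"
        by (simp only: restrict_empty_def ell2_restrict.rep_eq coord_annihilation mem_Collect_eq)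
    qed
    have summand: "cinner (T i j (Y (cadjoint (T i j) x))) y
        = cinner (annihilation i j a) (annihilation i j (restrict_empty S b))" if j: "j \<in> {1..n i}" for j
    proof -
      have "cinner (T i j (Y (cadjoint (T i j) x))) y
          = cinner (restrict_empty S (annihilation i j a)) (annihilation i j b)"
        by (simp add: cinner_T[OF i(1) j] cadjoint_T[OF i(1) j] Y orth_proj_N_annihilation(2)[OF i(1) j] a_def b_def)
      also have "\<dots> = cinner (annihilation i j a) (restrict_empty S (annihilation i j b))"
        unfolding restrict_empty_def by (rule cinner_restrict_left)
      finally show ?thesis unfolding comm .
    qed
    have "cinner (Phi_map (n i) (T i) Y x) y
        = (\<Sum>j=1..n i. cinner (annihilation i j a) (annihilation i j (restrict_empty S b)))"
      unfolding Phi_map_def cinner_sum_left by (rule sum.cong) (simp_all only: summand)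
    also have "\<dots> = cinner (ell2_restrict {\<beta>. \<beta> i \<noteq> []} a) (restrict_empty S b)"
      by (rule sum_annihilation_cinner[OF aF i(1)])
    also have "\<dots> = cinner (restrict_empty S (ell2_restrict {\<beta>. \<beta> i \<noteq> []} a)) b"
      by (simp add: restrict_empty_def cinner_restrict_left)
    finally have "cinner (Y x - Phi_map (n i) (T i) Y x) y
        = cinner (restrict_empty S a - restrict_empty S (ell2_restrict {\<beta>. \<beta> i \<noteq> []} a)) b"
      by (simp add: cinner_diff_left Y a_def b_def)
    also have "restrict_empty S a - restrict_empty S (ell2_restrict {\<beta>. \<beta> i \<noteq> []} a)
        = restrict_empty (insert i S) a"
      by (rule ell2_eqI) (simp add: restrict_empty_def ell2_restrict.rep_eq)
    finally show ?thesis unfolding S using pi by (simp add: Y_def a_def b_def)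
  qed
qed

text \<open>Each defect is a diagonal projection compressed to N, so its quadratic form is a squared
  norm.\<close>

lemma T_in_comm_polyball: "T \<in> comm_polyball k n N"
  unfolding comm_polyball_def
proof (intro CollectI conjI ballI)
  fix p :: "nat \<Rightarrow> nat" assume p: "p \<in> PiE {1..k} (\<lambda>_. {0, 1})"
  show "positive_op (defect_map k n T p (orth_proj N))"
    unfolding positive_op_def
  proof
    fix x
    define a where "a = restrict_empty {i \<in> set [1..<Suc k]. p i = 1} (orth_proj N x)"
    have "cinner (defect_map k n T p (orth_proj N) x) x = cinner a (orth_proj N x)"
      unfolding defect_map_def a_def using p by (intro cinner_defect_foldr) (auto simp: PiE_iff)
    also have "\<dots> = cinner a a"
      unfolding a_def restrict_empty_def by (simp only: cinner_restrict_left restrict_restrict Int_absorb)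
    finally show "cinner (defect_map k n T p (orth_proj N) x) x \<in> \<real>
        \<and> 0 \<le> Re (cinner (defect_map k n T p (orth_proj N) x) x)"
      by (simp add: cinner_self)
  qed
qed (use T_in_bop T_commute in blast)+

text \<open>The defect operator is \<open>P\<^sub>N P\<^sub>\<Omega> P\<^sub>N\<close> with \<open>P\<^sub>\<Omega>\<close> the projection onto the vacuum vectors.\<close>

definition "A = defect_op k n N T"

definition vac :: "(nat \<Rightarrow> nat list, 'e) ell2 \<Rightarrow> 'e" where
  "vac x = coord x (empty_words k)"

lemma bounded_clinear_vac: "bounded_clinear vac"
  unfolding vac_def by (rule bounded_clinear_coord)

lemma cinner_A_restrict: "cinner (A x) y = cinner (restrict_empty {1..k} (orth_proj N x)) (orth_proj N y)"
proof -
  have "{i \<in> set [1..<Suc k]. (1 :: nat) = 1} = {1..k}" by auto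
  then show ?thesis
    unfolding A_def defect_op_def defect_map_def
    using cinner_defect_foldr[of "[1..<Suc k]" "\<lambda>_. 1" x y] by (simp add: atLeastLessThanSuc_atLeastAtMost del: upt_Suc)
qed

lemma cinner_A: "cinner (A x) y = cinner (vac (orth_proj N x)) (vac (orth_proj N y))"
proof -
  have "orth_proj N x \<in> F" using orth_proj_in[OF closed_N] N_subset by blast
  from restrict_empty_eq_single[OF this] show ?thesis
    by (simp add: cinner_A_restrict cinner_single_left vac_def)
qed

lemma A_eq: "A x = orth_proj N (restrict_empty {1..k} (orth_proj N x))"
  by (rule cinner_eqI) (simp add: cinner_A_restrict orth_proj_selfadjoint[OF closed_N])

lemma bounded_clinear_A: "bounded_clinear A"
  unfolding A_eq[abs_def] restrict_empty_def
  by (intro bounded_clinear_compose[OF bounded_clinear_orth_proj[OF closed_N]]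
      bounded_clinear_compose[OF bounded_clinear_restrict] bounded_clinear_orth_proj[OF closed_N])

definition "R = op_sqrt A"

text \<open>The choice in \<open>op_sqrt\<close> is meaningful once a root exists. As A compresses a
  projection, the squared norm of A x is at most \<open>inner (A x) x\<close>, so I - A is a
  contraction and \<open>contraction_sqrt_exists\<close> applies to it.\<close>

lemma R: "bounded_clinear R" "positive_op R" "R (R x) = A x"
proof -
  have sa: "cinner (A x) y = cinner x (A y)" for x y
    by (subst (2) cinner_commute) (simp add: cinner_A cinner_commute[symmetric])
  have contr: "norm (x - A x) \<le> norm x" for x
  proof (rule power2_le_imp_le)
    define v where "v = restrict_empty {1..k} (orth_proj N x)"
    have "cinner (A x) x = cinner v v"
      unfolding cinner_A_restrict v_def restrict_empty_def
      by (simp only: cinner_restrict_left restrict_restrict Int_absorb)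
    then have "inner (A x) x = (norm v)\<^sup>2" by (simp add: inner_eq_Re_cinner cinner_self)
    moreover have "norm (A x) \<le> norm v" unfolding A_eq v_def by (rule norm_orth_proj_le[OF closed_N])
    then have "(norm (A x))\<^sup>2 \<le> (norm v)\<^sup>2" by (intro power_mono) auto
    moreover have "(norm (x - A x))\<^sup>2 = (norm x)\<^sup>2 - 2 * inner (A x) x + (norm (A x))\<^sup>2"
      by (simp add: power2_norm_eq_inner inner_diff_left inner_diff_right inner_commute)
    ultimately show "(norm (x - A x))\<^sup>2 \<le> (norm x)\<^sup>2" using zero_le_power2[of "norm v"] by linarith
  qed simp
  have "bounded_clinear (\<lambda>x. x - A x)"
    by (rule bounded_clinearI[where K = 1])
      (use contr in \<open>simp_all add: bounded_clinearD[OF bounded_clinear_A] cvec.scale_right_diff_distrib\<close>)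
  then obtain R' where "bounded_clinear R' \<and> positive_op R' \<and> R' \<circ> R' = (\<lambda>x. x - (x - A x))"
    using contraction_sqrt_exists[of "\<lambda>x. x - A x"] contr by (auto simp: cinner_diff_left cinner_diff_right sa)
  then have ex: "\<exists>R. bounded_clinear R \<and> positive_op R \<and> R \<circ> R = A" by auto
  have "bounded_clinear R \<and> positive_op R \<and> R \<circ> R = A"
    unfolding R_def op_sqrt_def by (rule someI_ex[OF ex])
  then show "bounded_clinear R" "positive_op R" "R (R x) = A x" by (auto simp: fun_eq_iff)
qed

lemmas R_lin = bounded_clinearD[OF R(1)]

text \<open>R is self-adjoint with square A. This is the isometry behind the intertwiner u
  below.\<close>

lemma cinner_R: "cinner (R x) (R y) = cinner (vac (orth_proj N x)) (vac (orth_proj N y))"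
  using positive_op_selfadjoint[OF R(1,2), of "R x" y] by (simp add: R(3) cinner_A[symmetric])

lemma R_eq_zero:
  assumes "vac (orth_proj N x) = 0" shows "R x = 0"
  using cinner_R[of x x] assms by simp

lemma R_orth_proj_N: "R (orth_proj N x) = R x"
proof -
  have "orth_proj N (x - orth_proj N x) = 0"
    by (simp add: bounded_clinearD[OF bounded_clinear_orth_proj[OF closed_N]]
        orth_proj_ident[OF closed_N orth_proj_in[OF closed_N]])
  then have "R (x - orth_proj N x) = 0"
    by (intro R_eq_zero) (simp add: bounded_clinearD[OF bounded_clinear_vac])
  then show ?thesis by (simp add: R_lin)
qed

lemma R_in_N: "R x \<in> N"
proof -
  have "orth_proj N (R x) = R x"
    by (rule cinner_eqI)
      (simp add: orth_proj_selfadjoint[OF closed_N] positive_op_selfadjoint[OF R(1,2)] R_orth_proj_N)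
  then show ?thesis using orth_proj_in[OF closed_N, of "R x"] by simp
qed

lemma word_annihilation_in_N:
  assumes "i \<in> {1..k}" "\<alpha> \<in> lists {1..n i}" "x \<in> N"
  shows "word_annihilation i \<alpha> x \<in> N"
  using assms(2,3) unfolding word_annihilation_def
  by (induction \<alpha> arbitrary: x) (use coinvariant[OF _ assms(1)] in auto)

lemma cadjoint_word_op:
  assumes i: "i \<in> {1..k}" and \<alpha>: "\<alpha> \<in> lists {1..n i}"
  shows "cadjoint (word_op N (T i) \<alpha>) = (\<lambda>y. word_annihilation i \<alpha> (orth_proj N y))"
proof (rule cadjoint_eqI)
  fix x y
  show "cinner (word_op N (T i) \<alpha> x) y = cinner x (word_annihilation i \<alpha> (orth_proj N y))"
    using \<alpha>
  proof (induction \<alpha> arbitrary: y)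
    case Nil
    then show ?case by (simp add: word_op_def word_annihilation_def orth_proj_selfadjoint[OF closed_N])
  next
    case (Cons j \<alpha>)
    then have j: "j \<in> {1..n i}" by simp
    have "cinner (word_op N (T i) (j # \<alpha>) x) y = cinner (T i j (word_op N (T i) \<alpha> x)) y"
      by (simp add: word_op_def)
    also have "\<dots> = cinner (word_op N (T i) \<alpha> x) (annihilation i j (orth_proj N y))"
      by (rule cinner_T[OF i j])
    also have "\<dots> = cinner x (word_annihilation i \<alpha> (annihilation i j (orth_proj N y)))"
      using Cons by (simp add: orth_proj_N_annihilation(2)[OF i j])
    finally show ?case by (simp add: word_annihilation_def)
  qed
qed

text \<open>Each adjoint begins with the projection onto N, which acts trivially since the running
  vector stays in N. What remains is deleting the prefix \<beta> i in every factor of the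
  list.\<close>

lemma foldr_word_annihilation:
  assumes "\<beta> \<in> words k n" "distinct is" "set is \<subseteq> {1..k}" "x \<in> N"
  shows "foldr (\<lambda>i x. cadjoint (word_op N (T i) (\<beta> i)) x) is x \<in> N \<and>
    (\<forall>\<gamma>. coord (foldr (\<lambda>i x. cadjoint (word_op N (T i) (\<beta> i)) x) is x) \<gamma>
      = coord x (\<lambda>i. if i \<in> set is then \<beta> i @ \<gamma> i else \<gamma> i))"
  using assms(2,3)
proof (induction "is")
  case Nil
  then show ?case using assms(4) by simp
next
  case (Cons i "is")
  define x' where "x' = foldr (\<lambda>i x. cadjoint (word_op N (T i) (\<beta> i)) x) is x"
  have x': "x' \<in> N" "\<And>\<gamma>. coord x' \<gamma> = coord x (\<lambda>l. if l \<in> set is then \<beta> l @ \<gamma> l else \<gamma> l)"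
    using Cons by (auto simp: x'_def)
  have i: "i \<in> {1..k}" "i \<notin> set is" using Cons.prems by auto
  have \<beta>: "\<beta> i \<in> lists {1..n i}" using assms(1) i(1) unfolding words_def PiE_iff by blast
  have eq: "foldr (\<lambda>i x. cadjoint (word_op N (T i) (\<beta> i)) x) (i # is) x = word_annihilation i (\<beta> i) x'"
    by (simp add: cadjoint_word_op[OF i(1) \<beta>] x'_def[symmetric] orth_proj_ident[OF closed_N x'(1)])
  have "coord (word_annihilation i (\<beta> i) x') \<gamma> = coord x (\<lambda>l. if l \<in> set (i # is) then \<beta> l @ \<gamma> l else \<gamma> l)" for \<gamma>
    unfolding coord_word_annihilation x'(2) using i(2) by (intro arg_cong[of _ _ "coord x"]) (auto simp: fun_eq_iff)
  then show ?case unfolding eq using word_annihilation_in_N[OF i(1) \<beta> x'(1)] by blast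
qed

text \<open>The adjoint applied first already contains the projection onto N; for an empty list
  nothing would be projected.\<close>

lemma foldr_word_op_orth_proj_N:
  assumes "\<beta> \<in> words k n" "is \<noteq> []" "set is \<subseteq> {1..k}"
  shows "foldr (\<lambda>i x. cadjoint (word_op N (T i) (\<beta> i)) x) is x
    = foldr (\<lambda>i x. cadjoint (word_op N (T i) (\<beta> i)) x) is (orth_proj N x)"
  using assms(2,3)
proof (induction "is")
  case (Cons i "is")
  show ?case
  proof (cases "is = []")
    case True
    have i: "i \<in> {1..k}" using Cons.prems by simp
    have "\<beta> i \<in> lists {1..n i}" using assms(1) i unfolding words_def PiE_iff by blast
    then show ?thesis using True
      by (simp add: cadjoint_word_op[OF i] orth_proj_ident[OF closed_N orth_proj_in[OF closed_N]])
  qed (use Cons in simp)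
qed simp

text \<open>Deleting all of \<beta> moves the coordinate at \<beta> to the vacuum.\<close>

lemma coord_eq_vac:
  assumes "\<beta> \<in> words k n" "x \<in> N"
  shows "vac (foldr (\<lambda>i x. cadjoint (word_op N (T i) (\<beta> i)) x) [1..<Suc k] x) = coord x \<beta>"
    "foldr (\<lambda>i x. cadjoint (word_op N (T i) (\<beta> i)) x) [1..<Suc k] x \<in> N"
proof -
  have "(\<lambda>i. if i \<in> set [1..<Suc k] then \<beta> i @ empty_words k i else empty_words k i) = \<beta>"
    using assms(1) by (auto simp: words_iff empty_words_def extensional_def fun_eq_iff)
  then show "vac (foldr (\<lambda>i x. cadjoint (word_op N (T i) (\<beta> i)) x) [1..<Suc k] x) = coord x \<beta>"
    "foldr (\<lambda>i x. cadjoint (word_op N (T i) (\<beta> i)) x) [1..<Suc k] x \<in> N"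
    using foldr_word_annihilation[OF assms(1), of "[1..<Suc k]" x] assms(2)
    by (simp_all add: vac_def atLeastLessThanSuc_atLeastAtMost del: upt_Suc)
qed

end

section \<open>Berezin kernel and characteristic function of the compression\<close>

lemma elem_tensor_ket:
  assumes "\<beta> \<in> extensional {1..k}"
  shows "elem_tensor k (\<lambda>i. ket (\<beta> i)) v = single \<beta> v"
proof (rule ell2_eqI)
  fix \<gamma>
  show "coord (elem_tensor k (\<lambda>i. ket (\<beta> i)) v) \<gamma> = coord (single \<beta> v) \<gamma>"
  proof (cases "\<gamma> \<in> extensional {1..k}")
    case True
    have "(\<Prod>i = 1..k. coord (ket (\<beta> i)) (\<gamma> i)) = (if \<forall>i\<in>{1..k}. \<gamma> i = \<beta> i then 1 else 0)"
      unfolding ket.rep_eq by (auto intro!: prod.neutral prod_zero)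
    also have "(\<forall>i\<in>{1..k}. \<gamma> i = \<beta> i) \<longleftrightarrow> \<gamma> = \<beta>"
      using True assms by (auto simp: extensional_def fun_eq_iff)
    finally have "(\<Prod>i = 1..k. coord (ket (\<beta> i)) (\<gamma> i)) = (if \<gamma> = \<beta> then 1 else 0)" .
    then show ?thesis using True
      by (simp add: elem_tensor.rep_eq single.rep_eq scaleC_one cvec.scale_zero_left)
  qed (use assms in \<open>auto simp: elem_tensor.rep_eq single.rep_eq\<close>)
qed

lemma map_coord_in_fock_tensor:
  assumes u: "bounded_clinear u" "range u \<subseteq> D" and x: "x \<in> fock_tensor k n UNIV" and D: "closed_csubspace D"
  shows "map_coord u x \<in> fock_tensor k n D"
  unfolding fock_tensor_eq[OF D]
proof (rule sym_familyI)
  have x': "x \<in> sym_family k n UNIV" using x by (simp add: fock_tensor_eq[OF closed_csubspace_UNIV])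
  show "coord (map_coord u x) \<beta> = 0" if "\<beta> \<notin> words k n" for \<beta>
    using sym_familyD(1)[OF x' that] by (simp add: map_coord.rep_eq u(1) bounded_clinearD(4)[OF u(1)])
  show "coord (map_coord u x) \<beta> \<in> D" for \<beta> using u by (auto simp: map_coord.rep_eq)
  show "coord (map_coord u x) \<beta> = coord (map_coord u x) \<gamma>"
    if "\<beta> \<in> words k n" "\<gamma> \<in> words k n" "\<forall>i\<in>{1..k}. mset (\<beta> i) = mset (\<gamma> i)" for \<beta> \<gamma>
    using sym_familyD(3)[OF x' that(1,2)] that(3) by (simp add: map_coord.rep_eq)
qed

lemma fock_tensor_mono: "D \<subseteq> D' \<Longrightarrow> closed_csubspace D \<Longrightarrow> closed_csubspace D' \<Longrightarrow>
    fock_tensor k n D \<subseteq> fock_tensor k n D'"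
  unfolding fock_tensor_eq sym_family_def by blast

lemma map_coord_annihilation: "map_coord u (annihilation i j x) = annihilation i j (map_coord u x)"
  by (rule ell2_eqI) (simp add: map_coord.rep_eq coord_annihilation)

text \<open>I \<otimes> u maps the full Fock space into the one with coefficients in D, so its
  adjoint sends the residual of the projection to vectors orthogonal to the full one.\<close>

lemma map_coord_adjoint_orth_proj:
  assumes u: "bounded_clinear u" "range u \<subseteq> D" and D: "closed_csubspace D"
  shows "map_coord (cadjoint u) (orth_proj (fock_tensor k n D) z)
    = orth_proj (fock_tensor k n UNIV) (map_coord (cadjoint u) z)"
proof (rule orth_proj_eqI[OF closed_csubspace_fock_tensor, symmetric])
  have "orth_proj (fock_tensor k n D) z \<in> fock_tensor k n UNIV"
    using orth_proj_in[OF closed_csubspace_fock_tensor] fock_tensor_mono[OF _ D closed_csubspace_UNIV] by blast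
  then show "map_coord (cadjoint u) (orth_proj (fock_tensor k n D) z) \<in> fock_tensor k n UNIV"
    by (intro map_coord_in_fock_tensor bounded_clinear_cadjoint u closed_csubspace_UNIV) auto
  fix y assume "y \<in> fock_tensor k n (UNIV :: 'a set)"
  then have "map_coord u y \<in> fock_tensor k n D" by (rule map_coord_in_fock_tensor[OF u _ D])
  then have "cinner (z - orth_proj (fock_tensor k n D) z) (map_coord u y) = 0"
    by (rule orth_proj_orth[OF closed_csubspace_fock_tensor])
  then have "cinner (map_coord u y) (z - orth_proj (fock_tensor k n D) z) = 0"
    by (simp only: cinner_zero_commute)
  then have "cinner y (map_coord (cadjoint u) z - map_coord (cadjoint u) (orth_proj (fock_tensor k n D) z)) = 0"
    by (simp add: cinner_map_coord[OF u(1)]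
        bounded_clinearD(5)[OF bounded_clinear_map_coord[OF bounded_clinear_cadjoint[OF u(1)]]])
  then show "cinner (map_coord (cadjoint u) z - map_coord (cadjoint u) (orth_proj (fock_tensor k n D) z)) y = 0"
    by (simp only: cinner_zero_commute)
qed

text \<open>Compared through adjoints, where annihilation acts on indices and u on coefficients, so
  that they commute.\<close>

lemma map_coord_shift_op:
  assumes u: "bounded_clinear u" "range u \<subseteq> D" and D: "closed_csubspace D" and ij: "i \<in> {1..k}" "j \<in> {1..n i}"
  shows "map_coord u (shift_op k n i j UNIV x) = shift_op k n i j D (map_coord u x)"
proof (rule cinner_eqI)
  fix z
  show "cinner (map_coord u (shift_op k n i j UNIV x)) z = cinner (shift_op k n i j D (map_coord u x)) z"
    by (simp add: cinner_map_coord[OF u(1)] shift_op_adjoint(1)[of _ i k j n, OF _ ij] D closed_csubspace_UNIV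
        map_coord_annihilation map_coord_adjoint_orth_proj[OF u D])
qed

locale finite_multiplicity_subspace = invariant_subspace k n M
  for k n and M :: "(nat \<Rightarrow> nat list, 'e::chilbert_space) ell2 set" +
  assumes k_pos: "k \<ge> 1" and finite_dim: "\<exists>S :: 'e set. finite S \<and> cvec.span S = UNIV"
begin

abbreviation "D \<equiv> defect_space k n N T"

lemma D_eq: "D = closure (A ` N)"
  by (simp add: defect_space_def A_def)

lemma closed_D: "closed_csubspace D"
  unfolding D_eq
  by (intro closed_csubspace_closure subspace_image bounded_clinear_A closed_csubspaceD(6) closed_N)

text \<open>Since \<open>\<parallel>R y\<parallel> = \<parallel>vac y\<parallel>\<close> on \<open>N\<close>, there is a partial isometry \<open>u\<close> of the finite dimensional
  coefficient space onto the defect space with \<open>u (vac y) = R y\<close>.\<close>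

lemma exists_intertwiner:
  "\<exists>u. bounded_clinear u \<and> (\<forall>y\<in>N. u (vac y) = R y) \<and> range u \<subseteq> D \<and>
    (\<forall>h\<in>D. u (cadjoint u h) = h) \<and> finite_rank u"
proof -
  note vac_lin = bounded_clinearD[OF bounded_clinear_vac]
  have sub: "cvec.subspace (vac ` N)"
    by (intro subspace_image bounded_clinear_vac closed_csubspaceD(6) closed_N)
  obtain S :: "'e set" where S: "finite S" "cvec.span S = UNIV" using finite_dim by blast
  obtain B where B: "finite B" "orthonormal B" "B \<subseteq> vac ` N"
    and exp: "\<And>x. x \<in> vac ` N \<Longrightarrow> x = (\<Sum>b\<in>B. cinner x b *\<^sub>C b)"
    using finite_onb_exists[OF sub S(1)] S(2) by auto
  have "\<forall>b\<in>B. \<exists>y\<in>N. vac y = b" using B(3) by blast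
  then obtain g where g: "\<And>b. b \<in> B \<Longrightarrow> g b \<in> N" "\<And>b. b \<in> B \<Longrightarrow> vac (g b) = b" by metis
  \<comment> \<open>B is an orthonormal basis of the image of N under vac. Which preimage
    \<open>g b\<close> is taken does not matter, since R vanishes on N wherever vac does.\<close>
  define u where "u v = (\<Sum>b\<in>B. cinner v b *\<^sub>C R (g b))" for v
  have u: "bounded_clinear u"
  proof (rule bounded_clinearI[where K = "\<Sum>b\<in>B. norm b * norm (R (g b))"])
    fix x y c
    show "u (x + y) = u x + u y"
      by (simp add: u_def cinner_add_left scaleC_add_left sum.distrib)
    show "u (c *\<^sub>C x) = c *\<^sub>C u x"
      by (simp add: u_def cinner_scaleC_left scaleC_scaleC cvec.scale_sum_right)
    have "norm (u x) \<le> (\<Sum>b\<in>B. norm (cinner x b *\<^sub>C R (g b)))" unfolding u_def by (rule norm_sum)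
    also have "\<dots> \<le> (\<Sum>b\<in>B. norm x * (norm b * norm (R (g b))))"
    proof (rule sum_mono)
      fix b
      have "cmod (cinner x b) * norm (R (g b)) \<le> norm x * norm b * norm (R (g b))"
        by (intro mult_right_mono norm_cinner_le) simp
      then show "norm (cinner x b *\<^sub>C R (g b)) \<le> norm x * (norm b * norm (R (g b)))"
        by (simp add: norm_scaleC mult.assoc)
    qed
    finally show "norm (u x) \<le> (\<Sum>b\<in>B. norm b * norm (R (g b))) * norm x"
      by (simp add: sum_distrib_left[symmetric] mult.commute)
  qed
  have u_adj: "cadjoint u h = (\<Sum>b\<in>B. cinner h (R (g b)) *\<^sub>C b)" for h
  proof -
    have "cadjoint u = (\<lambda>h. \<Sum>b\<in>B. cinner h (R (g b)) *\<^sub>C b)"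
    proof (rule cadjoint_eqI)
      fix x y
      show "cinner (u x) y = cinner x (\<Sum>b\<in>B. cinner y (R (g b)) *\<^sub>C b)"
        by (simp add: u_def cinner_sum_left cinner_sum_right cinner_scaleC_left cinner_scaleC_right
            cinner_commute[symmetric] mult.commute)
    qed
    then show ?thesis by simp
  qed
  have u_vac: "u (vac y) = R y" if y: "y \<in> N" for y
  proof -
    define z where "z = y - (\<Sum>b\<in>B. cinner (vac y) b *\<^sub>C g b)"
    have zN: "z \<in> N" unfolding z_def
      by (intro closed_csubspaceD[OF closed_N] y cvec.subspace_sum[OF closed_csubspaceD(6)[OF closed_N]] g)
    have "vac z = vac y - (\<Sum>b\<in>B. cinner (vac y) b *\<^sub>C b)"
      by (simp add: z_def vac_lin g(2))
    also have "\<dots> = 0" using exp[of "vac y"] y by simp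
    finally have "R z = 0" by (intro R_eq_zero) (simp add: orth_proj_ident[OF closed_N zN])
    then show ?thesis by (simp add: z_def R_lin u_def)
  qed
  have onR: "cinner (R (g b)) (R (g b')) = cinner b b'" if "b \<in> B" "b' \<in> B" for b b'
    using that by (simp add: cinner_R orth_proj_ident[OF closed_N g(1)] g(2))
  \<comment> \<open>The images R (g b) are orthonormal by \<open>onR\<close>, so u is a partial
    isometry.\<close>
  have uuu: "u (cadjoint u (u v)) = u v" for v
  proof -
    have "cinner (u v) (R (g b')) = cinner v b'" if b': "b' \<in> B" for b'
    proof -
      have "cinner (u v) (R (g b')) = cinner (\<Sum>b\<in>B. cinner v b *\<^sub>C b) b'"
        unfolding u_def cinner_sum_left cinner_scaleC_left using onR b' by (intro sum.cong) auto
      then show ?thesis by (simp add: cinner_fourier_sum[OF B(1,2) b'])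
    qed
    then have "cadjoint u (u v) = (\<Sum>b\<in>B. cinner v b *\<^sub>C b)" by (simp add: u_adj)
    then show ?thesis unfolding u_def[of "cadjoint u (u v)"]
      by (simp add: cinner_fourier_sum[OF B(1,2)] u_def)
  qed
  have A_u: "A x \<in> range u" for x
    using u_vac[OF R_in_N, of x] by (metis R(3) rangeI)
  have D_fix: "u (cadjoint u h) = h" if "h \<in> D" for h
  proof -
    note lin = bounded_clinearD(3)[OF bounded_clinear_compose[OF u bounded_clinear_cadjoint[OF u]]]
    have "closed {h. u (cadjoint u h) = h}"
      by (intro closed_Collect_eq linear_continuous_on[OF lin] continuous_on_id)
    moreover have "A ` N \<subseteq> {h. u (cadjoint u h) = h}" 
    proof
      fix h assume "h \<in> A ` N"
      then obtain v where "h = u v" using A_u by blast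
      then show "h \<in> {h. u (cadjoint u h) = h}" by (simp add: uuu)
    qed
    ultimately have "D \<subseteq> {h. u (cadjoint u h) = h}" unfolding D_eq by (intro closure_minimal)
    then show ?thesis using that by blast
  qed
  \<comment> \<open>The residual h' of h modulo D has the form R y and is orthogonal to A h'. Hence
    R h' = 0, and \<open>cinner h' h' = cinner (R h') y = 0\<close>.\<close>
  have "h \<in> D" if h: "h \<in> range u" for h
  proof -
    define h' where "h' = h - orth_proj D h"
    have PD: "u (cadjoint u (orth_proj D h)) = orth_proj D h" by (rule D_fix[OF orth_proj_in[OF closed_D]])
    obtain v where hv: "h = u v" using h by blast
    have "h' = u (v - cadjoint u (orth_proj D h))"
      unfolding h'_def bounded_clinearD(5)[OF u] PD hv[symmetric] ..
    then obtain w where w: "h' = u w" by blast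
    define y where "y = (\<Sum>b\<in>B. cinner w b *\<^sub>C g b)"
    have y: "h' = R y" unfolding w u_def y_def R_lin(6) R_lin(2) ..
    have h'N: "h' \<in> N" unfolding y by (rule R_in_N)
    have "A h' \<in> D" unfolding D_eq by (rule subsetD[OF closure_subset imageI[OF h'N]])
    then have "cinner h' (A h') = 0" unfolding h'_def by (rule orth_proj_orth[OF closed_D])
    then have "cinner (R h') (R h') = 0"
      using positive_op_selfadjoint[OF R(1,2), of h' "R h'"] by (simp only: R(3))
    then have "R h' = 0" by simp
    then have "cinner h' h' = 0"
      using positive_op_selfadjoint[OF R(1,2), of h' y] y by simp
    then have "h = orth_proj D h" by (simp add: h'_def)
    then show ?thesis using orth_proj_in[OF closed_D, of h] by simp
  qed
  moreover have "finite_rank u"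
    unfolding finite_rank_def
  proof (intro exI conjI)
    show "range u \<subseteq> cvec.span ((\<lambda>b. R (g b)) ` B)"
      unfolding u_def
      by (rule image_subsetI) (intro cvec.span_sum cvec.span_scale cvec.span_base imageI)
  qed (use B(1) in simp)
  ultimately show ?thesis using u u_vac D_fix by blast
qed

definition "u = (SOME u. bounded_clinear u \<and> (\<forall>y\<in>N. u (vac y) = R y) \<and> range u \<subseteq> D \<and>
    (\<forall>h\<in>D. u (cadjoint u h) = h) \<and> finite_rank u)"

lemma u:
  shows "bounded_clinear u" "\<And>y. y \<in> N \<Longrightarrow> u (vac y) = R y" "range u \<subseteq> D"
    "\<And>h. h \<in> D \<Longrightarrow> u (cadjoint u h) = h" "finite_rank u"
  using someI_ex[OF exists_intertwiner] unfolding u_def[symmetric] by blast+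

lemma finite_rank_A: "finite_rank A"
proof -
  have "A x \<in> range u" for x using u(2)[OF R_in_N, of x] by (metis R(3) rangeI)
  then show ?thesis using u(5) unfolding finite_rank_def by blast
qed

text \<open>The coefficient at \<beta> is R applied to the projection of h onto N with \<beta>
  deleted. On N applying R is applying u after vac, which gives u of the coordinate at
  \<beta>.\<close>

lemma berezin_kernel_eq: "berezin_kernel k n N T h = map_coord u (orth_proj N h)"
proof -
  let ?y = "\<lambda>\<beta>. foldr (\<lambda>i x. cadjoint (word_op N (T i) (\<beta> i)) x) [1..<Suc k] h"
  have NF: "orth_proj N h \<in> F" using orth_proj_in[OF closed_N] N_subset by blast
  have "elem_tensor k (\<lambda>i. ket (\<beta> i)) (R (?y \<beta>)) = single \<beta> (coord (map_coord u (orth_proj N h)) \<beta>)"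
    if \<beta>: "\<beta> \<in> words k n" for \<beta>
  proof -
    have "?y \<beta> = foldr (\<lambda>i x. cadjoint (word_op N (T i) (\<beta> i)) x) [1..<Suc k] (orth_proj N h)"
      by (rule foldr_word_op_orth_proj_N[OF \<beta>]) (use k_pos in auto)
    then have "?y \<beta> \<in> N" "vac (?y \<beta>) = coord (orth_proj N h) \<beta>"
      using coord_eq_vac[OF \<beta> orth_proj_in[OF closed_N]] by auto
    then have "R (?y \<beta>) = coord (map_coord u (orth_proj N h)) \<beta>"
      using u(2)[of "?y \<beta>"] by (simp add: map_coord.rep_eq u(1))
    then show ?thesis using \<beta> by (simp add: elem_tensor_ket words_iff)
  qed
  then have "berezin_kernel k n N T h
      = (\<Sum>\<^sub>\<infinity>\<beta>\<in>words k n. single \<beta> (coord (map_coord u (orth_proj N h)) \<beta>))"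
    unfolding berezin_kernel_def words_def[symmetric] A_def[symmetric] R_def[symmetric]
    by (intro infsum_cong) simp
  also have "\<dots> = map_coord u (orth_proj N h)"
  proof (rule infsumI[OF ell2_has_sum_single])
    fix \<beta> assume "coord (map_coord u (orth_proj N h)) \<beta> \<noteq> 0"
    then have "coord (orth_proj N h) \<beta> \<noteq> 0"
      using bounded_clinearD(4)[OF u(1)] by (auto simp: map_coord.rep_eq u(1))
    then show "\<beta> \<in> words k n"
      using sym_familyD(1)[of "orth_proj N h" k n UNIV \<beta>] NF by (auto simp: fock_tensor_eq[OF closed_csubspace_UNIV])
  qed
  finally show ?thesis .
qed

abbreviation "K \<equiv> constr_berezin_kernel k n N T"

text \<open>The kernel already takes values in the symmetric space, so the projection of the
  constrained kernel acts trivially.\<close>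

lemma K_eq: "K = (\<lambda>h. map_coord u (orth_proj N h))"
proof
  fix h
  have "orth_proj N h \<in> F" using orth_proj_in[OF closed_N] N_subset by blast
  from map_coord_in_fock_tensor[OF u(1,3) this closed_D] show "K h = map_coord u (orth_proj N h)"
    by (simp add: constr_berezin_kernel_def berezin_kernel_eq orth_proj_ident[OF closed_csubspace_fock_tensor])
qed

lemma cadjoint_K: "cadjoint K = (\<lambda>x. orth_proj N (map_coord (cadjoint u) x))"
  by (rule cadjoint_eqI) (simp add: K_eq cinner_map_coord[OF u(1)] orth_proj_selfadjoint[OF closed_N])

text \<open>Put J = I \<otimes> u and \<Theta> = J \<Psi>. Both products are sandwiched between J
  and its adjoint, and the projections onto N and M add up to that onto F. This leaves J J* on the
  space with coefficients in D, where u u* is the identity.\<close>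

lemma has_char_function_T:
  fixes \<Psi> :: "(nat \<Rightarrow> nat list, 'g::chilbert_space) ell2 \<Rightarrow> (nat \<Rightarrow> nat list, 'e) ell2"
  assumes \<Psi>: "multi_analytic k n UNIV UNIV \<Psi>" and range: "\<And>x. \<Psi> (cadjoint \<Psi> x) = orth_proj M x"
  shows "has_char_function TYPE('g) k n N T"
proof -
  have \<Psi>b: "\<Psi> \<in> bop (fock_tensor k n UNIV) F"
    and \<Psi>s: "\<And>i j. i \<in> {1..k} \<Longrightarrow> j \<in> {1..n i} \<Longrightarrow> \<Psi> \<circ> shift_op k n i j UNIV = shift_op k n i j UNIV \<circ> \<Psi>"
    using \<Psi> unfolding multi_analytic_def by blast+
  note Jlin = bounded_clinear_map_coord[OF u(1)]
  define \<Theta> where "\<Theta> x = map_coord u (\<Psi> x)" for x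
  have "\<Theta> \<in> bop (fock_tensor k n UNIV) (fock_tensor k n D)"
    unfolding bop_def
  proof (intro CollectI conjI ballI)
    show "bounded_clinear \<Theta>"
      unfolding \<Theta>_def by (rule bounded_clinear_compose[OF Jlin bopD(1)[OF \<Psi>b]])
    show "range \<Theta> \<subseteq> fock_tensor k n D"
      using map_coord_in_fock_tensor[OF u(1,3) bopD(2)[OF \<Psi>b] closed_D] by (auto simp: \<Theta>_def)
    fix x :: "(nat \<Rightarrow> nat list, 'g) ell2" assume "x \<in> orth_compl_in UNIV (fock_tensor k n UNIV)"
    then have "\<Psi> x = 0" by (intro bopD(3)[OF \<Psi>b]) (auto simp: orth_compl_in_def)
    then show "\<Theta> x = 0" by (simp add: \<Theta>_def bounded_clinearD(4)[OF Jlin])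
  qed
  moreover have "\<Theta> \<circ> shift_op k n i j UNIV = shift_op k n i j D \<circ> \<Theta>"
    if ij: "i \<in> {1..k}" "j \<in> {1..n i}" for i j
  proof
    fix x
    show "(\<Theta> \<circ> shift_op k n i j UNIV) x = (shift_op k n i j D \<circ> \<Theta>) x"
      using fun_cong[OF \<Psi>s[OF ij], of x] map_coord_shift_op[of u D i k j n, OF u(1,3) closed_D ij]
      by (simp add: \<Theta>_def)
  qed
  ultimately have "multi_analytic k n UNIV D \<Theta>" by (simp add: multi_analytic_def)
  moreover have "K (cadjoint K x) + \<Theta> (cadjoint \<Theta> x) = orth_proj (fock_tensor k n D) x" for x
  proof -
    let ?J = "map_coord u" and ?J' = "map_coord (cadjoint u)"
    have "cadjoint \<Theta> = (\<lambda>x. cadjoint \<Psi> (?J' x))"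
      by (rule cadjoint_eqI) (simp add: \<Theta>_def cinner_map_coord[OF u(1)] cadjoint[OF bopD(1)[OF \<Psi>b]])
    then have "K (cadjoint K x) + \<Theta> (cadjoint \<Theta> x) = ?J (orth_proj N (?J' x) + orth_proj M (?J' x))"
      unfolding cadjoint_K
      by (simp add: K_eq \<Theta>_def range bounded_clinearD(1)[OF Jlin]
          orth_proj_ident[OF closed_N orth_proj_in[OF closed_N]])
    also have "\<dots> = ?J (?J' (orth_proj (fock_tensor k n D) x))"
      by (simp add: orth_proj_N map_coord_adjoint_orth_proj[OF u(1,3) closed_D])
    also have "\<dots> = orth_proj (fock_tensor k n D) x"
    proof (rule ell2_eqI)
      fix \<beta>
      have "coord (orth_proj (fock_tensor k n D) x) \<beta> \<in> D"
        using orth_proj_in[OF closed_csubspace_fock_tensor, of k n D x]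
        unfolding fock_tensor_eq[OF closed_D] by (rule sym_familyD(2))
      then show "coord (?J (?J' (orth_proj (fock_tensor k n D) x))) \<beta> = coord (orth_proj (fock_tensor k n D) x) \<beta>"
        by (simp add: map_coord.rep_eq u(1,4) bounded_clinear_cadjoint)
    qed
    finally show ?thesis .
  qed
  ultimately show ?thesis unfolding has_char_function_def Let_def by blast
qed

text \<open>For e in N the coordinates are vacuum coefficients of vectors of N, whose norms u
  preserves; so the form is that of Q on N. Each basis vector contributes the squared norm of its
  N-component, which is 1 minus that of its M-component.\<close>

lemma trace_curvature:
  assumes B: "finite_onb B"
  shows "trace_on N (cadjoint K \<circ> Q_op k n q D \<circ> K)
    = complex_of_real (real (card (multi_types k n q) * card B) - proj_weight k n M B q)"
proof -
  let ?U = "multi_types k n q \<times> B" and ?u = "\<lambda>(\<mu>, b). sym_vec k \<mu> b"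
  have fin: "finite ?U" using finite_onbD(1)[OF B] finite_multi_types by blast
  have "trace_on N (cadjoint K \<circ> Q_op k n q D \<circ> K) = (\<Sum>v\<in>?U. cinner (orth_proj N (?u v)) (?u v))"
  proof (rule trace_on_finite_rank[OF closed_N fin])
    fix e assume e: "e \<in> N"
    then have eF: "e \<in> F" using N_subset by blast
    have Ke: "K e = map_coord u e" by (simp add: K_eq orth_proj_ident[OF closed_N e])
    have KeF: "K e \<in> fock_tensor k n D"
      unfolding Ke by (rule map_coord_in_fock_tensor[OF u(1,3) eF closed_D])
    have "cinner ((cadjoint K \<circ> Q_op k n q D \<circ> K) e) e = cinner (Q_op k n q D (K e)) (K e)"
      unfolding o_def cadjoint_K orth_proj_selfadjoint[OF closed_N] orth_proj_ident[OF closed_N e] Ke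
      by (subst (1 2) cinner_commute) (simp add: cinner_map_coord[OF u(1)])
    also have "\<dots> = cinner (ell2_restrict (degree_words k n q) (map_coord u e)) (map_coord u e)"
      by (simp add: Q_op_eq[OF closed_D] orth_proj_ident[OF closed_csubspace_fock_tensor KeF[unfolded Ke]] Ke)
    also have "\<dots> = cinner (ell2_restrict (degree_words k n q) e) e"
      unfolding cinner_ell2_def[of _ "map_coord u e"] cinner_ell2_def[of _ e]
    proof (rule infsum_cong)
      fix \<beta> :: "nat \<Rightarrow> nat list"
      have iso: "cinner (u (coord e \<beta>)) (u (coord e \<beta>)) = cinner (coord e \<beta>) (coord e \<beta>)"
        if \<beta>: "\<beta> \<in> degree_words k n q"
      proof -
        have w: "\<beta> \<in> words k n" using \<beta> by (simp add: degree_words_def)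
        define y where "y = foldr (\<lambda>i x. cadjoint (word_op N (T i) (\<beta> i)) x) [1..<Suc k] e"
        have y: "y \<in> N" "vac y = coord e \<beta>" unfolding y_def using coord_eq_vac[OF w e] by auto
        then show ?thesis using u(2)[OF y(1)] cinner_R[of y y] by (simp add: orth_proj_ident[OF closed_N])
      qed
      then show "cinner (coord (ell2_restrict (degree_words k n q) (map_coord u e)) \<beta>) (coord (map_coord u e) \<beta>)
          = cinner (coord (ell2_restrict (degree_words k n q) e) \<beta>) (coord e \<beta>)"
        by (simp add: ell2_restrict.rep_eq map_coord.rep_eq u(1))
    qed
    also have "\<dots> = (\<Sum>v\<in>?U. cinner e (?u v) * cinner (?u v) e)"
      unfolding sym_vec_expansion[OF eF B] cinner_sum_left by (simp add: case_prod_unfold cinner_scaleC_left)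
    finally show "cinner ((cadjoint K \<circ> Q_op k n q D \<circ> K) e) e = (\<Sum>v\<in>?U. cinner e (?u v) * cinner (?u v) e)" .
  qed
  also have "\<dots> = (\<Sum>(\<mu>, b)\<in>?U. complex_of_real (1 - (norm (orth_proj M (sym_vec k \<mu> b)))\<^sup>2))"
  proof (rule sum.cong)
    fix v assume "v \<in> ?U"
    then obtain \<mu> b where v: "v = (\<mu>, b)" "\<mu> \<in> multi_types k n q" "b \<in> B" by blast
    show "cinner (orth_proj N (?u v)) (?u v)
        = (case v of (\<mu>, b) \<Rightarrow> complex_of_real (1 - (norm (orth_proj M (sym_vec k \<mu> b)))\<^sup>2))"
      using finite_onbD(2)[OF B v(3)]
      by (simp add: v orth_proj_N cinner_diff_left orth_proj_ident[OF closed_F sym_vec_in_fock_tensor[OF v(2)]]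
          norm_sym_vec[OF v(2)] cinner_orth_proj_self[OF closed_M])
  qed simp
  also have "\<dots> = complex_of_real (real (card (multi_types k n q) * card B) - proj_weight k n M B q)"
    unfolding proj_weight_def by (simp add: case_prod_unfold sum_subtractf card_cartesian_product)
  finally show ?thesis .
qed

end

text \<open>\<Psi> intertwines the shifts, so its range M is invariant under them, and adjoints
  carry the complement into itself. Closedness and the projection formula hold because \<Psi> is a
  partial isometry.\<close>

lemma beurling_invariant_subspace:
  fixes \<Psi> :: "(nat \<Rightarrow> nat list, 'g::chilbert_space) ell2 \<Rightarrow> (nat \<Rightarrow> nat list, 'e::chilbert_space) ell2"
  assumes \<Psi>: "multi_analytic k n UNIV UNIV \<Psi>" and iso: "partial_isometry_on (fock_tensor k n UNIV) \<Psi>"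
    and M: "M = \<Psi> ` fock_tensor k n UNIV"
  shows "invariant_subspace k n M" "\<Psi> (cadjoint \<Psi> x) = orth_proj M x"
proof -
  let ?F = "fock_tensor k n (UNIV :: 'e set)" and ?G = "fock_tensor k n (UNIV :: 'g set)"
  have \<Psi>b: "\<Psi> \<in> bop ?G ?F"
    and \<Psi>s: "\<And>i j. i \<in> {1..k} \<Longrightarrow> j \<in> {1..n i} \<Longrightarrow> \<Psi> \<circ> shift_op k n i j UNIV = shift_op k n i j UNIV \<circ> \<Psi>"
    using \<Psi> unfolding multi_analytic_def by blast+
  have \<Psi>u: "\<Psi> \<in> bop ?G UNIV" using \<Psi>b by (auto simp: bop_def)
  show "\<Psi> (cadjoint \<Psi> x) = orth_proj M x"
    unfolding M by (rule partial_isometry_range(2)[OF \<Psi>u closed_csubspace_fock_tensor iso])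
  have cl: "closed_csubspace M"
    unfolding M by (rule partial_isometry_range(1)[OF \<Psi>u closed_csubspace_fock_tensor iso])
  show "invariant_subspace k n M"
  proof
    show "M \<subseteq> ?F" unfolding M using bopD(2)[OF \<Psi>b] by blast
    fix x i j assume x: "x \<in> orth_compl_in ?F M" and ij: "i \<in> {1..k}" "j \<in> {1..n i}"
    have xF: "x \<in> ?F" using x by (simp add: orth_compl_in_def)
    have "cinner (annihilation i j x) m = 0" if m: "m \<in> M" for m
    proof -
      obtain g where g: "m = \<Psi> g" using m M by blast
      have "shift_op k n i j UNIV m = \<Psi> (orth_proj ?G (shift_op k n i j UNIV g))"
        using fun_cong[OF \<Psi>s[OF ij], of g] by (simp add: g bop_orth_proj[OF \<Psi>b closed_csubspace_fock_tensor])
      then have "shift_op k n i j UNIV m \<in> M"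
        unfolding M using orth_proj_in[OF closed_csubspace_fock_tensor] by blast
      then have "cinner x (shift_op k n i j UNIV m) = 0" using x by (simp add: orth_compl_in_def)
      then have "cinner (shift_op k n i j UNIV m) x = 0" by (simp only: cinner_zero_commute)
      then have "cinner m (annihilation i j x) = 0"
        by (simp add: shift_op_adjoint(1)[of UNIV i k j n, OF closed_csubspace_UNIV ij]
            orth_proj_ident[OF closed_csubspace_fock_tensor xF])
      then show ?thesis by (simp only: cinner_zero_commute)
    qed
    then show "annihilation i j x \<in> orth_compl_in ?F M"
      using annihilation_in_fock_tensor[of x k n UNIV i j, OF xF ij closed_csubspace_UNIV]
      by (simp add: orth_compl_in_def)
  qed (rule cl)
qed

lemma card_finite_onb:
  assumes B: "finite_onb (B :: 'e::chilbert_space set)"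
  shows "card B = cvec.dim (UNIV :: 'e set)"
proof -
  have "cvec.independent B" using B by (intro orthonormal_independent) (auto simp: finite_onb_def)
  moreover have "v \<in> cvec.span B" for v
  proof -
    have "(\<Sum>b\<in>B. cinner v b *\<^sub>C b) \<in> cvec.span B"
      by (intro cvec.span_sum cvec.span_scale cvec.span_base)
    then show ?thesis by (simp add: finite_onbD(3)[OF B])
  qed
  ultimately show ?thesis by (intro cvec.dim_eq_card[symmetric]) auto
qed

theorem theorem5p8:
  fixes k :: nat and n :: "nat \<Rightarrow> nat"
    and M :: "(nat \<Rightarrow> nat list, 'e::chilbert_space) ell2 set"
  defines "N \<equiv> orth_compl_in (fock_tensor k n (UNIV :: 'e set)) M"
  assumes "k \<ge> 1"
    and "\<forall>i\<in>{1..k}. n i \<ge> 1"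
    and "\<exists>i\<in>{1..k}. n i \<ge> 2"
    and "\<exists>S :: 'e set. finite S \<and> cvec.span S = UNIV"
    and "beurling_type TYPE('g::chilbert_space) k n M"
  shows "convergent (mult_seq k n M) \<and>
    ((\<lambda>q. trace_on (fock_tensor k n UNIV) (orth_proj M \<circ> Q_op k n q UNIV) /
          trace_on (fock_tensor k n (UNIV :: complex set)) (Q_op k n q UNIV))
       \<longlongrightarrow> multiplicity_c k n M) (multi_at_top k) \<and>
    has_iterated_lim k
      (\<lambda>q. trace_on (fock_tensor k n UNIV) (orth_proj M \<circ> Q_le_op k n q UNIV) /
           trace_on (fock_tensor k n (UNIV :: complex set)) (Q_le_op k n q UNIV))
      (multiplicity_c k n M) \<and>
    (\<lambda>m. 1 / of_nat ((m + k - 1) choose (k - 1)) *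
         (\<Sum>q | q \<in> multi_indices k \<and> (\<Sum>i = 1..k. q i) = m.
            trace_on (fock_tensor k n UNIV) (orth_proj M \<circ> Q_op k n q UNIV) /
            trace_on (fock_tensor k n (UNIV :: complex set)) (Q_op k n q UNIV)))
       \<longlonglongrightarrow> multiplicity_c k n M \<and>
    compression k n N \<in> comm_polyball k n N \<and>
    has_char_function TYPE('g) k n N (compression k n N) \<and>
    finite_rank (defect_op k n N (compression k n N)) \<and>
    convergent (curv_seq k n N (compression k n N)) \<and>
    multiplicity_c k n M =
      of_nat (cvec.dim (UNIV :: 'e set)) - curv_c k n N (compression k n N)"
proof -
  obtain \<Psi> :: "(nat \<Rightarrow> nat list, 'g) ell2 \<Rightarrow> (nat \<Rightarrow> nat list, 'e) ell2"
    where \<Psi>: "multi_analytic k n UNIV UNIV \<Psi>" "partial_isometry_on (fock_tensor k n UNIV) \<Psi>"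
      "M = \<Psi> ` fock_tensor k n UNIV"
    using assms(6) unfolding beurling_type_def by blast
  interpret X: invariant_subspace k n M by (rule beurling_invariant_subspace(1)[OF \<Psi>])
  interpret X: finite_multiplicity_subspace k n M
    by unfold_locales (use assms in auto)
  obtain S :: "'e set" where S: "finite S" "cvec.span S = UNIV" using assms(5) by blast
  obtain B :: "'e set" where B: "finite_onb B"
    using finite_onb_exists[of UNIV S] S by (auto simp: finite_onb_def)
  have n: "n i \<ge> 1" if "i \<in> {1..k}" for i using assms(3) that by blast
  define d where "d q = real (card (multi_types k n q))" for q
  define a where "a q = proj_weight k n M B q / d q" for q
  have d: "d q > 0" for q
    unfolding d_def card_multi_types of_nat_prod
    by (intro prod_pos) (use card_multisets_of_size_pos n in simp)
  interpret net: bounded_increasing_net k a "real (card B)"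
    unfolding a_def d_def by (rule X.bounded_increasing_net_weight[OF B n])
  let ?L = "complex_of_real net.L"
  have ratio: "trace_on (fock_tensor k n UNIV) (orth_proj M \<circ> Q_op k n q UNIV) /
      trace_on (fock_tensor k n (UNIV :: complex set)) (Q_op k n q UNIV) = complex_of_real (a q)" for q
    by (simp add: trace_proj_Q[OF X.closed_M X.M_subset B] trace_Q a_def d_def)
  \<comment> \<open>The product of the single factor traces counts the same tuples of multisets as
    the trace on the tensor product.\<close>
  have "trace_on (fock_tensor k n UNIV) (orth_proj M \<circ> Q_op k n q UNIV) /
      (\<Prod>i = 1..k. trace_on (sym_fock (n i)) (degree_proj (n i) (q i))) = complex_of_real (a q)" for q
    by (simp add: trace_proj_Q[OF X.closed_M X.M_subset B] trace_degree_proj a_def d_def card_multi_types)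
  then have mult_seq: "mult_seq k n M m = complex_of_real ((\<Sum>q\<in>corner k m. a q) / real (card (corner k m)))" for m
    unfolding mult_seq_def corner_def[symmetric] card_corner[OF assms(2), symmetric] by simp
  have corner: "(\<lambda>m. (\<Sum>q\<in>corner k m. a q) / real (card (corner k m))) \<longlonglongrightarrow> net.L"
    by (rule net.average_tendsto[OF finite_corner _ corner_ratio_tendsto[OF assms(2)]])
      (auto simp: corner_def)
  have mult_lim: "mult_seq k n M \<longlonglongrightarrow> ?L" unfolding mult_seq[abs_def] by (rule tendsto_of_real[OF corner])
  then have mult: "multiplicity_c k n M = ?L" unfolding multiplicity_c_def by (rule limI)
  have "((\<lambda>q. complex_of_real (a q)) \<longlongrightarrow> ?L) (multi_at_top k)"
    by (rule tendsto_of_real[OF net.tendsto_multi_at_top])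
  then have net_lim: "((\<lambda>q. trace_on (fock_tensor k n UNIV) (orth_proj M \<circ> Q_op k n q UNIV) /
      trace_on (fock_tensor k n (UNIV :: complex set)) (Q_op k n q UNIV)) \<longlongrightarrow> ?L) (multi_at_top k)"
    by (simp only: ratio)
  \<comment> \<open>The value 1 outside \<open>{1..k}\<close> secures the bound
    \<open>w i r \<ge> 1\<close> for all i.\<close>
  define w where "w i r = (if i \<in> {1..k} then real (card (multisets_of_size {1..n i} r)) else 1)" for i r
  have w: "w i r \<ge> 1" for i r
    using card_multisets_of_size_pos[OF n, of i r] by (simp add: w_def Suc_leI)
  have prod_w: "(\<Prod>i=1..k. w i (s i)) = d s" for s
    unfolding d_def card_multi_types of_nat_prod by (rule prod.cong) (simp_all add: w_def)
  have "trace_on (fock_tensor k n UNIV) (orth_proj M \<circ> Q_le_op k n q UNIV) /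
      trace_on (fock_tensor k n (UNIV :: complex set)) (Q_le_op k n q UNIV)
      = complex_of_real (box_average w k a q)" for q
  proof -
    \<comment> \<open>The weights of the box average undo the normalization of a.\<close>
    have "d s * a s = proj_weight k n M B s" for s using d[of s] by (simp add: a_def)
    then show ?thesis
      unfolding trace_proj_Q_le[OF X.closed_M X.M_subset B] trace_Q_le box_average_def prod_w
      by (simp add: d_def)
  qed
  then have iter_lim: "has_iterated_lim k
      (\<lambda>q. trace_on (fock_tensor k n UNIV) (orth_proj M \<circ> Q_le_op k n q UNIV) /
           trace_on (fock_tensor k n (UNIV :: complex set)) (Q_le_op k n q UNIV)) ?L"
    using box_average_iterated_lim[OF w net.bounded_increasing_net_axioms] by simp
  have "(\<lambda>m. complex_of_real ((\<Sum>q\<in>shell k m. a q) / real (card (shell k m)))) \<longlonglongrightarrow> ?L"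
    by (rule tendsto_of_real[OF net.average_tendsto[OF finite_shell _ shell_ratio_tendsto[OF assms(2)]]])
      (auto simp: shell_def)
  moreover have "1 / of_nat ((m + k - 1) choose (k - 1)) *
      (\<Sum>q | q \<in> multi_indices k \<and> (\<Sum>i = 1..k. q i) = m. complex_of_real (a q))
      = complex_of_real ((\<Sum>q\<in>shell k m. a q) / real (card (shell k m)))" for m
    unfolding shell_def[symmetric] card_shell[OF assms(2)] using assms(2) by simp
  ultimately have shell_lim: "(\<lambda>m. 1 / of_nat ((m + k - 1) choose (k - 1)) *
      (\<Sum>q | q \<in> multi_indices k \<and> (\<Sum>i = 1..k. q i) = m.
        trace_on (fock_tensor k n UNIV) (orth_proj M \<circ> Q_op k n q UNIV) /
        trace_on (fock_tensor k n (UNIV :: complex set)) (Q_op k n q UNIV))) \<longlonglongrightarrow> ?L"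
    by (simp only: ratio)
  have curv_seq: "curv_seq k n N (compression k n N) m
      = complex_of_real (real (card B) - (\<Sum>q\<in>corner k m. a q) / real (card (corner k m)))" for m
  proof -
    have "trace_on X.N (cadjoint X.K \<circ> Q_op k n q X.D \<circ> X.K) /
        trace_on (fock_tensor k n (UNIV :: complex set)) (Q_op k n q UNIV) = complex_of_real (real (card B) - a q)" for q
      using d[of q] unfolding X.trace_curvature[OF B] trace_Q
      by (simp add: a_def d_def diff_divide_distrib)
    then have "curv_seq k n N (compression k n N) m
        = complex_of_real ((\<Sum>q\<in>corner k m. real (card B) - a q) / real (card (corner k m)))"
      unfolding curv_seq_def N_def corner_def[symmetric] card_corner[OF assms(2), symmetric] by simp
    also have "(\<Sum>q\<in>corner k m. real (card B) - a q) / real (card (corner k m))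
        = real (card B) - (\<Sum>q\<in>corner k m. a q) / real (card (corner k m))"
      using card_corner[OF assms(2), of m]
      by (simp add: sum_subtractf diff_divide_distrib)
    finally show ?thesis .
  qed
  have "(\<lambda>m. real (card B) - (\<Sum>q\<in>corner k m. a q) / real (card (corner k m))) \<longlonglongrightarrow> real (card B) - net.L"
    by (intro tendsto_diff tendsto_const corner)
  then have curv_lim: "curv_seq k n N (compression k n N) \<longlonglongrightarrow> complex_of_real (real (card B) - net.L)"
    unfolding curv_seq[abs_def] by (rule tendsto_of_real)
  then have curv: "curv_c k n N (compression k n N) = of_nat (card B) - ?L"
    unfolding curv_c_def using limI by force
  have "finite_rank (defect_op k n N (compression k n N))"
    using X.finite_rank_A by (simp add: X.A_def N_def)
  moreover have "convergent (mult_seq k n M)" "convergent (curv_seq k n N (compression k n N))"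
    using mult_lim curv_lim by (auto simp: convergent_def)
  moreover have "compression k n N \<in> comm_polyball k n N"
    unfolding N_def by (rule X.T_in_comm_polyball)
  moreover have "has_char_function TYPE('g) k n N (compression k n N)"
    unfolding N_def by (rule X.has_char_function_T[OF \<Psi>(1) beurling_invariant_subspace(2)[OF \<Psi>]])
  ultimately show ?thesis
    using net_lim iter_lim shell_lim
    unfolding mult curv card_finite_onb[OF B, symmetric] by simp
qed

end
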